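(* Let $A=S(V,N)$ be the $N$-symmetric algebra of $V$, let $P,Q$ be $A$-bimodules, and let $p,q\ge 0$ be such that $\nu(p+q)\ne\nu(p)+\nu(q)$ (that is, $N>2$ and $p,q$ are both odd). Let $f:\bigwedge^{\nu(p)}V\to P$ and $g:\bigwedge^{\nu(q)}V\to Q$ be $k$-linear maps, viewed as Koszul cochains via the isomorphisms $\phi_m:\bigwedge^m V\to Ant_m(V^{\otimes m})$. Then for all elements $x_1<\cdots<x_{\nu(p+q)}$ of the ordered basis $(e_1,\ldots,e_n)$ of $V$, the Koszul cup product, viewed as a map $\bigwedge^{\nu(p+q)}V\to P\otimes_A Q$, is given by $$\begin{aligned}(f\underset{K}{\smile} g)(x_1\wedge\cdots\wedge x_{\nu(p+q)})=-\sum_{0\le i+j\le N-2}\ \sum_{\sigma\in Sh(i,\nu(p),\nu(q),j)}&\mathrm{sgn}(\sigma)\, x_{\sigma(1)}\ldots x_{\sigma(i)}\, f(x_{\sigma(i+1)}\wedge\cdots\wedge x_{\sigma(i+\nu(p))})\, x_{\sigma(i+\nu(p)+1)}\ldots x_{\sigma(\nu(p)+N-j-2)}\\ &\otimes_A g(x_{\sigma(\nu(p)+N-j-1)}\wedge\cdots\wedge x_{\sigma(\nu(p)+\nu(q)+N-j-2)})\, x_{\sigma(\nu(p)+\nu(q)+N-j-1)}\ldots x_{\sigma(\nu(p+q))},\end{aligned}$$ where the outer sum is over integers $i,j\ge0$.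
   Context: $k$ is a field, $V$ a $k$-vector space of finite dimension $n\ge 2$ with ordered basis $(e_1,\ldots,e_n)$ (with $e_1<\cdots<e_n$), and $N$ is an integer with $2\le N\le n$. Tensor symbols $\otimes$ between elements of $V$ are omitted. For $m\ge1$, $Ant_m:V^{\otimes m}\to V^{\otimes m}$ is the linear map $Ant_m(z)=\sum_{\sigma\in\Sigma_m}\mathrm{sgn}(\sigma)\,\sigma\cdot z$, where $\Sigma_m$ is the group of permutations of $\{1,\ldots,m\}$ and $\sigma\cdot(x_1\ldots x_m)=x_{\sigma^{-1}(1)}\ldots x_{\sigma^{-1}(m)}$; $Ant_0=\mathrm{Id}_k$. There is an isomorphism $\phi_m:\bigwedge^m V\to Ant_m(V^{\otimes m})$, $e_{i_1}\wedge\cdots\wedge e_{i_m}\mapsto Ant_m(e_{i_1}\ldots e_{i_m})$ for $i_1<\cdots<i_m$. The $N$-symmetric algebra is $A=S(V,N)=T(V)/(R)$ with $R=Ant_N(V^{\otimes N})$. Elements of $V$ appearing as factors in bimodules mean their images in $A$. Put $W_m=\bigcap_{i+N+j=m}V^{\otimes i}\otimes R\otimes V^{\otimes j}\subseteq V^{\otimes m}$ (so $W_m=V^{\otimes m}$ for $m<N$). Define $\nu(2p')=Np'$ and $\nu(2p'+1)=Np'+1$. For all $p$ one has $W_{\nu(p)}=Ant_{\nu(p)}(V^{\otimes\nu(p)})$, so a Koszul $p$-cochain with coefficients in a bimodule $P$, i.e. a $k$-linear map $f:W_{\nu(p)}\to P$, is identified with the linear map $f\circ\phi_{\nu(p)}:\bigwedge^{\nu(p)}V\to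 P$, denoted by the same letter. Koszul cup product: for Koszul cochains $f:W_{\nu(p)}\to P$ and $g:W_{\nu(q)}\to Q$, $f\underset{K}{\smile}g:W_{\nu(p+q)}\to P\otimes_AQ$ is defined as follows, where an element of $W_{\nu(p+q)}$ is written as a (sum of) $x_1\ldots x_{\nu(p+q)}$ and $f,g$ are applied to the indicated tensor positions, using the inclusions of $W_{\nu(p+q)}$ in $V^{\otimes i}\otimes W_{\nu(p)}\otimes V^{\otimes l}\otimes W_{\nu(q)}\otimes V^{\otimes j}$. (1) If $p,q$ are not both odd (so $\nu(p+q)=\nu(p)+\nu(q)$): $(f\underset{K}{\smile}g)(x_1\ldots x_{\nu(p+q)})=f(x_1\ldots x_{\nu(p)})\otimes_A g(x_{\nu(p)+1}\ldots x_{\nu(p)+\nu(q)})$. (2) If $p,q$ are both odd (so $\nu(p+q)=\nu(p)+\nu(q)+N-2$): $(f\underset{K}{\smile}g)(x_1\ldots x_{\nu(p+q)})=-\sum_{0\le i+j\le N-2}x_1\ldots x_i\,f(x_{i+1}\ldots x_{i+\nu(p)})\,x_{i+\nu(p)+1}\ldots x_{\nu(p)+N-j-2}\otimes_A g(x_{\nu(p)+N-j-1}\ldots x_{\nu(p)+\nu(q)+N-j-2})\,x_{\nu(p)+\nu(q)+N-j-1}\ldots x_{\nu(p)+\nu(q)+N-2}$, the sum being over $i,j\ge0$. $Sh(i,\nu(p),\nu(q),j)$ denotes the set of permutations $\sigma$ of $\{1,\ldots,\nu(p+q)\}$ that are increasing on $\{i+1,\ldots,i+\nu(p)\}$ and increasing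 on $\{\nu(p)+N-j-1,\ldots,\nu(p)+\nu(q)+N-j-2\}$ (no condition on the other indices). *)

theory Defs
  imports "HOL-Algebra.Algebra" "HOL-Combinatorics.Combinatorics" "HOL-Library.Poly_Mapping"
begin

section \<open>The tensor algebra\<close>

text \<open>With concatenation as addition, \<^typ>\<open>'v list\<close> is the free monoid on \<^typ>\<open>'v\<close>, so that
  \<open>'v list \<Rightarrow>\<^sub>0 'k\<close> is the free associative \<open>'k\<close>-algebra on the set \<^typ>\<open>'v\<close>.\<close>

instantiation list :: (type) monoid_add
begin
definition zero_list :: "'a list" where "zero_list = []"
definition plus_list :: "'a list \<Rightarrow> 'a list \<Rightarrow> 'a list" where "plus_list = (@)"
instance by standard (simp_all add: zero_list_def plus_list_def)
end

type_synonym ('k, 'v) tensor = "('v list \<Rightarrow>\<^sub>0 'k) set"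

definition free_algebra :: "('v list \<Rightarrow>\<^sub>0 'k::field) ring" where
  "free_algebra = \<lparr>carrier = UNIV, monoid.mult = (*), one = 1, ring.zero = 0, add = (+)\<rparr>"

text \<open>\<open>T(V)\<close> is the free algebra on the set \<open>V\<close> modulo the relations that make the
  inclusion of \<open>V\<close> linear.\<close>

definition tensor_ideal :: "('k::field \<Rightarrow> 'v::ab_group_add \<Rightarrow> 'v) \<Rightarrow> ('v list \<Rightarrow>\<^sub>0 'k) set" where
  "tensor_ideal scale = Idl\<^bsub>free_algebra\<^esub>
     ({Poly_Mapping.single [x + y] 1 - Poly_Mapping.single [x] 1 - Poly_Mapping.single [y] 1 | x y. True}
      \<union> {Poly_Mapping.single [scale c x] 1 - Poly_Mapping.single [x] c | c x. True})"

definition tensor_algebra ::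
    "('k::field \<Rightarrow> 'v::ab_group_add \<Rightarrow> 'v) \<Rightarrow> ('k, 'v) tensor ring" where
  "tensor_algebra scale = free_algebra Quot tensor_ideal scale"

definition tensor_class ::
    "('k::field \<Rightarrow> 'v::ab_group_add \<Rightarrow> 'v) \<Rightarrow> ('v list \<Rightarrow>\<^sub>0 'k) \<Rightarrow> ('k, 'v) tensor" where
  "tensor_class scale z = tensor_ideal scale +>\<^bsub>free_algebra\<^esub> z"

definition pure_tensor ::
    "('k::field \<Rightarrow> 'v::ab_group_add \<Rightarrow> 'v) \<Rightarrow> 'v list \<Rightarrow> ('k, 'v) tensor" where
  "pure_tensor scale xs = tensor_class scale (Poly_Mapping.single xs 1)"

definition tensor_scalar ::
    "('k::field \<Rightarrow> 'v::ab_group_add \<Rightarrow> 'v) \<Rightarrow> 'k \<Rightarrow> ('k, 'v) tensor" where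
  "tensor_scalar scale c = tensor_class scale (Poly_Mapping.single [] c)"

text \<open>\<open>V\<^sup>\<otimes>\<^sup>m\<close> as the homogeneous component of degree \<open>m\<close> of \<open>T(V)\<close>.\<close>

definition tensor_power ::
    "('k::field \<Rightarrow> 'v::ab_group_add \<Rightarrow> 'v) \<Rightarrow> nat \<Rightarrow> ('k, 'v) tensor set" where
  "tensor_power scale m = tensor_class scale ` {z. Poly_Mapping.keys z \<subseteq> {xs. length xs = m}}"

text \<open>\<open>word x a b\<close> lists the factors of \<open>x\<^sub>a \<dots> x\<^sub>b\<close>; it is empty if \<open>a > b\<close>.\<close>

definition word :: "(nat \<Rightarrow> 'v) \<Rightarrow> nat \<Rightarrow> nat \<Rightarrow> 'v list" where
  "word x a b = map x [a..<Suc b]"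

text \<open>Linear maps over \<open>'k\<close> from a subspace \<open>U\<close> of \<open>E\<close> to \<open>M\<close>, where \<open>s\<close> and \<open>s'\<close> are the
  scalar multiplications of \<open>E\<close> and \<open>M\<close>.\<close>

definition klinear_on ::
    "('c, 'm) ring_scheme \<Rightarrow> ('k \<Rightarrow> 'c \<Rightarrow> 'c) \<Rightarrow> 'c set \<Rightarrow>
     ('d, 'n) ring_scheme \<Rightarrow> ('k \<Rightarrow> 'd \<Rightarrow> 'd) \<Rightarrow> ('c \<Rightarrow> 'd) \<Rightarrow> bool" where
  "klinear_on E s U M s' h \<longleftrightarrow>
     h \<in> U \<rightarrow> carrier M \<and>
     (\<forall>x\<in>U. \<forall>y\<in>U. h (x \<oplus>\<^bsub>E\<^esub> y) = h x \<oplus>\<^bsub>M\<^esub> h y) \<and>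
     (\<forall>c. \<forall>x\<in>U. h (s c x) = s' c (h x))"

definition tensor_scale ::
    "('k::field \<Rightarrow> 'v::ab_group_add \<Rightarrow> 'v) \<Rightarrow> 'k \<Rightarrow> ('k, 'v) tensor \<Rightarrow> ('k, 'v) tensor" where
  "tensor_scale scale c t = tensor_scalar scale c \<otimes>\<^bsub>tensor_algebra scale\<^esub> t"


section \<open>Antisymmetrizers and the symmetric algebra \<open>S(V, N)\<close>\<close>

text \<open>The factors of \<open>\<sigma> \<cdot> (x\<^sub>1 \<dots> x\<^sub>m)\<close>; positions are counted from 1.\<close>

definition permute_word :: "(nat \<Rightarrow> nat) \<Rightarrow> 'v list \<Rightarrow> 'v list" where
  "permute_word \<sigma> xs = map (\<lambda>k. xs ! (inv_into UNIV \<sigma> k - 1)) [1..<Suc (length xs)]"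

text \<open>The action of \<open>\<sigma>\<close> on \<open>V\<^sup>\<otimes>\<^sup>m\<close>: the linear map with the prescribed values on pure tensors.\<close>

definition permute_tensor ::
    "('k::field \<Rightarrow> 'v::ab_group_add \<Rightarrow> 'v) \<Rightarrow> nat \<Rightarrow> (nat \<Rightarrow> nat) \<Rightarrow> ('k, 'v) tensor \<Rightarrow> ('k, 'v) tensor" where
  "permute_tensor scale m \<sigma> = (THE h. h \<in> extensional (tensor_power scale m) \<and>
     klinear_on (tensor_algebra scale) (tensor_scale scale) (tensor_power scale m)
                (tensor_algebra scale) (tensor_scale scale) h \<and>
     (\<forall>xs. length xs = m \<longrightarrow> h (pure_tensor scale xs) = pure_tensor scale (permute_word \<sigma> xs)))"

definition Ant ::
    "('k::field \<Rightarrow> 'v::ab_group_add \<Rightarrow> 'v) \<Rightarrow> nat \<Rightarrow> ('k, 'v) tensor \<Rightarrow> ('k, 'v) tensor" where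
  "Ant scale m z = (\<Oplus>\<^bsub>tensor_algebra scale\<^esub>\<sigma>\<in>{\<sigma>. \<sigma> permutes {1..m}}.
     [sign \<sigma>] \<cdot>\<^bsub>tensor_algebra scale\<^esub> permute_tensor scale m \<sigma> z)"

definition sym_relations ::
    "('k::field \<Rightarrow> 'v::ab_group_add \<Rightarrow> 'v) \<Rightarrow> nat \<Rightarrow> ('k, 'v) tensor set" where
  "sym_relations scale N = Ant scale N ` tensor_power scale N"

definition sym_ideal ::
    "('k::field \<Rightarrow> 'v::ab_group_add \<Rightarrow> 'v) \<Rightarrow> nat \<Rightarrow> ('k, 'v) tensor set" where
  "sym_ideal scale N = Idl\<^bsub>tensor_algebra scale\<^esub> (sym_relations scale N)"

definition sym_algebra ::
    "('k::field \<Rightarrow> 'v::ab_group_add \<Rightarrow> 'v) \<Rightarrow> nat \<Rightarrow> ('k, 'v) tensor set ring" where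
  "sym_algebra scale N = tensor_algebra scale Quot sym_ideal scale N"

definition sym_proj ::
    "('k::field \<Rightarrow> 'v::ab_group_add \<Rightarrow> 'v) \<Rightarrow> nat \<Rightarrow> ('k, 'v) tensor \<Rightarrow> ('k, 'v) tensor set" where
  "sym_proj scale N t = sym_ideal scale N +>\<^bsub>tensor_algebra scale\<^esub> t"

definition sym_scalar ::
    "('k::field \<Rightarrow> 'v::ab_group_add \<Rightarrow> 'v) \<Rightarrow> nat \<Rightarrow> 'k \<Rightarrow> ('k, 'v) tensor set" where
  "sym_scalar scale N c = sym_proj scale N (tensor_scalar scale c)"

text \<open>The library's \<^const>\<open>ideal_prod\<close> of two subsets is the set of finite sums of products, that
  is, the image of the tensor product of two subspaces in \<open>T(V)\<close>.\<close>

definition koszul_space ::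
    "('k::field \<Rightarrow> 'v::ab_group_add \<Rightarrow> 'v) \<Rightarrow> nat \<Rightarrow> nat \<Rightarrow> ('k, 'v) tensor set" where
  "koszul_space scale N m = {t \<in> tensor_power scale m. \<forall>i j. i + N + j = m \<longrightarrow>
     t \<in> tensor_power scale i \<cdot>\<^bsub>tensor_algebra scale\<^esub> sym_relations scale N
           \<cdot>\<^bsub>tensor_algebra scale\<^esub> tensor_power scale j}"

definition nu :: "nat \<Rightarrow> nat \<Rightarrow> nat" where
  "nu N p = N * (p div 2) + p mod 2"


section \<open>Exterior powers\<close>

definition exterior_ideal ::
    "('k::field \<Rightarrow> 'v::ab_group_add \<Rightarrow> 'v) \<Rightarrow> ('k, 'v) tensor set" where
  "exterior_ideal scale = Idl\<^bsub>tensor_algebra scale\<^esub> {pure_tensor scale [x, x] | x. True}"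

definition exterior_algebra ::
    "('k::field \<Rightarrow> 'v::ab_group_add \<Rightarrow> 'v) \<Rightarrow> ('k, 'v) tensor set ring" where
  "exterior_algebra scale = tensor_algebra scale Quot exterior_ideal scale"

definition exterior_proj ::
    "('k::field \<Rightarrow> 'v::ab_group_add \<Rightarrow> 'v) \<Rightarrow> ('k, 'v) tensor \<Rightarrow> ('k, 'v) tensor set" where
  "exterior_proj scale t = exterior_ideal scale +>\<^bsub>tensor_algebra scale\<^esub> t"

definition exterior_power ::
    "('k::field \<Rightarrow> 'v::ab_group_add \<Rightarrow> 'v) \<Rightarrow> nat \<Rightarrow> ('k, 'v) tensor set set" where
  "exterior_power scale m = exterior_proj scale ` tensor_power scale m"

definition exterior_scale ::
    "('k::field \<Rightarrow> 'v::ab_group_add \<Rightarrow> 'v) \<Rightarrow> 'k \<Rightarrow> ('k, 'v) tensor set \<Rightarrow> ('k, 'v) tensor set" where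
  "exterior_scale scale c w =
     exterior_proj scale (tensor_scalar scale c) \<otimes>\<^bsub>exterior_algebra scale\<^esub> w"

definition wedge ::
    "('k::field \<Rightarrow> 'v::ab_group_add \<Rightarrow> 'v) \<Rightarrow> 'v list \<Rightarrow> ('k, 'v) tensor set" where
  "wedge scale xs = exterior_proj scale (pure_tensor scale xs)"

text \<open>The map \<open>\<phi>\<^sub>m\<close>: the linear map on the \<open>m\<close>-th exterior power whose values are prescribed on
  the basis of increasing wedge products of the \<open>e\<^sub>i\<close>.\<close>

definition phi ::
    "('k::field \<Rightarrow> 'v::ab_group_add \<Rightarrow> 'v) \<Rightarrow> nat \<Rightarrow> (nat \<Rightarrow> 'v) \<Rightarrow> nat \<Rightarrow>
     ('k, 'v) tensor set \<Rightarrow> ('k, 'v) tensor" where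
  "phi scale n e m = (THE h. h \<in> extensional (exterior_power scale m) \<and>
     klinear_on (exterior_algebra scale) (exterior_scale scale) (exterior_power scale m)
                (tensor_algebra scale) (tensor_scale scale) h \<and>
     (\<forall>js. length js = m \<and> sorted_wrt (<) js \<and> set js \<subseteq> {1..n} \<longrightarrow>
        h (wedge scale (map e js)) = Ant scale m (pure_tensor scale (map e js))))"

text \<open>The Koszul cochain \<open>f \<circ> \<phi>\<^sub>m\<^sup>-\<^sup>1\<close> corresponding to \<open>f\<close>; it is meaningful on \<open>Ant\<^sub>m(V\<^sup>\<otimes>\<^sup>m)\<close>.\<close>

definition koszul_cochain ::
    "('k::field \<Rightarrow> 'v::ab_group_add \<Rightarrow> 'v) \<Rightarrow> nat \<Rightarrow> (nat \<Rightarrow> 'v) \<Rightarrow> nat \<Rightarrow>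
     (('k, 'v) tensor set \<Rightarrow> 'p) \<Rightarrow> ('k, 'v) tensor \<Rightarrow> 'p" where
  "koszul_cochain scale n e m f w = f (inv_into (exterior_power scale m) (phi scale n e m) w)"


section \<open>Bimodules and their tensor product\<close>

text \<open>As for the library's modules, the ring multiplication and unit of the record are unused.\<close>

record ('a, 'p) bimodule = "'p ring" +
  lact :: "'a \<Rightarrow> 'p \<Rightarrow> 'p"
  ract :: "'p \<Rightarrow> 'a \<Rightarrow> 'p"

text \<open>Bimodules over an algebra \<open>A\<close> with structure map \<open>\<eta>\<close> from the ground field, which acts
  in the same way on both sides.\<close>

locale bimodule = A: ring A + P: abelian_group P
  for A :: "('a, 'm) ring_scheme" and \<eta> :: "'k \<Rightarrow> 'a" and P :: "('a, 'p, 'n) bimodule_scheme" +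
  assumes lact_closed: "\<lbrakk>a \<in> carrier A; x \<in> carrier P\<rbrakk> \<Longrightarrow> lact P a x \<in> carrier P"
    and ract_closed: "\<lbrakk>a \<in> carrier A; x \<in> carrier P\<rbrakk> \<Longrightarrow> ract P x a \<in> carrier P"
    and lact_add: "\<lbrakk>a \<in> carrier A; x \<in> carrier P; y \<in> carrier P\<rbrakk> \<Longrightarrow>
      lact P a (x \<oplus>\<^bsub>P\<^esub> y) = lact P a x \<oplus>\<^bsub>P\<^esub> lact P a y"
    and ract_add: "\<lbrakk>a \<in> carrier A; x \<in> carrier P; y \<in> carrier P\<rbrakk> \<Longrightarrow>
      ract P (x \<oplus>\<^bsub>P\<^esub> y) a = ract P x a \<oplus>\<^bsub>P\<^esub> ract P y a"
    and add_lact: "\<lbrakk>a \<in> carrier A; b \<in> carrier A; x \<in> carrier P\<rbrakk> \<Longrightarrow>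
      lact P (a \<oplus>\<^bsub>A\<^esub> b) x = lact P a x \<oplus>\<^bsub>P\<^esub> lact P b x"
    and add_ract: "\<lbrakk>a \<in> carrier A; b \<in> carrier A; x \<in> carrier P\<rbrakk> \<Longrightarrow>
      ract P x (a \<oplus>\<^bsub>A\<^esub> b) = ract P x a \<oplus>\<^bsub>P\<^esub> ract P x b"
    and mult_lact: "\<lbrakk>a \<in> carrier A; b \<in> carrier A; x \<in> carrier P\<rbrakk> \<Longrightarrow>
      lact P (a \<otimes>\<^bsub>A\<^esub> b) x = lact P a (lact P b x)"
    and mult_ract: "\<lbrakk>a \<in> carrier A; b \<in> carrier A; x \<in> carrier P\<rbrakk> \<Longrightarrow>
      ract P x (a \<otimes>\<^bsub>A\<^esub> b) = ract P (ract P x a) b"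
    and one_lact: "x \<in> carrier P \<Longrightarrow> lact P \<one>\<^bsub>A\<^esub> x = x"
    and one_ract: "x \<in> carrier P \<Longrightarrow> ract P x \<one>\<^bsub>A\<^esub> = x"
    and lact_ract: "\<lbrakk>a \<in> carrier A; b \<in> carrier A; x \<in> carrier P\<rbrakk> \<Longrightarrow>
      ract P (lact P a x) b = lact P a (ract P x b)"
    and scalar: "x \<in> carrier P \<Longrightarrow> lact P (\<eta> c) x = ract P x (\<eta> c)"

text \<open>\<open>P \<otimes>\<^sub>A Q\<close>: the free abelian group on \<open>P \<times> Q\<close> modulo biadditivity and \<open>A\<close>-balancedness.\<close>

definition balancing ::
    "('a, 'm) ring_scheme \<Rightarrow> ('a, 'p, 'n) bimodule_scheme \<Rightarrow> ('a, 'q, 'o) bimodule_scheme \<Rightarrow>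
     ('p \<times> 'q \<Rightarrow>\<^sub>0 int) set" where
  "balancing A P Q = generate (free_Abelian_group (carrier P \<times> carrier Q))
     ({frag_of (x \<oplus>\<^bsub>P\<^esub> x', y) - frag_of (x, y) - frag_of (x', y) | x x' y.
         x \<in> carrier P \<and> x' \<in> carrier P \<and> y \<in> carrier Q}
      \<union> {frag_of (x, y \<oplus>\<^bsub>Q\<^esub> y') - frag_of (x, y) - frag_of (x, y') | x y y'.
         x \<in> carrier P \<and> y \<in> carrier Q \<and> y' \<in> carrier Q}
      \<union> {frag_of (ract P x a, y) - frag_of (x, lact Q a y) | x a y.
         x \<in> carrier P \<and> a \<in> carrier A \<and> y \<in> carrier Q})"

text \<open>Only the additive structure of \<open>P \<otimes>\<^sub>A Q\<close> is recorded, as the additive part of a ring record.\<close>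

definition bimod_tensor ::
    "('a, 'm) ring_scheme \<Rightarrow> ('a, 'p, 'n) bimodule_scheme \<Rightarrow> ('a, 'q, 'o) bimodule_scheme \<Rightarrow>
     ('p \<times> 'q \<Rightarrow>\<^sub>0 int) set ring" where
  "bimod_tensor A P Q =
     (let G = free_Abelian_group (carrier P \<times> carrier Q) Mod balancing A P Q
      in \<lparr>carrier = carrier G, monoid.mult = undefined, one = undefined, ring.zero = one G, add = monoid.mult G\<rparr>)"

definition tens ::
    "('a, 'm) ring_scheme \<Rightarrow> ('a, 'p, 'n) bimodule_scheme \<Rightarrow> ('a, 'q, 'o) bimodule_scheme \<Rightarrow>
     'p \<Rightarrow> 'q \<Rightarrow> ('p \<times> 'q \<Rightarrow>\<^sub>0 int) set" where
  "tens A P Q x y =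
     balancing A P Q #>\<^bsub>free_Abelian_group (carrier P \<times> carrier Q)\<^esub> frag_of (x, y)"


section \<open>The Koszul cup product\<close>

text \<open>The value at \<open>z\<close> of the map sending \<open>u w v w' t\<close> to \<open>u f(w) v \<otimes>\<^sub>A g(w') t\<close>, for
  \<open>u \<in> V\<^sup>\<otimes>\<^sup>i\<close>, \<open>w \<in> W\<^sub>a\<close>, \<open>v \<in> V\<^sup>\<otimes>\<^sup>l\<close>, \<open>w' \<in> W\<^sub>b\<close> and \<open>t \<in> V\<^sup>\<otimes>\<^sup>j\<close>: the element \<open>z\<close> is
  written as a sum of such products, and the result does not depend on the way this is done.\<close>

definition apply_factors ::
    "('k::field \<Rightarrow> 'v::ab_group_add \<Rightarrow> 'v) \<Rightarrow> nat \<Rightarrow>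
     (('k, 'v) tensor set, 'p) bimodule \<Rightarrow> (('k, 'v) tensor set, 'q) bimodule \<Rightarrow>
     nat \<Rightarrow> nat \<Rightarrow> nat \<Rightarrow> nat \<Rightarrow> nat \<Rightarrow>
     (('k, 'v) tensor \<Rightarrow> 'p) \<Rightarrow> (('k, 'v) tensor \<Rightarrow> 'q) \<Rightarrow>
     ('k, 'v) tensor \<Rightarrow> ('p \<times> 'q \<Rightarrow>\<^sub>0 int) set" where
  "apply_factors scale N P Q i a l b j f g z =
     (let T = tensor_algebra scale; A = sym_algebra scale N; \<pi> = sym_proj scale N;
          V = tensor_power scale; W = koszul_space scale N
      in THE y. \<exists>(r::nat) u w v w' t.
        (\<forall>s<r. u s \<in> V i \<and> w s \<in> W a \<and> v s \<in> V l \<and> w' s \<in> W b \<and> t s \<in> V j) \<and>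
        z = (\<Oplus>\<^bsub>T\<^esub>s\<in>{..<r}. u s \<otimes>\<^bsub>T\<^esub> w s \<otimes>\<^bsub>T\<^esub> v s \<otimes>\<^bsub>T\<^esub> w' s \<otimes>\<^bsub>T\<^esub> t s) \<and>
        y = (\<Oplus>\<^bsub>bimod_tensor A P Q\<^esub>s\<in>{..<r}.
               tens A P Q (ract P (lact P (\<pi> (u s)) (f (w s))) (\<pi> (v s)))
                          (ract Q (g (w' s)) (\<pi> (t s)))))"

definition koszul_cup ::
    "('k::field \<Rightarrow> 'v::ab_group_add \<Rightarrow> 'v) \<Rightarrow> nat \<Rightarrow>
     (('k, 'v) tensor set, 'p) bimodule \<Rightarrow> (('k, 'v) tensor set, 'q) bimodule \<Rightarrow>
     nat \<Rightarrow> nat \<Rightarrow> (('k, 'v) tensor \<Rightarrow> 'p) \<Rightarrow> (('k, 'v) tensor \<Rightarrow> 'q) \<Rightarrow>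
     ('k, 'v) tensor \<Rightarrow> ('p \<times> 'q \<Rightarrow>\<^sub>0 int) set" where
  "koszul_cup scale N P Q p q f g z =
     (let M = bimod_tensor (sym_algebra scale N) P Q
      in if odd p \<and> odd q
         then \<ominus>\<^bsub>M\<^esub> finsum M
                (\<lambda>(i, j). apply_factors scale N P Q i (nu N p) (N - 2 - i - j) (nu N q) j f g z)
                {(i, j). i + j \<le> N - 2}
         else apply_factors scale N P Q 0 (nu N p) 0 (nu N q) 0 f g z)"

text \<open>The set \<open>Sh(i, \<nu>(p), \<nu>(q), j)\<close>.\<close>

definition koszul_shuffles :: "nat \<Rightarrow> nat \<Rightarrow> nat \<Rightarrow> nat \<Rightarrow> nat \<Rightarrow> (nat \<Rightarrow> nat) set" where
  "koszul_shuffles N p q i j = {\<sigma>. \<sigma> permutes {1..nu N (p + q)} \<and>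
     strict_mono_on {i + 1..i + nu N p} \<sigma> \<and>
     strict_mono_on {nu N p + N - j - 1..nu N p + nu N q + N - j - 2} \<sigma>}"

end

theory Submission
  imports Defs
begin

text \<open>
  Write \<open>T\<close> for the tensor algebra, \<open>B\<close> for the basis \<open>e\<^sub>1, \<dots>, e\<^sub>n\<close>, and \<open>F\<close> for the free algebra on
  the set of all vectors. All computations take place in \<open>F\<close>, whose elements are finite
  combinations of words. Expanding every letter in \<open>B\<close> is a ring endomorphism \<open>nf\<close> of \<open>F\<close> whose
  kernel is the ideal defining \<open>T\<close> (lemma \<open>tensor_ideal_eq\<close>); so every tensor has exactly one
  representative that is a combination of words in \<open>B\<close>, and a tensor may be handled through the
  coefficients of this representative.

  Antisymmetrization of words extends linearly to \<open>F\<close>, commutes with \<open>nf\<close> and kills all words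
  with two equal adjacent letters. It therefore factors through the exterior algebra, which gives
  \<open>\<phi>\<^sub>m(x\<^sub>1 \<and> \<dots> \<and> x\<^sub>m) = Ant\<^sub>m(x\<^sub>1 \<dots> x\<^sub>m)\<close> for all vectors, not just for increasing basis vectors
  (lemma \<open>phi_ext_class\<close>).

  The left-hand side of the theorem applies two cochains to tensor factors of one tensor that has
  been decomposed in an arbitrary way, and the value must not depend on the decomposition. A
  cochain \<open>f \<circ> \<phi>\<^sub>m\<inverse>\<close> is defined on antisymmetric tensors only, but it is the restriction of a linear
  map on all tensors, namely the one that sends a strictly increasing basis word to the value of
  \<open>f\<close> at the corresponding wedge product and every other basis word to zero: in
  \<open>Ant\<^sub>m(e\<^sub>J)\<close> with \<open>J\<close> increasing, the only increasing word is \<open>e\<^sub>J\<close> itself (lemmas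
  \<open>extension_ant_lin\<close> and \<open>koszul_cochain_ant_lin\<close>). Since \<open>W\<^sub>m\<close> consists of antisymmetrizations
  (lemma \<open>koszul_spaceE\<close>: its elements have coefficients that alternate at every pair of adjacent
  positions), the extended maps yield an additive map on all tensors of the right degree that
  sends \<open>u w v w' t\<close> to \<open>u f(w) v \<otimes> g(w') t\<close>, and this map computes the value of every
  decomposition (lemmas \<open>cup_lin_mult\<close> and \<open>apply_factors_eq\<close>).

  It remains to exhibit one decomposition of \<open>Ant\<^sub>m(x\<^sub>1 \<dots> x\<^sub>m)\<close>. A permutation factors uniquely as
  \<open>\<tau> \<circ> \<rho>' \<circ> \<rho>\<close>, where \<open>\<rho>\<close> and \<open>\<rho>'\<close> permute the two blocks of positions that are fed to \<open>f\<close> and \<open>g\<close>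
  and \<open>\<tau>\<close> increases on both blocks. For fixed \<open>\<tau>\<close>, summing over \<open>\<rho>\<close> and \<open>\<rho>'\<close> antisymmetrizes the
  two blocks (lemma \<open>ant_blocks\<close>), so the terms of the decomposition are indexed by the shuffles
  \<open>\<tau>\<close>, and \<open>f\<close>, \<open>g\<close> take the values at the wedge products in the formula. The same
  factorization with a single block shows that antisymmetrizations lie in \<open>W\<^sub>m\<close>.
\<close>

section \<open>Words and homogeneous elements\<close>

abbreviation single :: "'a list \<Rightarrow> 'k \<Rightarrow> 'a list \<Rightarrow>\<^sub>0 'k::zero" where "single \<equiv> Poly_Mapping.single"
abbreviation coeff :: "('a list \<Rightarrow>\<^sub>0 'k::zero) \<Rightarrow> 'a list \<Rightarrow> 'k" where "coeff \<equiv> Poly_Mapping.lookup"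

definition homog :: "nat \<Rightarrow> ('a list \<Rightarrow>\<^sub>0 'k::zero) \<Rightarrow> bool" where
  "homog m z \<longleftrightarrow> Poly_Mapping.keys z \<subseteq> {xs. length xs = m}"

lemma mult_single_word: "single xs a * single ys (b::'k::semiring_0) = single (xs @ ys) (a * b)"
  by (simp add: mult_single plus_list_def)

lemma one_eq_single: "1 = single [] (1::'k::field)"
  by (metis single_one zero_list_def)

lemma of_int_eq_single: "of_int k = single [] (of_int k :: 'k::field)"
  by (metis single_of_int zero_list_def)

lemma homog_zero [simp]: "homog m 0"
  by (simp add: homog_def)

lemma homog_add: "homog m x \<Longrightarrow> homog m y \<Longrightarrow> homog m (x + y)"
  using keys_add[of x y] by (auto simp: homog_def)

lemma homog_sum: "(\<And>i. i \<in> I \<Longrightarrow> homog m (h i)) \<Longrightarrow> homog m (sum h I)"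
  by (induction I rule: infinite_finite_induct) (auto intro: homog_add)

lemma homog_single: "length xs = m \<Longrightarrow> homog m (single xs c)"
  by (auto simp: homog_def)

lemma homog_mult: "homog a x \<Longrightarrow> homog b y \<Longrightarrow> homog (a + b) (x * y :: 'a list \<Rightarrow>\<^sub>0 'k::field)"
  using keys_mult[of x y] by (fastforce simp: homog_def plus_list_def)

lemma homog_scalar: "homog m z \<Longrightarrow> homog m (single [] c * z :: 'a list \<Rightarrow>\<^sub>0 'k::field)"
  using homog_mult[OF homog_single[of "[]" 0 c]] by simp

lemma poly_mapping_sum_keys: "z = (\<Sum>ws\<in>Poly_Mapping.keys z. single ws (coeff z ws :: 'k::field))"
  by (rule poly_mapping_eqI) (simp add: lookup_sum lookup_single when_def in_keys_iff)

lemma keys_induct [consumes 1, case_names zero single add]: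
  fixes z :: "'a list \<Rightarrow>\<^sub>0 'k::field"
  assumes "Poly_Mapping.keys z \<subseteq> S"
    and zero: "R 0" and single: "\<And>ws c. ws \<in> S \<Longrightarrow> R (single ws c)"
    and add: "\<And>x y. Poly_Mapping.keys x \<subseteq> S \<Longrightarrow> Poly_Mapping.keys y \<subseteq> S \<Longrightarrow> R x \<Longrightarrow> R y \<Longrightarrow> R (x + y)"
  shows "R z"
proof -
  have "Poly_Mapping.keys (\<Sum>ws\<in>I. single ws (coeff z ws)) \<subseteq> S \<and> R (\<Sum>ws\<in>I. single ws (coeff z ws))"
    if "finite I" "I \<subseteq> S" for I
    using that
  proof (induction I)
    case (insert w I)
    then have 1: "Poly_Mapping.keys (single w (coeff z w)) \<subseteq> S" by auto
    show ?case using insert 1 single[of w] keys_add[of "single w (coeff z w)" "\<Sum>ws\<in>I. single ws (coeff z ws)"]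
      by (auto intro!: add)
  qed (auto simp: zero)
  from this[of "Poly_Mapping.keys z"] show ?thesis
    using assms(1) poly_mapping_sum_keys[of z] by simp
qed

lemmas homog_induct [consumes 1, case_names zero single add] =
  keys_induct[where S = "{xs. length xs = m}" for m, folded homog_def, simplified mem_Collect_eq]

lemma poly_mapping_induct [case_names single add]:
  fixes z :: "'a list \<Rightarrow>\<^sub>0 'k::field"
  assumes "\<And>ws c. R (single ws c)" "\<And>x y. R x \<Longrightarrow> R y \<Longrightarrow> R (x + y)"
  shows "R z"
  using keys_induct[of z UNIV R] assms assms(1)[of "[]" 0] by simp

lemma scalar_central: "z * single [] (c::'k::field) = single [] c * z"
  by (induction z rule: poly_mapping_induct) (simp_all add: mult_single_word algebra_simps)

text \<open>Knowing the degree of the left factor, there is only one way to cut a word into two factors that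
  contribute to its coefficient.\<close>

lemma coeff_mult_homog:
  fixes u r :: "'a list \<Rightarrow>\<^sub>0 'k::field"
  assumes "homog i u"
  shows "coeff (u * r) ws = coeff u (take i ws) * coeff r (drop i ws)"
  using assms
proof (induction rule: homog_induct)
  case (single us c)
  show ?case
  proof (induction r rule: poly_mapping_induct)
    case (single k v)
    have "us @ k = ws \<longleftrightarrow> us = take i ws \<and> k = drop i ws"
      using \<open>length us = i\<close> by (metis append_eq_conv_conj append_take_drop_id)
    then show ?case
      by (auto simp: mult_single_word lookup_single when_def)
  qed (simp add: algebra_simps lookup_add)
qed (simp_all add: algebra_simps lookup_add)

section \<open>Linear extension\<close>

definition lin_extend :: "('a list \<Rightarrow> 'b list \<Rightarrow>\<^sub>0 'k) \<Rightarrow> ('a list \<Rightarrow>\<^sub>0 'k::field) \<Rightarrow> 'b list \<Rightarrow>\<^sub>0 'k" where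
  "lin_extend h z = (\<Sum>ws\<in>Poly_Mapping.keys z. single [] (coeff z ws) * h ws)"

lemma lin_superset: "finite S \<Longrightarrow> Poly_Mapping.keys z \<subseteq> S \<Longrightarrow> lin_extend h z = (\<Sum>ws\<in>S. single [] (coeff z ws) * h ws)"
  unfolding lin_extend_def by (rule sum.mono_neutral_left) (auto simp: in_keys_iff)

lemma lin_zero [simp]: "lin_extend h 0 = 0" by (simp add: lin_extend_def)

lemma lin_single [simp]: "lin_extend h (single ws c) = single [] c * h ws"
  by (simp add: lin_extend_def)

lemma lin_add: "lin_extend h (x + y) = lin_extend h x + lin_extend h y"
proof -
  let ?S = "Poly_Mapping.keys x \<union> Poly_Mapping.keys y"
  have "lin_extend h (x + y) = (\<Sum>ws\<in>?S. single [] (coeff (x+y) ws) * h ws)"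
    using keys_add[of x y] by (intro lin_superset) auto
  also have "\<dots> = (\<Sum>ws\<in>?S. single [] (coeff x ws) * h ws) + (\<Sum>ws\<in>?S. single [] (coeff y ws) * h ws)"
    by (simp add: lookup_add single_add algebra_simps sum.distrib)
  also have "\<dots> = lin_extend h x + lin_extend h y" by (subst (1 2) lin_superset[of ?S]) auto
  finally show ?thesis .
qed

lemma lin_uminus: "lin_extend h (- x) = - lin_extend h x"
  using lin_add[of h x "-x"] by (simp add: eq_neg_iff_add_eq_0 add.commute)

lemma lin_diff: "lin_extend h (x - y) = lin_extend h x - lin_extend h y"
  using lin_add[of h x "-y"] by (simp add: lin_uminus)

lemma lin_sum: "lin_extend h (sum g I) = (\<Sum>i\<in>I. lin_extend h (g i))"
  by (induction I rule: infinite_finite_induct) (auto simp: lin_add)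

lemma lin_scalar: "lin_extend h (single [] c * z) = single [] c * lin_extend h z"
  by (induction z rule: poly_mapping_induct)
    (simp_all add: mult_single_word lin_add distrib_left flip: mult.assoc)

lemma homog_lin:
  assumes "\<And>ws. length ws = m \<Longrightarrow> homog k (h ws)" "homog m z"
  shows "homog k (lin_extend h z)"
  using assms(2) by (induction rule: homog_induct)
    (auto simp: lin_add intro!: homog_add homog_mult[of 0 _ k, simplified] homog_single assms(1))

section \<open>Bubble sort\<close>

text \<open>The standard device for alternating maps: a statement that is trivial for words with two equal
  neighbours and invariant under swapping neighbours only has to be checked on strictly
  increasing words. Swapping a descent decreases the word lexicographically, so the
  process stops.\<close>

lemma bubble_sort_induct:
  fixes R :: "nat list \<Rightarrow> bool"
  assumes sorted: "\<And>js. sorted_wrt (<) js \<Longrightarrow> R js"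
    and repeat: "\<And>us a vs. R (us @ a # a # vs)"
    and swap: "\<And>us a b vs. b < a \<Longrightarrow> R (us @ b # a # vs) \<Longrightarrow> R (us @ a # b # vs)"
  shows "R js"
proof (induction js rule: wf_induct_rule[OF wf_lex[OF wf_less_than]])
  case (1 js)
  show ?case
  proof (cases "sorted_wrt (<) js")
    case False
    then obtain k where k: "Suc k < length js" "\<not> js ! k < js ! Suc k"
      using sorted_wrt_iff_nth_Suc_transp[of "(<)" js] by (auto simp: transp_def)
    define us a b vs where "us = take k js" "a = js ! k" "b = js ! Suc k" "vs = drop (Suc (Suc k)) js"
    have js: "js = us @ a # b # vs"
      using k unfolding us_a_b_vs_def
      by (metis Cons_nth_drop_Suc Suc_lessD id_take_nth_drop)
    show ?thesis
    proof (cases "a = b")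
      case False
      then have "b < a" using k by (simp add: us_a_b_vs_def)
      then have "(us @ b # a # vs, js) \<in> lex less_than"
        unfolding js by (intro lex_append_leftI) simp
      from 1[OF this] show ?thesis using swap \<open>b < a\<close> js by blast
    qed (use repeat js in auto)
  qed (rule sorted)
qed

section \<open>Place permutations of words\<close>

abbreviation pinv :: "('a \<Rightarrow> 'b) \<Rightarrow> 'b \<Rightarrow> 'a" where "pinv \<equiv> inv_into UNIV"

lemma length_word [simp]: "length (word y a b) = Suc b - a"
  by (simp add: word_def del: upt_Suc)

lemma word_cong: "(\<And>k. a \<le> k \<Longrightarrow> k \<le> b \<Longrightarrow> y k = y' k) \<Longrightarrow> word y a b = word y' a b"
  by (auto simp: word_def)

lemma word_append: "a \<le> Suc b \<Longrightarrow> b \<le> c \<Longrightarrow> word y a b @ word y (Suc b) c = word y a c"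
  unfolding word_def by (metis Suc_le_mono map_append upt_add_eq_append le_add_diff_inverse)

lemma word_shift: "word y (Suc i) (i + a) = word (\<lambda>k. y (i + k)) 1 a"
  by (auto simp: word_def list_eq_iff_nth_eq simp del: upt_Suc)

lemma word_of_list: "xs = word (\<lambda>k. xs ! (k - 1)) 1 (length xs)"
  by (rule nth_equalityI) (auto simp: word_def simp del: upt_Suc)

lemma length_permute_word [simp]: "length (permute_word \<sigma> xs) = length xs"
  by (simp add: permute_word_def del: upt_Suc)

lemma permute_word_word:
  assumes "\<sigma> permutes {1..m}"
  shows "permute_word \<sigma> (word y 1 m) = word (y \<circ> pinv \<sigma>) 1 m"
proof (rule nth_equalityI)
  fix k assume "k < length (permute_word \<sigma> (word y 1 m))"
  then have k: "k < m" by simp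
  then have "pinv \<sigma> (Suc k) \<in> {1..m}"
    using permutes_in_image[OF permutes_inv[OF assms], of "Suc k"] by simp
  then show "permute_word \<sigma> (word y 1 m) ! k = word (y \<circ> pinv \<sigma>) 1 m ! k"
    using k by (auto simp: permute_word_def word_def simp del: upt_Suc)
qed simp

lemma permute_word_comp:
  assumes "\<sigma> permutes {1..length xs}" "\<tau> permutes {1..length xs}"
  shows "permute_word \<sigma> (permute_word \<tau> xs) = permute_word (\<sigma> \<circ> \<tau>) xs"
proof -
  obtain y m where xs: "xs = word y 1 m" using word_of_list by metis
  have "pinv (\<sigma> \<circ> \<tau>) = pinv \<tau> \<circ> pinv \<sigma>"
    using assms by (meson o_inv_distrib permutes_bij)
  moreover have "\<sigma> permutes {1..m}" "\<tau> permutes {1..m}" using assms by (simp_all add: xs)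
  ultimately show ?thesis
    by (simp add: xs permute_word_word permutes_compose comp_assoc del: One_nat_def)
qed

lemma permute_word_id [simp]: "permute_word id xs = xs"
proof -
  obtain y m where xs: "xs = word y 1 m" using word_of_list by metis
  show ?thesis by (simp only: xs permute_word_word permutes_id inv_id comp_id)
qed

lemma set_permute_word:
  assumes "\<sigma> permutes {1..length xs}"
  shows "set (permute_word \<sigma> xs) = set xs"
proof -
  obtain y m where xs: "xs = word y 1 m" using word_of_list by metis
  have s: "\<sigma> permutes {1..m}" using assms by (simp add: xs)
  have "set (word (y \<circ> pinv \<sigma>) 1 m) = y ` (pinv \<sigma> ` {1..m})"
    by (auto simp: word_def simp del: upt_Suc)
  also have "pinv \<sigma> ` {1..m} = {1..m}"
    using s permutes_image permutes_inv by metis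
  finally show ?thesis using s
    by (simp only: xs permute_word_word) (auto simp: word_def simp del: upt_Suc)
qed

lemma map_permute_word:
  assumes "\<sigma> permutes {1..length xs}"
  shows "permute_word \<sigma> (map h xs) = map h (permute_word \<sigma> xs)"
proof -
  obtain y m where xs: "xs = word y 1 m" using word_of_list by metis
  have "map h (word y' 1 m) = word (h \<circ> y') 1 m" for y' by (simp add: word_def del: upt_Suc)
  moreover have "\<sigma> permutes {1..m}" using assms by (simp add: xs)
  ultimately show ?thesis by (simp add: xs permute_word_word comp_assoc del: One_nat_def)
qed

text \<open>Positions are counted from 1, hence the successors.\<close>

lemma permute_word_adjacent:
  "permute_word (transpose (Suc (length us)) (Suc (Suc (length us)))) (us @ a # b # vs) = us @ b # a # vs"
proof (rule nth_equalityI)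
  fix k assume "k < length (permute_word (transpose (Suc (length us)) (Suc (Suc (length us)))) (us @ a # b # vs))"
  then have k: "k < length us + 2 + length vs" by simp
  then have "permute_word (transpose (Suc (length us)) (Suc (Suc (length us)))) (us @ a # b # vs) ! k
      = (us @ a # b # vs) ! (transpose (Suc (length us)) (Suc (Suc (length us))) (Suc k) - 1)"
    by (simp add: permute_word_def del: upt_Suc)
  also have "\<dots> = (us @ b # a # vs) ! k"
    by (auto simp: transpose_def nth_append nth_Cons split: nat.splits)
  finally show "permute_word (transpose (Suc (length us)) (Suc (Suc (length us)))) (us @ a # b # vs) ! k
     = (us @ b # a # vs) ! k" .
qed simp

lemma adjacent_permutes:
  "transpose (Suc (length us)) (Suc (Suc (length us))) permutes {1..length (us @ a # b # vs)}"
  by (rule permutes_swap_id) auto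

section \<open>Antisymmetrizer\<close>

definition ant :: "'a list \<Rightarrow> 'a list \<Rightarrow>\<^sub>0 'k::field" where
  "ant xs = (\<Sum>\<sigma> | \<sigma> permutes {1..length xs}. single (permute_word \<sigma> xs) (of_int (sign \<sigma>)))"

text \<open>Terms cancel in pairs that an involution forms. The involution exchanges the elements satisfying
  \<open>ev\<close> with the others and so has no fixed points; unlike an argument by
  \<open>S = - S\<close>, this also works in characteristic 2.\<close>

lemma sum_signed_involution:
  fixes h :: "'i \<Rightarrow> 'b::ab_group_add"
  assumes "finite I" "\<And>s. s \<in> I \<Longrightarrow> T s \<in> I \<and> T (T s) = s \<and> ev (T s) = (\<not> ev s) \<and> h (T s) = - h s"
  shows "sum h I = 0"
proof -
  let ?E = "{s \<in> I. ev s}" and ?O = "{s \<in> I. \<not> ev s}"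
  have "sum h I = sum h ?E + sum h ?O"
    using assms(1) by (subst sum.union_disjoint[symmetric]) (auto intro!: sum.cong)
  also have "sum h ?O = sum (\<lambda>s. h (T s)) ?E"
    using assms(2) by (intro sum.reindex_bij_witness[of _ T T]) auto
  also have "\<dots> = - sum h ?E"
    using assms(2) by (simp add: sum_negf[symmetric])
  finally show ?thesis by simp
qed

lemma ant_permute:
  assumes \<tau>: "\<tau> permutes {1..length xs}"
  shows "(ant (permute_word \<tau> xs) :: 'a list \<Rightarrow>\<^sub>0 'k::field) = single [] (of_int (sign \<tau>)) * ant xs"
proof -
  let ?S = "{1..length xs}"
  have p: "permutation \<sigma>" if "\<sigma> permutes ?S" for \<sigma> using that permutation_permutes by blast
  have "(ant (permute_word \<tau> xs) :: 'a list \<Rightarrow>\<^sub>0 'k) =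
     (\<Sum>\<sigma> | \<sigma> permutes ?S. single (permute_word (\<sigma> \<circ> \<tau>) xs) (of_int (sign \<sigma>)))"
    unfolding ant_def using \<tau> by (auto simp: permute_word_comp intro!: sum.cong)
  also have "\<dots> = (\<Sum>\<sigma> | \<sigma> permutes ?S. single (permute_word (\<sigma> \<circ> \<tau>) xs) (of_int (sign \<tau> * sign (\<sigma> \<circ> \<tau>))))"
    using \<tau> p by (intro sum.cong) (auto simp: sign_compose mult.commute mult.left_commute)
  also have "\<dots> = (\<Sum>\<sigma> | \<sigma> permutes ?S. single (permute_word \<sigma> xs) (of_int (sign \<tau> * sign \<sigma>)))"
    by (rule sum_permutations_compose_right[OF \<tau>, symmetric])
  finally show ?thesis by (simp add: ant_def sum_distrib_left mult_single_word)
qed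

lemma ant_swap: "ant (us @ a # b # vs) = - (ant (us @ b # a # vs) :: 'a list \<Rightarrow>\<^sub>0 'k::field)"
  using ant_permute[OF adjacent_permutes, of us b a vs, unfolded permute_word_adjacent]
  by (simp add: sign_swap_id single_uminus flip: one_eq_single)

lemma comp_adjacent_involution:
  assumes "\<sigma> permutes S" "t = transpose a b" "t permutes S" "finite S" "a \<noteq> b"
  shows "\<sigma> \<circ> t permutes S" "\<sigma> \<circ> t \<circ> t = \<sigma>" "evenperm (\<sigma> \<circ> t) \<longleftrightarrow> \<not> evenperm \<sigma>" "sign (\<sigma> \<circ> t) = - sign \<sigma>"
    "t \<circ> \<sigma> permutes S" "t \<circ> (t \<circ> \<sigma>) = \<sigma>" "evenperm (t \<circ> \<sigma>) \<longleftrightarrow> \<not> evenperm \<sigma>" "sign (t \<circ> \<sigma>) = - sign \<sigma>"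
proof -
  have p: "permutation \<sigma>" "permutation t" using assms permutation_permutes by blast+
  show "\<sigma> \<circ> t permutes S" "t \<circ> \<sigma> permutes S" using assms permutes_compose by blast+
  show "\<sigma> \<circ> t \<circ> t = \<sigma>" "t \<circ> (t \<circ> \<sigma>) = \<sigma>" using assms by (auto simp: fun_eq_iff)
  show "evenperm (\<sigma> \<circ> t) \<longleftrightarrow> \<not> evenperm \<sigma>" "evenperm (t \<circ> \<sigma>) \<longleftrightarrow> \<not> evenperm \<sigma>"
    using p assms by (auto simp: evenperm_comp evenperm_swap)
  then show "sign (\<sigma> \<circ> t) = - sign \<sigma>" "sign (t \<circ> \<sigma>) = - sign \<sigma>" by (auto simp: sign_def)
qed

lemma ant_repeat: "ant (us @ a # a # vs) = (0 :: 'a list \<Rightarrow>\<^sub>0 'k::field)"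
proof -
  let ?xs = "us @ a # a # vs" and ?t = "transpose (Suc (length us)) (Suc (Suc (length us)))"
  note t = comp_adjacent_involution[OF _ refl adjacent_permutes[of us a a vs]]
  show ?thesis unfolding ant_def
  proof (rule sum_signed_involution[of _ "\<lambda>\<sigma>. \<sigma> \<circ> ?t" evenperm])
    fix \<sigma> assume "\<sigma> \<in> {\<sigma>. \<sigma> permutes {1..length ?xs}}"
    then have s: "\<sigma> permutes {1..length ?xs}" by blast
    have "permute_word (\<sigma> \<circ> ?t) ?xs = permute_word \<sigma> ?xs"
      using permute_word_comp[OF s adjacent_permutes] permute_word_adjacent by metis
    then show "\<sigma> \<circ> ?t \<in> {\<sigma>. \<sigma> permutes {1..length ?xs}} \<and> \<sigma> \<circ> ?t \<circ> ?t = \<sigma> \<and> evenperm (\<sigma> \<circ> ?t) = (\<not> evenperm \<sigma>) \<and>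
        single (permute_word (\<sigma> \<circ> ?t) ?xs) (of_int (sign (\<sigma> \<circ> ?t))) =
       - single (permute_word \<sigma> ?xs) (of_int (sign \<sigma>) :: 'k)"
      using t[OF s] by (simp del: length_append add: single_uminus)
  qed (simp add: finite_permutations)
qed

lemma permute_word_inverse:
  assumes "\<tau> permutes {1..length xs}"
  shows "permute_word \<tau> (permute_word (pinv \<tau>) xs) = xs" "permute_word (pinv \<tau>) (permute_word \<tau> xs) = xs"
  using permute_word_comp[of \<tau> xs "pinv \<tau>"] permute_word_comp[of "pinv \<tau>" xs \<tau>] assms
  by (simp_all add: permutes_inv permutes_inv_o)

lemma homog_ant [simp]: "homog (length xs) (ant xs)"
  unfolding ant_def by (intro homog_sum homog_single) simp

lemma coeff_ant_length: "length ys \<noteq> length xs \<Longrightarrow> coeff (ant xs) ys = 0"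
  using homog_ant[of xs] by (auto simp: homog_def in_keys_iff)

lemma coeff_ant: "coeff (ant xs) ys = (\<Sum>\<sigma> | \<sigma> permutes {1..length xs}. if permute_word \<sigma> xs = ys then of_int (sign \<sigma>) else 0 :: 'k::field)"
  by (simp add: ant_def lookup_sum lookup_single when_def)

text \<open>The lemmas \<open>ant_swap\<close> and \<open>ant_repeat\<close> permute the argument of \<open>ant\<close>, by composition on the right
  with a transposition; here and in the next lemma it is the resulting coefficients that alternate, by
  composition on the left.\<close>

lemma coeff_ant_swap: "coeff (ant xs) (us @ a # b # vs) = - (coeff (ant xs) (us @ b # a # vs) :: 'k::field)"
proof (cases "length xs = length (us @ a # b # vs)")
  case True
  let ?t = "transpose (Suc (length us)) (Suc (Suc (length us)))" and ?S = "{1..length xs}"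
  have t: "?t permutes ?S" using adjacent_permutes[of us a b vs] True by simp
  have eq: "permute_word (?t \<circ> \<sigma>) xs = us @ a # b # vs \<longleftrightarrow> permute_word \<sigma> xs = us @ b # a # vs"
    if "\<sigma> permutes ?S" for \<sigma>
    using permute_word_comp[OF t that] permute_word_adjacent permute_word_inverse[of ?t]
    by (metis inv_transpose_eq length_permute_word t)
  have "coeff (ant xs) (us @ a # b # vs)
    = (\<Sum>\<sigma> | \<sigma> permutes ?S. if permute_word (?t \<circ> \<sigma>) xs = us @ a # b # vs then of_int (sign (?t \<circ> \<sigma>)) else 0 :: 'k)"
    unfolding coeff_ant by (rule setum_permutations_compose_left[OF t])
  also have "\<dots> = (\<Sum>\<sigma> | \<sigma> permutes ?S. - (if permute_word \<sigma> xs = us @ b # a # vs then of_int (sign \<sigma>) else 0 :: 'k))"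
    using eq comp_adjacent_involution(8)[OF _ refl t] by (intro sum.cong) auto
  finally show ?thesis by (simp add: coeff_ant sum_negf)
qed (simp add: coeff_ant_length)

lemma coeff_ant_repeat: "coeff (ant xs) (us @ a # a # vs) = (0 :: 'k::field)"
proof (cases "length xs = length (us @ a # a # vs)")
  case True
  let ?t = "transpose (Suc (length us)) (Suc (Suc (length us)))" and ?S = "{1..length xs}"
  have t: "?t permutes ?S" using adjacent_permutes[of us a a vs] True by simp
  have eq: "permute_word (?t \<circ> \<sigma>) xs = us @ a # a # vs \<longleftrightarrow> permute_word \<sigma> xs = us @ a # a # vs"
    if "\<sigma> permutes ?S" for \<sigma>
    using permute_word_comp[OF t that] permute_word_adjacent permute_word_inverse[of ?t]
    by (metis inv_transpose_eq length_permute_word t)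
  note ci = comp_adjacent_involution[OF _ refl t]
  show ?thesis unfolding coeff_ant
    by (rule sum_signed_involution[of _ "\<lambda>\<sigma>. ?t \<circ> \<sigma>" evenperm]) (use eq ci in \<open>auto simp: finite_permutations\<close>)
qed (simp add: coeff_ant_length)

definition ant_lin :: "('a list \<Rightarrow>\<^sub>0 'k::field) \<Rightarrow> 'a list \<Rightarrow>\<^sub>0 'k" where "ant_lin = lin_extend ant"

lemma coeff_scalar: "coeff (single [] c * z) ws = (c::'k::field) * coeff z ws"
  using coeff_mult_homog[OF homog_single[of "[]" 0 c]] by simp

lemma coeff_ant_lin: "coeff (ant_lin z) ys = (\<Sum>ws\<in>Poly_Mapping.keys z. coeff z ws * coeff (ant ws) ys)"
  by (simp add: ant_lin_def lin_extend_def lookup_sum coeff_scalar)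

lemma coeff_ant_lin_swap: "coeff (ant_lin z) (us @ a # b # vs) = - coeff (ant_lin z) (us @ b # a # vs)"
  unfolding coeff_ant_lin by (subst coeff_ant_swap) (simp add: sum_negf)

lemma coeff_ant_lin_repeat: "coeff (ant_lin z) (us @ a # a # vs) = 0"
  unfolding coeff_ant_lin by (simp add: coeff_ant_repeat)

lemma homog_ant_lin: "homog m z \<Longrightarrow> homog m (ant_lin z)"
  unfolding ant_lin_def by (rule homog_lin) auto

text \<open>Among the rearrangements of a strictly increasing word, only the word itself is increasing, and
  it arises from the identity permutation alone.\<close>

lemma coeff_ant_increasing:
  fixes js ks :: "nat list"
  assumes "sorted_wrt (<) js" "sorted_wrt (<) ks"
  shows "coeff (ant js) ks = (if js = ks then 1 else 0 :: 'k::field)"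
proof -
  have *: "permute_word \<sigma> js = ks \<longleftrightarrow> \<sigma> = id \<and> js = ks" if s: "\<sigma> permutes {1..length js}" for \<sigma> :: "nat \<Rightarrow> nat"
  proof
    assume eq: "permute_word \<sigma> js = ks"
    then have "set ks = set js" using set_permute_word[OF s] by simp
    then have jk: "js = ks" using strict_sorted_equal[OF assms(2,1)] by simp
    have "pinv \<sigma> k = k" for k
    proof (cases "k \<in> {1..length js}")
      case True
      then have i: "pinv \<sigma> k \<in> {1..length js}" using permutes_in_image[OF permutes_inv[OF s]] by blast
      have "permute_word \<sigma> js ! (k - 1) = js ! (pinv \<sigma> k - 1)"
        using True by (auto simp: permute_word_def simp del: upt_Suc)
      then have "js ! (k - 1) = js ! (pinv \<sigma> k - 1)" using eq jk by simp
      moreover have "distinct js" using assms(1) strict_sorted_iff by blast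
      ultimately have "k - 1 = pinv \<sigma> k - 1" using True i by (subst (asm) nth_eq_iff_index_eq) auto
      then show ?thesis using True i by auto
    qed (use permutes_not_in[OF permutes_inv[OF s]] in auto)
    then have "pinv \<sigma> = id" by (simp add: fun_eq_iff)
    then have "\<sigma> = id" using permutes_inv_inv[OF s] by (simp add: inv_id)
    with jk show "\<sigma> = id \<and> js = ks" by simp
  qed simp
  have "coeff (ant js) ks = (\<Sum>\<sigma> | \<sigma> permutes {1..length js}. if \<sigma> = id then (if js = ks then 1 else 0) else 0 :: 'k)"
    unfolding coeff_ant by (intro sum.cong) (use * in auto)
  then show ?thesis by (simp add: finite_permutations permutes_id)
qed

lemma coeff_ant_map:
  assumes "inj_on h (set xs \<union> set ys)"
  shows "coeff (ant (map h xs)) (map h ys) = (coeff (ant xs) ys :: 'k::field)"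
proof -
  have "permute_word \<sigma> (map h xs) = map h ys \<longleftrightarrow> permute_word \<sigma> xs = ys" if "\<sigma> permutes {1..length xs}" for \<sigma>
    using assms by (simp add: map_permute_word[OF that] set_permute_word[OF that] inj_on_map_eq_map del: One_nat_def)
  then show ?thesis unfolding coeff_ant length_map by (intro sum.cong) auto
qed

section \<open>Shuffles\<close>

lemma strict_mono_on_same_image:
  fixes \<sigma> \<tau> :: "nat \<Rightarrow> nat"
  assumes "finite B" "strict_mono_on B \<sigma>" "strict_mono_on B \<tau>" "\<sigma> ` B = \<tau> ` B" "k \<in> B"
  shows "\<sigma> k = \<tau> k"
proof -
  let ?b = "sorted_list_of_set B"
  have srt: "sorted_wrt (<) (map h ?b)" if "strict_mono_on B h" for h :: "nat \<Rightarrow> nat"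
    unfolding sorted_wrt_map
    by (rule sorted_wrt_mono_rel[OF _ strict_sorted_list_of_set]) (use assms(1) that in \<open>auto simp: strict_mono_on_def\<close>)
  have "map \<sigma> ?b = map \<tau> ?b"
    by (rule strict_sorted_equal) (use srt assms in auto)
  then show ?thesis using assms(1,5) by simp
qed

lemma sorting_permutation:
  fixes \<sigma> :: "nat \<Rightarrow> nat"
  assumes B: "finite B" and inj: "inj_on \<sigma> B"
  obtains \<rho> where "\<rho> permutes B" "strict_mono_on B (\<sigma> \<circ> \<rho>)"
proof -
  let ?b = "sorted_list_of_set B" and ?c = "sorted_list_of_set (\<sigma> ` B)"
  have len: "length ?b = card B" "length ?c = card B"
    using inj by (simp_all add: card_image)
  obtain g where g: "bij_betw g B (\<sigma> ` B)" "strict_mono_on B g"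
  proof -
    define ib where "ib = inv_into {..<card B} ((!) ?b)"
    have bb: "bij_betw ((!) ?b) {..<card B} B" "bij_betw ((!) ?c) {..<card B} (\<sigma> ` B)"
      using B len by (auto intro!: bij_betw_nth)
    then have ib: "bij_betw ib B {..<card B}" unfolding ib_def by (rule_tac bij_betw_inv_into)
    have "bij_betw ((!) ?c \<circ> ib) B (\<sigma> ` B)" using ib bb(2) by (rule bij_betw_trans)
    moreover have "strict_mono_on B ((!) ?c \<circ> ib)"
    proof (rule strict_mono_onI)
      fix r s assume rs: "r \<in> B" "s \<in> B" "r < s"
      have i: "ib r < card B" "ib s < card B" "?b ! ib r = r" "?b ! ib s = s"
        using ib bb rs by (auto simp: bij_betw_def ib_def intro!: f_inv_into_f)
      have "ib r < ib s"
      proof (rule ccontr)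
        assume "\<not> ib r < ib s"
        then have "?b ! ib s \<le> ?b ! ib r"
          using i len by (intro sorted_nth_mono) auto
        then show False using i rs by simp
      qed
      then show "((!) ?c \<circ> ib) r < ((!) ?c \<circ> ib) s"
        using i len strict_sorted_list_of_set[of "\<sigma> ` B"] by (simp add: sorted_wrt_iff_nth_less)
    qed
    ultimately show ?thesis using that by blast
  qed
  define \<rho> where "\<rho> k = (if k \<in> B then inv_into B \<sigma> (g k) else k)" for k
  have "bij_betw (inv_into B \<sigma> \<circ> g) B B"
    using g(1) bij_betw_inv_into[OF bij_betw_imageI[OF inj refl]] by (rule bij_betw_trans)
  then have "bij_betw \<rho> B B" by (rule bij_betw_cong[THEN iffD1, rotated]) (simp add: \<rho>_def)
  then have "\<rho> permutes B" by (rule bij_imp_permutes) (simp add: \<rho>_def)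
  moreover have "\<sigma> (\<rho> k) = g k" if "k \<in> B" for k
    using that g(1) by (auto simp: \<rho>_def bij_betw_def intro!: f_inv_into_f)
  then have "strict_mono_on B (\<sigma> \<circ> \<rho>)" using g(2) by (simp add: strict_mono_on_def)
  ultimately show ?thesis using that by blast
qed

text \<open>Coset representatives for the right action of the permutations of a block \<open>B\<close>: in each orbit,
  exactly one permutation increases on \<open>B\<close>. The set \<open>I\<close> is arbitrary, so that the lemma can be
  applied again to the permutations that already increase on another block.\<close>

lemma sum_permutations_shuffle:
  fixes h :: "(nat \<Rightarrow> nat) \<Rightarrow> 'b::comm_monoid_add"
  assumes I: "\<And>\<sigma>. \<sigma> \<in> I \<Longrightarrow> \<sigma> permutes S" and S: "finite S" "B \<subseteq> S"
    and closed: "\<And>\<sigma> \<rho>. \<sigma> \<in> I \<Longrightarrow> \<rho> permutes B \<Longrightarrow> \<sigma> \<circ> \<rho> \<in> I"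
  shows "sum h I = (\<Sum>\<tau> | \<tau> \<in> I \<and> strict_mono_on B \<tau>. \<Sum>\<rho> | \<rho> permutes B. h (\<tau> \<circ> \<rho>))"
proof -
  have finI: "finite I" by (rule finite_subset[OF _ finite_permutations[OF S(1)]]) (use I in auto)
  have finB: "finite B" using S finite_subset by blast
  let ?T = "{\<tau> \<in> I. strict_mono_on B \<tau>}" and ?P = "{\<rho>. \<rho> permutes B}"
  have "bij_betw (\<lambda>(\<tau>, \<rho>). \<tau> \<circ> \<rho>) (?T \<times> ?P) I"
  proof (rule bij_betw_imageI)
    show "inj_on (\<lambda>(\<tau>, \<rho>). \<tau> \<circ> \<rho>) (?T \<times> ?P)"
    proof (rule inj_onI, clarsimp)
      fix \<tau> \<rho> \<tau>' \<rho>'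
      assume t: "\<tau> \<in> I" "strict_mono_on B \<tau>" "\<tau>' \<in> I" "strict_mono_on B \<tau>'"
        and r: "\<rho> permutes B" "\<rho>' permutes B" and eq: "\<tau> \<circ> \<rho> = \<tau>' \<circ> \<rho>'"
      have "\<tau> ` B = \<tau>' ` B"
        using arg_cong[OF eq, of "\<lambda>h. h ` B"] r by (metis image_comp permutes_image)
      then have "\<tau> k = \<tau>' k" for k
        using strict_mono_on_same_image[OF finB t(2,4)] fun_cong[OF eq, of k] r
        by (cases "k \<in> B") (simp_all add: permutes_not_in)
      then have "\<tau> = \<tau>'" ..
      moreover have "\<rho> = \<rho>'"
        using eq permutes_inj[OF I[OF t(1)]] unfolding \<open>\<tau> = \<tau>'\<close>[symmetric]
        by (auto simp: fun_eq_iff inj_def)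
      ultimately show "\<tau> = \<tau>' \<and> \<rho> = \<rho>'" ..
    qed
    show "(\<lambda>(\<tau>, \<rho>). \<tau> \<circ> \<rho>) ` (?T \<times> ?P) = I"
    proof (intro equalityI subsetI)
      fix \<sigma> assume s: "\<sigma> \<in> I"
      obtain \<rho> where r: "\<rho> permutes B" "strict_mono_on B (\<sigma> \<circ> \<rho>)"
        using sorting_permutation[OF finB] permutes_inj_on[OF I[OF s]] by blast
      have "\<sigma> = \<sigma> \<circ> \<rho> \<circ> pinv \<rho>" by (simp add: comp_assoc permutes_inv_o[OF r(1)])
      then show "\<sigma> \<in> (\<lambda>(\<tau>, \<rho>). \<tau> \<circ> \<rho>) ` (?T \<times> ?P)"
        using r closed[OF s r(1)] permutes_inv[OF r(1)] by (intro image_eqI[of _ _ "(\<sigma> \<circ> \<rho>, pinv \<rho>)"]) auto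
    qed (use closed in auto)
  qed
  then have "sum h I = (\<Sum>(\<tau>, \<rho>)\<in>?T \<times> ?P. h (\<tau> \<circ> \<rho>))"
    by (subst sum.reindex_bij_betw[symmetric]) (auto simp: case_prod_unfold)
  then show ?thesis by (simp add: sum.cartesian_product)
qed

lemma ant_word:
  "ant (word y (Suc i) (i + a)) =
   (\<Sum>\<rho> | \<rho> permutes {Suc i..i + a}. single (word (y \<circ> \<rho>) (Suc i) (i + a)) (of_int (sign \<rho>) :: 'k::field))"
proof -
  let ?m = "map_permutation {1..a} ((+) i)" and ?y = "\<lambda>k. y (i + k)"
  have bij: "bij_betw ((+) i) {1..a} {Suc i..i + a}"
    by (rule bij_betw_imageI) (auto simp: image_add_atLeastAtMost simp del: One_nat_def)
  have "ant (word y (Suc i) (i + a)) =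
     (\<Sum>\<sigma> | \<sigma> permutes {1..a}. single (permute_word \<sigma> (word ?y 1 a)) (of_int (sign \<sigma>) :: 'k))"
    unfolding ant_def by (simp add: word_shift)
  also have "\<dots> = (\<Sum>\<sigma> | \<sigma> permutes {1..a}. single (permute_word (pinv \<sigma>) (word ?y 1 a)) (of_int (sign (pinv \<sigma>))))"
    by (rule sum_permutations_inverse)
  also have "\<dots> = (\<Sum>\<sigma> | \<sigma> permutes {1..a}. single (word (?y \<circ> \<sigma>) 1 a) (of_int (sign \<sigma>)))"
  proof (rule sum.cong[OF refl])
    fix \<sigma> assume "\<sigma> \<in> {\<sigma>. \<sigma> permutes {1..a}}"
    then have s: "\<sigma> permutes {1..a}" by blast
    have "permute_word (pinv \<sigma>) (word ?y 1 a) = word (?y \<circ> \<sigma>) 1 a"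
      using permute_word_word[OF permutes_inv[OF s]] permutes_inv_inv[OF s] by metis
    moreover have "permutation \<sigma>" using s permutation_permutes by blast
    ultimately show "single (permute_word (pinv \<sigma>) (word ?y 1 a)) (of_int (sign (pinv \<sigma>)))
       = single (word (?y \<circ> \<sigma>) 1 a) (of_int (sign \<sigma>) :: 'k)"
      by (simp add: sign_inverse)
  qed
  also have "\<dots> = (\<Sum>\<sigma> | \<sigma> permutes {1..a}. single (word (y \<circ> ?m \<sigma>) (Suc i) (i + a)) (of_int (sign (?m \<sigma>))))"
  proof (rule sum.cong[OF refl])
    fix \<sigma> assume "\<sigma> \<in> {\<sigma>. \<sigma> permutes {1..a}}"
    then have s: "\<sigma> permutes {1..a}" by blast
    have "word (y \<circ> ?m \<sigma>) (Suc i) (i + a) = word (?y \<circ> \<sigma>) 1 a"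
      unfolding word_shift
    proof (rule word_cong)
      fix k assume "1 \<le> k" "k \<le> a"
      then show "(y \<circ> ?m \<sigma>) (i + k) = (?y \<circ> \<sigma>) k"
        using map_permutation_apply[OF bij_betw_imp_inj_on[OF bij], of k \<sigma>] by simp
    qed
    moreover have "sign (?m \<sigma>) = sign \<sigma>"
      by (rule sign_map_permutation[OF bij_betw_imp_inj_on[OF bij] s]) simp
    ultimately show "single (word (?y \<circ> \<sigma>) 1 a) (of_int (sign \<sigma>) :: 'k)
      = single (word (y \<circ> ?m \<sigma>) (Suc i) (i + a)) (of_int (sign (?m \<sigma>)))" by simp
  qed
  also have "\<dots> = (\<Sum>\<rho> | \<rho> permutes {Suc i..i + a}. single (word (y \<circ> \<rho>) (Suc i) (i + a)) (of_int (sign \<rho>)))"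
  proof (rule sum.reindex_bij_witness[where i = "map_permutation {Suc i..i + a} (\<lambda>k. k - i)" and j = ?m])
    have bij': "bij_betw (\<lambda>k. k - i) {Suc i..i + a} {1..a}"
      by (rule bij_betw_byWitness[where f' = "(+) i"]) auto
    fix \<rho> assume "\<rho> \<in> {\<rho>. \<rho> permutes {Suc i..i + a}}"
    then show "map_permutation {Suc i..i + a} (\<lambda>k. k - i) \<rho> \<in> {\<sigma>. \<sigma> permutes {1..a}}"
      "?m (map_permutation {Suc i..i + a} (\<lambda>k. k - i) \<rho>) = \<rho>"
      using map_permutation_permutes[OF bij'] map_permutation_compose_inv[OF bij'] by auto
  qed (use map_permutation_permutes[OF bij] map_permutation_compose_inv[OF bij] in auto)
  finally show ?thesis .
qed

text \<open>Right composition with a permutation of a block of positions rearranges only the letters of the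
  subword in that block. Sorting the first block and then the second turns the sum over all
  permutations into a sum over shuffles in which the two subwords are antisymmetrized.\<close>

lemma ant_blocks:
  fixes y :: "nat \<Rightarrow> 'a"
  assumes m: "m = i + a + l + b + j"
  shows "(ant (word y 1 m) :: 'a list \<Rightarrow>\<^sub>0 'k::field) =
    (\<Sum>\<tau> | \<tau> permutes {1..m} \<and> strict_mono_on {Suc i..i + a} \<tau> \<and>
           strict_mono_on {Suc (i + a + l)..i + a + l + b} \<tau>.
       single (word (y \<circ> \<tau>) 1 i) (of_int (sign \<tau>)) * ant (word (y \<circ> \<tau>) (Suc i) (i + a))
       * single (word (y \<circ> \<tau>) (Suc (i + a)) (i + a + l)) 1
       * ant (word (y \<circ> \<tau>) (Suc (i + a + l)) (i + a + l + b))
       * single (word (y \<circ> \<tau>) (Suc (i + a + l + b)) m) 1)"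
proof -
  let ?S = "{1..m}" and ?B = "{Suc i..i + a}" and ?C = "{Suc (i + a + l)..i + a + l + b}"
  let ?h = "\<lambda>\<sigma>. single (word (y \<circ> \<sigma>) 1 m) (of_int (sign \<sigma>) :: 'k)"
  have sub: "?B \<subseteq> ?S" "?C \<subseteq> ?S" using m by auto
  have perm: "permutation \<sigma>" if "\<sigma> permutes A" "finite A" for \<sigma> :: "nat \<Rightarrow> nat" and A
    using that permutation_permutes by blast
  have "ant (word y 1 m) = sum ?h {\<sigma>. \<sigma> permutes ?S}"
    using ant_word[of y 0 m] by simp
  also have "\<dots> = (\<Sum>\<tau> | \<tau> \<in> {\<sigma>. \<sigma> permutes ?S} \<and> strict_mono_on ?B \<tau>. \<Sum>\<rho> | \<rho> permutes ?B. ?h (\<tau> \<circ> \<rho>))"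
  proof (rule sum_permutations_shuffle[of _ ?S])
    fix \<sigma> \<rho> assume "\<sigma> \<in> {\<sigma>. \<sigma> permutes ?S}" "\<rho> permutes ?B"
    then show "\<sigma> \<circ> \<rho> \<in> {\<sigma>. \<sigma> permutes ?S}"
      using permutes_compose[OF permutes_subset[OF _ sub(1)]] by blast
  qed (use sub in auto)
  also have "\<dots> = (\<Sum>\<tau> | \<tau> \<in> {\<tau> \<in> {\<sigma>. \<sigma> permutes ?S}. strict_mono_on ?B \<tau>} \<and> strict_mono_on ?C \<tau>.
      \<Sum>\<rho>' | \<rho>' permutes ?C. \<Sum>\<rho> | \<rho> permutes ?B. ?h (\<tau> \<circ> \<rho>' \<circ> \<rho>))"
  proof (rule sum_permutations_shuffle[of _ ?S])
    fix \<sigma> \<rho> assume s: "\<sigma> \<in> {\<tau> \<in> {\<sigma>. \<sigma> permutes ?S}. strict_mono_on ?B \<tau>}" and r: "\<rho> permutes ?C"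
    have "\<rho> k = k" if "k \<in> ?B" for k using that by (intro permutes_not_in[OF r]) auto
    then have "strict_mono_on ?B (\<sigma> \<circ> \<rho>)" using s by (simp add: strict_mono_on_def)
    then show "\<sigma> \<circ> \<rho> \<in> {\<tau> \<in> {\<sigma>. \<sigma> permutes ?S}. strict_mono_on ?B \<tau>}"
      using s permutes_compose[OF permutes_subset[OF r sub(2)]] by blast
  qed (use sub in auto)
  also have "\<dots> = (\<Sum>\<tau> | \<tau> permutes ?S \<and> strict_mono_on ?B \<tau> \<and> strict_mono_on ?C \<tau>.
       single (word (y \<circ> \<tau>) 1 i) (of_int (sign \<tau>)) * ant (word (y \<circ> \<tau>) (Suc i) (i + a))
       * single (word (y \<circ> \<tau>) (Suc (i + a)) (i + a + l)) 1
       * ant (word (y \<circ> \<tau>) (Suc (i + a + l)) (i + a + l + b))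
       * single (word (y \<circ> \<tau>) (Suc (i + a + l + b)) m) 1)"
  proof (rule sum.cong, goal_cases)
    case (2 \<tau>)
    then have t: "\<tau> permutes ?S" by blast
    have "?h (\<tau> \<circ> \<rho>' \<circ> \<rho>) =
        single (word (y \<circ> \<tau>) 1 i) (of_int (sign \<tau>))
        * single (word (y \<circ> \<tau> \<circ> \<rho>) (Suc i) (i + a)) (of_int (sign \<rho>))
        * single (word (y \<circ> \<tau>) (Suc (i + a)) (i + a + l)) 1
        * single (word (y \<circ> \<tau> \<circ> \<rho>') (Suc (i + a + l)) (i + a + l + b)) (of_int (sign \<rho>'))
        * single (word (y \<circ> \<tau>) (Suc (i + a + l + b)) m) 1"
      if r: "\<rho> permutes ?B" and r': "\<rho>' permutes ?C" for \<rho> \<rho>'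
    proof -
      let ?y = "y \<circ> (\<tau> \<circ> \<rho>' \<circ> \<rho>)"
      have out: "\<rho> k = k" if "k \<notin> ?B" for k using r that by (rule permutes_not_in)
      have out': "\<rho>' k = k" if "k \<notin> ?C" for k using r' that by (rule permutes_not_in)
      have inB: "\<rho> k \<notin> ?C" if "k \<in> ?B" for k
        using permutes_in_image[OF r, of k] that by auto
      have "word ?y 1 m = word ?y 1 i @ word ?y (Suc i) (i + a) @ word ?y (Suc (i + a)) (i + a + l)
          @ word ?y (Suc (i + a + l)) (i + a + l + b) @ word ?y (Suc (i + a + l + b)) m"
        using m by (simp add: word_append)
      also have "word ?y 1 i = word (y \<circ> \<tau>) 1 i"
        by (rule word_cong) (simp add: out out')
      also have "word ?y (Suc i) (i + a) = word (y \<circ> \<tau> \<circ> \<rho>) (Suc i) (i + a)"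
        by (rule word_cong) (use out' inB in auto)
      also have "word ?y (Suc (i + a)) (i + a + l) = word (y \<circ> \<tau>) (Suc (i + a)) (i + a + l)"
        by (rule word_cong) (simp add: out out')
      also have "word ?y (Suc (i + a + l)) (i + a + l + b) = word (y \<circ> \<tau> \<circ> \<rho>') (Suc (i + a + l)) (i + a + l + b)"
        by (rule word_cong) (simp add: out)
      also have "word ?y (Suc (i + a + l + b)) m = word (y \<circ> \<tau>) (Suc (i + a + l + b)) m"
        by (rule word_cong) (simp add: out out')
      finally have w: "word ?y 1 m = word (y \<circ> \<tau>) 1 i @ word (y \<circ> \<tau> \<circ> \<rho>) (Suc i) (i + a)
          @ word (y \<circ> \<tau>) (Suc (i + a)) (i + a + l)
          @ word (y \<circ> \<tau> \<circ> \<rho>') (Suc (i + a + l)) (i + a + l + b)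
          @ word (y \<circ> \<tau>) (Suc (i + a + l + b)) m" .
      have "sign (\<tau> \<circ> \<rho>' \<circ> \<rho>) = sign \<tau> * sign \<rho>' * sign \<rho>"
        using perm[OF t] perm[OF r] perm[OF r'] by (simp add: sign_compose permutation_compose)
      then show ?thesis
        by (simp add: w mult_single_word mult_ac del: One_nat_def)
    qed
    then have "(\<Sum>\<rho>' | \<rho>' permutes ?C. \<Sum>\<rho> | \<rho> permutes ?B. ?h (\<tau> \<circ> \<rho>' \<circ> \<rho>)) =
      (\<Sum>\<rho>' | \<rho>' permutes ?C. \<Sum>\<rho> | \<rho> permutes ?B. 
        single (word (y \<circ> \<tau>) 1 i) (of_int (sign \<tau>))
        * single (word (y \<circ> \<tau> \<circ> \<rho>) (Suc i) (i + a)) (of_int (sign \<rho>))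
        * single (word (y \<circ> \<tau>) (Suc (i + a)) (i + a + l)) 1
        * single (word (y \<circ> \<tau> \<circ> \<rho>') (Suc (i + a + l)) (i + a + l + b)) (of_int (sign \<rho>'))
        * single (word (y \<circ> \<tau>) (Suc (i + a + l + b)) m) 1)"
      by (intro sum.cong refl) simp
    then show ?case
      by (simp only: ant_word sum_distrib_left sum_distrib_right)
  qed simp
  finally show ?thesis .
qed

section \<open>Ring homomorphisms out of a type\<close>

text \<open>The algebras \<open>T\<close>, \<open>A\<close> and the exterior algebra are all quotients of the free algebra, which is a
  ring in the type class sense; each class map is an instance of this locale.\<close>

locale type_ring_hom = R: ring R for R :: "('r, 'm) ring_scheme" (structure) +
  fixes h :: "'z::ring_1 \<Rightarrow> 'r"
  assumes closed [simp]: "h x \<in> carrier R"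
    and add: "h (x + y) = h x \<oplus> h y"
    and mult: "h (x * y) = h x \<otimes> h y"
    and one: "h 1 = \<one>"
begin

lemma zero: "h 0 = \<zero>"
  using add[of 0 0] R.add.l_cancel_one'[of "h 0" "h 0"] by (metis add_0 closed)

lemma uminus: "h (- x) = \<ominus> h x"
  using add[of "-x" x] by (simp add: zero R.minus_equality)

lemma minus: "h (x - y) = h x \<ominus> h y"
  using add[of x "-y"] by (simp add: uminus R.minus_eq)

lemma sum: "h (sum g I) = finsum R (\<lambda>i. h (g i)) I"
  by (induction I rule: infinite_finite_induct)
    (simp_all add: zero add R.finsum_infinite)

lemma of_int: "h (of_int k * z) = add_pow R k (h z)"
proof -
  have nat: "h (of_nat m * z) = add_pow R m (h z)" for m :: nat
    by (induction m) (simp_all add: zero add algebra_simps R.a_comm)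
  show ?thesis
  proof (cases "k \<ge> 0")
    case True
    then show ?thesis using nat[of "nat k"] by (simp add: add_pow_int_ge)
  next
    case False
    have "of_int k * z = - (of_nat (nat (- k)) * z)" using False by (simp add: of_nat_nat)
    then have "h (of_int k * z) = \<ominus> h (of_nat (nat (- k)) * z)" by (simp only: uminus)
    then show ?thesis using False by (simp only: nat add_pow_int_lt not_le)
  qed
qed

end

section \<open>Normal forms\<close>

definition permute_lin :: "(nat \<Rightarrow> nat) \<Rightarrow> ('a list \<Rightarrow>\<^sub>0 'k::field) \<Rightarrow> 'a list \<Rightarrow>\<^sub>0 'k" where
  "permute_lin \<sigma> = lin_extend (\<lambda>ws. single (permute_word \<sigma> ws) 1)"

lemma homog_permute_lin: "homog m z \<Longrightarrow> homog m (permute_lin \<sigma> z)"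
  unfolding permute_lin_def by (rule homog_lin) (auto intro: homog_single)

text \<open>The antisymmetrizer as a signed sum of place permutations; this is the shape in which it is
  defined on tensors.\<close>

lemma ant_lin_permute_lin:
  assumes "homog m z"
  shows "ant_lin z = (\<Sum>\<sigma> | \<sigma> permutes {1..m}. of_int (sign \<sigma>) * permute_lin \<sigma> z)"
  using assms
proof (induction rule: homog_induct)
  case (add x y)
  then show ?case by (simp add: ant_lin_def permute_lin_def lin_add distrib_left sum.distrib)
qed (auto simp: ant_lin_def permute_lin_def ant_def mult_single_word of_int_eq_single sum_distrib_left mult.commute)

lemma coeff_permute_lin:
  fixes z :: "'a list \<Rightarrow>\<^sub>0 'k::field"
  assumes "homog m z" "\<sigma> permutes {1..m}" "length ys = m"
  shows "coeff (permute_lin \<sigma> z) ys = coeff z (permute_word (pinv \<sigma>) ys)"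
  using assms(1)
proof (induction rule: homog_induct)
  case (single ws c)
  have "permute_word \<sigma> ws = ys \<longleftrightarrow> ws = permute_word (pinv \<sigma>) ys"
    using permute_word_inverse[of \<sigma> ws] permute_word_inverse[of \<sigma> ys] single assms by auto
  then show ?case by (simp add: permute_lin_def mult_single_word lookup_single when_def)
qed (simp_all add: permute_lin_def lin_add lookup_add)

locale based_space =
  fixes scale :: "'k::field \<Rightarrow> 'v::ab_group_add \<Rightarrow> 'v" and e :: "nat \<Rightarrow> 'v" and n :: nat
  assumes fin_dim: "finite_dimensional_vector_space scale (e ` {1..n})"
    and inj_e: "inj_on e {1..n}"

context based_space
begin

definition \<B> :: "'v set" where "\<B> = e ` {1..n}"

sublocale V: finite_dimensional_vector_space scale \<B>
  unfolding \<B>_def by (rule fin_dim)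

lemma finite_\<B>: "finite \<B>"
  by (simp add: \<B>_def)

abbreviation rep :: "'v \<Rightarrow> 'v \<Rightarrow> 'k" where "rep \<equiv> V.representation \<B>"

definition nf_letter :: "'v \<Rightarrow> 'v list \<Rightarrow>\<^sub>0 'k" where "nf_letter v = (\<Sum>b\<in>\<B>. single [b] (rep v b))"
definition nf_word :: "'v list \<Rightarrow> 'v list \<Rightarrow>\<^sub>0 'k" where "nf_word xs = prod_list (map nf_letter xs)"
definition nf :: "('v list \<Rightarrow>\<^sub>0 'k) \<Rightarrow> 'v list \<Rightarrow>\<^sub>0 'k" where "nf = lin_extend nf_word"

lemma nf_add: "nf (x + y) = nf x + nf y" by (simp add: nf_def lin_add)
lemma nf_diff: "nf (x - y) = nf x - nf y" by (simp add: nf_def lin_diff)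
lemma nf_uminus: "nf (- x) = - nf x" by (simp add: nf_def lin_uminus)
lemma nf_zero [simp]: "nf 0 = 0" by (simp add: nf_def)
lemma nf_scalar: "nf (single [] c) = single [] c" by (simp add: nf_def nf_word_def)
lemma nf_single: "nf (single xs c) = single [] c * nf_word xs" by (simp add: nf_def)
lemma nf_sum: "nf (sum h I) = (\<Sum>i\<in>I. nf (h i))" by (simp add: nf_def lin_sum)

lemma nf_mult: "nf (x * y) = nf x * nf y"
proof (induction x rule: poly_mapping_induct)
  case (single xs a)
  show ?case
  proof (induction y rule: poly_mapping_induct)
    case (single ys b)
    have "nf_word xs * (single [] b * nf_word ys) = single [] b * (nf_word xs * nf_word ys)"
      using scalar_central[of "nf_word xs" b] by (simp flip: mult.assoc)
    moreover have "single [] (a * b) = single [] a * (single [] b :: 'v list \<Rightarrow>\<^sub>0 'k)" by (simp add: mult_single_word)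
    ultimately show ?case
      by (simp add: mult_single_word[of xs] nf_single nf_word_def mult.assoc)
  qed (simp add: distrib_left nf_add)
qed (simp add: distrib_right nf_add)

lemma homog_nf_letter: "homog 1 (nf_letter v)"
  unfolding nf_letter_def by (intro homog_sum homog_single) simp

lemma homog_nf_word: "length xs = m \<Longrightarrow> homog m (nf_word xs)"
proof (induction xs arbitrary: m)
  case (Cons x xs)
  then show ?case using homog_mult[OF homog_nf_letter[of x], of "length xs" "nf_word xs"]
    by (auto simp: nf_word_def)
qed (simp add: nf_word_def one_eq_single homog_single)

lemma homog_nf: "homog m z \<Longrightarrow> homog m (nf z)"
  unfolding nf_def by (rule homog_lin) (auto intro: homog_nf_word)

lemma rep_outside: "b \<notin> \<B> \<Longrightarrow> rep v b = 0"
  by (metis V.representation_ne_zero)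

lemma coeff_nf_letter: "coeff (nf_letter v) [b] = rep v b"
  by (simp add: nf_letter_def lookup_sum lookup_single when_def rep_outside finite_\<B>)

lemma coeff_nf_word:
  "length ys = length xs \<Longrightarrow> coeff (nf_word xs) ys = (\<Prod>k<length xs. rep (xs ! k) (ys ! k))"
proof (induction xs arbitrary: ys)
  case Nil
  then show ?case by (simp add: nf_word_def one_eq_single)
next
  case (Cons x xs)
  then obtain y ys' where ys: "ys = y # ys'" "length ys' = length xs" by (cases ys) auto
  have "coeff (nf_word (x # xs)) ys = coeff (nf_letter x) [y] * coeff (nf_word xs) ys'"
    using coeff_mult_homog[OF homog_nf_letter, of x "nf_word xs" ys] by (simp add: nf_word_def ys)
  then show ?case using Cons.IH[OF ys(2)]
    by (simp add: coeff_nf_letter ys prod.lessThan_Suc_shift del: prod.lessThan_Suc)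
qed

text \<open>The coefficients are products over positions, which makes the compatibility of \<open>nf\<close> with place
  permutations a reindexing of a product.\<close>

lemma coeff_nf_word_word:
  "coeff (nf_word (word x 1 m)) (word y 1 m) = (\<Prod>k\<in>{1..m}. rep (x k) (y k))"
proof -
  have "coeff (nf_word (word x 1 m)) (word y 1 m) = (\<Prod>k<m. rep (x (Suc k)) (y (Suc k)))"
    by (subst coeff_nf_word) (auto simp: word_def simp del: upt_Suc)
  also have "\<dots> = (\<Prod>k\<in>{1..m}. rep (x k) (y k))"
    by (rule prod.reindex_bij_witness[of _ "\<lambda>k. k - 1" Suc]) auto
  finally show ?thesis .
qed

lemma nf_word_permute:
  assumes s: "\<sigma> permutes {1..length xs}"
  shows "nf_word (permute_word \<sigma> xs) = permute_lin \<sigma> (nf_word xs)"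
proof (rule poly_mapping_eqI)
  fix ys
  obtain x m where xs: "xs = word x 1 m" using word_of_list by metis
  have s: "\<sigma> permutes {1..m}" using s by (simp add: xs)
  show "coeff (nf_word (permute_word \<sigma> xs)) ys = coeff (permute_lin \<sigma> (nf_word xs)) ys"
  proof (cases "length ys = m")
    case True
    then obtain y where ys: "ys = word y 1 m" using word_of_list by metis
    have "coeff (permute_lin \<sigma> (nf_word xs)) ys = coeff (nf_word xs) (permute_word (pinv \<sigma>) ys)"
      by (rule coeff_permute_lin[OF homog_nf_word s]) (simp_all add: xs ys)
    also have "\<dots> = (\<Prod>k\<in>{1..m}. rep (x k) ((y \<circ> \<sigma>) k))"
      unfolding xs ys permute_word_word[OF permutes_inv[OF s]] permutes_inv_inv[OF s]
      by (rule coeff_nf_word_word)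
    also have "\<dots> = (\<Prod>k\<in>{1..m}. rep ((x \<circ> pinv \<sigma>) k) (y k))"
      using permutes_inverses[OF s] permutes_in_image[OF s] permutes_in_image[OF permutes_inv[OF s]]
      by (intro prod.reindex_bij_witness[of _ "pinv \<sigma>" \<sigma>]) auto
    also have "\<dots> = coeff (nf_word (permute_word \<sigma> xs)) ys"
      unfolding xs ys permute_word_word[OF s] by (rule coeff_nf_word_word[symmetric])
    finally show ?thesis by simp
  next
    case False
    have "homog m (nf_word (permute_word \<sigma> xs))" "homog m (permute_lin \<sigma> (nf_word xs))"
      by (auto intro!: homog_nf_word homog_permute_lin simp: xs)
    with False show ?thesis by (metis (mono_tags, lifting) homog_def in_keys_iff mem_Collect_eq subset_iff)
  qed
qed

lemma nf_permute_lin: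
  assumes "homog m z" and s: "\<sigma> permutes {1..m}"
  shows "nf (permute_lin \<sigma> z) = permute_lin \<sigma> (nf z)"
  using assms(1)
proof (induction rule: homog_induct)
  case (single ws c)
  then show ?case using nf_word_permute[of \<sigma> ws] s
    by (simp add: permute_lin_def nf_single mult_single_word lin_scalar)
qed (simp_all add: permute_lin_def lin_add nf_add)

lemma nf_ant_lin_homog:
  assumes "homog m z" shows "nf (ant_lin z) = ant_lin (nf z)"
proof -
  have of_int: "nf (of_int k) = of_int k" for k by (simp add: of_int_eq_single nf_scalar)
  show ?thesis
    unfolding ant_lin_permute_lin[OF assms] ant_lin_permute_lin[OF homog_nf[OF assms]]
    by (simp add: nf_sum nf_mult of_int nf_permute_lin[OF assms])
qed

lemma nf_ant_lin: "nf (ant_lin z) = ant_lin (nf z)"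
  by (induction z rule: poly_mapping_induct)
    (simp only: nf_ant_lin_homog[OF homog_single[OF refl]], simp only: ant_lin_def lin_add nf_add)

definition reduced :: "('v list \<Rightarrow>\<^sub>0 'k) \<Rightarrow> bool" where
  "reduced z \<longleftrightarrow> Poly_Mapping.keys z \<subseteq> lists \<B>"

lemma reduced_add: "reduced x \<Longrightarrow> reduced y \<Longrightarrow> reduced (x + y)"
  using keys_add[of x y] by (auto simp: reduced_def)

lemma reduced_mult: "reduced x \<Longrightarrow> reduced y \<Longrightarrow> reduced (x * y)"
  using keys_mult[of x y] by (fastforce simp: reduced_def plus_list_def)

lemma reduced_sum: "(\<And>i. i \<in> I \<Longrightarrow> reduced (h i)) \<Longrightarrow> reduced (sum h I)"
  by (induction I rule: infinite_finite_induct) (auto intro: reduced_add simp: reduced_def[of 0])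

lemma reduced_single: "set ws \<subseteq> \<B> \<Longrightarrow> reduced (single ws c)"
  by (auto simp: reduced_def)

lemma reduced_nf_letter: "reduced (nf_letter x)"
  unfolding nf_letter_def by (intro reduced_sum reduced_single) auto

lemma reduced_nf: "reduced (nf z)"
proof -
  have "reduced (nf_word xs)" for xs
    by (induction xs) (auto simp: nf_word_def one_eq_single intro: reduced_single reduced_mult reduced_nf_letter)
  then show ?thesis
    unfolding nf_def lin_extend_def by (intro reduced_sum reduced_mult reduced_single) auto
qed

lemma nf_reduced: assumes "reduced z" shows "nf z = z"
proof -
  have letter: "nf_letter b = single [b] 1" if "b \<in> \<B>" for b
  proof -
    have "nf_letter b = (\<Sum>b'\<in>\<B>. if b' = b then single [b] 1 else 0)"
      unfolding nf_letter_def using that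
      by (intro sum.cong) (simp_all add: V.representation_basis[OF V.independent_Basis])
    then show ?thesis using that finite_\<B> by simp
  qed
  have word: "nf_word ws = single ws 1" if "ws \<in> lists \<B>" for ws
    using that by (induction ws) (simp_all add: nf_word_def letter mult_single_word one_eq_single)
  show ?thesis using assms unfolding reduced_def
    by (induction rule: keys_induct) (simp_all only: nf_zero nf_single word mult_single_word nf_add, simp)
qed

lemma nf_nf [simp]: "nf (nf z) = nf z"
  by (simp add: nf_reduced reduced_nf)

lemma reduced_ant_lin: "reduced z \<Longrightarrow> reduced (ant_lin z)"
  by (metis nf_ant_lin nf_reduced reduced_nf)

end

section \<open>The tensor algebra\<close>

text \<open>Existence of a map on a quotient with given values on representatives, in the extensional form
  needed to identify the maps that are defined by a unique description.\<close>

lemma factor_through_image: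
  assumes "\<And>z z'. z \<in> S \<Longrightarrow> z' \<in> S \<Longrightarrow> p z = p z' \<Longrightarrow> G z = G z'"
  obtains H where "H \<in> extensional (p ` S)" "\<And>z. z \<in> S \<Longrightarrow> H (p z) = G z"
proof
  show "restrict (\<lambda>t. G (inv_into S p t)) (p ` S) \<in> extensional (p ` S)" by simp
  fix z assume "z \<in> S"
  then show "restrict (\<lambda>t. G (inv_into S p t)) (p ` S) (p z) = G z"
    using assms[of "inv_into S p (p z)" z] f_inv_into_f[of "p z" p S] inv_into_into[of "p z" p S] by simp
qed

lemma ring_free_algebra: "ring (free_algebra :: ('v list \<Rightarrow>\<^sub>0 'k::field) ring)"
proof (rule ringI)
  show "abelian_group (free_algebra :: ('v list \<Rightarrow>\<^sub>0 'k) ring)"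
    by (rule abelian_groupI) (auto simp: free_algebra_def add_eq_0_iff2 add.assoc add.commute intro: exI[of _ "- _"])
  show "Group.monoid (free_algebra :: ('v list \<Rightarrow>\<^sub>0 'k) ring)"
    by (rule monoidI) (auto simp: free_algebra_def mult.assoc)
qed (auto simp: free_algebra_def algebra_simps)

lemma type_ring_hom_id: "type_ring_hom (free_algebra :: ('v list \<Rightarrow>\<^sub>0 'k::field) ring) (\<lambda>z. z)"
  by (intro type_ring_hom.intro ring_free_algebra type_ring_hom_axioms.intro) (simp_all add: free_algebra_def)

lemma type_ring_hom_quotient:
  assumes "type_ring_hom R h" "ideal I R"
  shows "type_ring_hom (R Quot I) (\<lambda>z. I +>\<^bsub>R\<^esub> h z)"
proof -
  interpret type_ring_hom R h by fact
  interpret ideal I R by fact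
  show ?thesis
    using ring_hom_closed[OF rcos_ring_hom] ring_hom_add[OF rcos_ring_hom] ring_hom_mult[OF rcos_ring_hom]
      ring_hom_one[OF rcos_ring_hom]
    by (intro type_ring_hom.intro quotient_is_ring type_ring_hom_axioms.intro) (simp_all add: add mult one)
qed

lemma (in ideal) coset_eq_iff:
  assumes "a \<in> carrier R" "b \<in> carrier R"
  shows "I +> a = I +> b \<longleftrightarrow> a \<ominus> b \<in> I"
  using quotient_eq_iff_same_a_r_cos[OF is_ideal assms] by simp

context based_space
begin

lemma tensor_ideal_ideal: "ideal (tensor_ideal scale) (free_algebra :: ('v list \<Rightarrow>\<^sub>0 'k) ring)"
  unfolding tensor_ideal_def by (rule ring.genideal_ideal[OF ring_free_algebra]) (simp add: free_algebra_def)

lemma tensor_ideal_closed: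
  shows tensor_ideal_add: "x \<in> tensor_ideal scale \<Longrightarrow> y \<in> tensor_ideal scale \<Longrightarrow> x + y \<in> tensor_ideal scale"
    and tensor_ideal_left: "x \<in> tensor_ideal scale \<Longrightarrow> z * x \<in> tensor_ideal scale"
    and tensor_ideal_right: "x \<in> tensor_ideal scale \<Longrightarrow> x * z \<in> tensor_ideal scale"
    and tensor_ideal_zero: "0 \<in> tensor_ideal scale"
proof -
  interpret ideal "tensor_ideal scale" "free_algebra :: ('v list \<Rightarrow>\<^sub>0 'k) ring" by (rule tensor_ideal_ideal)
  show "x \<in> tensor_ideal scale \<Longrightarrow> y \<in> tensor_ideal scale \<Longrightarrow> x + y \<in> tensor_ideal scale"
    using additive_subgroup.a_closed[OF ideal.axioms(1)[OF tensor_ideal_ideal], of x y] by (simp add: free_algebra_def)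
  show "x \<in> tensor_ideal scale \<Longrightarrow> z * x \<in> tensor_ideal scale"
    using I_l_closed[of x z] by (simp add: free_algebra_def)
  show "x \<in> tensor_ideal scale \<Longrightarrow> x * z \<in> tensor_ideal scale"
    using I_r_closed[of x z] by (simp add: free_algebra_def)
  show "0 \<in> tensor_ideal scale"
    using additive_subgroup.zero_closed[OF ideal.axioms(1)[OF tensor_ideal_ideal]] by (simp add: free_algebra_def)
qed

lemma tensor_ideal_generators:
  shows "single [x + y] 1 - single [x] 1 - single [y] 1 \<in> tensor_ideal scale"
    and "single [scale c x] 1 - single [x] c \<in> tensor_ideal scale"
proof -
  have *: "S \<subseteq> Idl\<^bsub>free_algebra\<^esub> S" for S :: "('v list \<Rightarrow>\<^sub>0 'k) set"
    by (rule ring.genideal_self[OF ring_free_algebra]) (simp add: free_algebra_def)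
  show "single [x + y] 1 - single [x] 1 - single [y] 1 \<in> tensor_ideal scale"
    unfolding tensor_ideal_def by (rule subsetD[OF *]) auto
  show "single [scale c x] 1 - single [x] c \<in> tensor_ideal scale"
    unfolding tensor_ideal_def by (rule subsetD[OF *]) auto
qed

text \<open>Linearity of the letters modulo the ideal, applied to the expansion of a vector in the basis. The
  empty sum needs that the letter 0 lies in the ideal, which is the additivity relation for
  \<open>0 + 0\<close>.\<close>

lemma letter_diff_mem: "single [v] 1 - nf_letter v \<in> tensor_ideal scale"
proof -
  have sum: "single [\<Sum>b\<in>A. scale (c b) b] 1 - (\<Sum>b\<in>A. single [b] (c b)) \<in> tensor_ideal scale"
    if "finite A" for A c
    using that
  proof (induction A)
    case empty
    have "- (single [0 + 0] 1 - single [0] 1 - single [0] (1::'k)) \<in> tensor_ideal scale"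
      using tensor_ideal_left[OF tensor_ideal_generators(1), of "-1" 0 0] by simp
    then show ?case by simp
  next
    case (insert b A)
    let ?x = "scale (c b) b" and ?y = "\<Sum>b\<in>A. scale (c b) b"
    have "(single [?x + ?y] 1 - single [?x] 1 - single [?y] 1) + (single [?x] 1 - single [b] (c b))
        + (single [?y] 1 - (\<Sum>b\<in>A. single [b] (c b))) \<in> tensor_ideal scale"
      using insert by (intro tensor_ideal_add tensor_ideal_generators) auto
    then show ?case using insert by (simp add: algebra_simps)
  qed
  have "(\<Sum>b\<in>\<B>. scale (rep v b) b) = v"
    using V.sum_representation_eq[OF V.independent_Basis _ finite_\<B>, of v] V.span_Basis by simp
  then show ?thesis using sum[OF finite_\<B>, of "rep v"] by (simp add: nf_letter_def)
qed

lemma nf_diff_mem: "z - nf z \<in> tensor_ideal scale"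
proof (induction z rule: poly_mapping_induct)
  case (single ws c)
  have "single ws 1 - nf_word ws \<in> tensor_ideal scale"
  proof (induction ws)
    case Nil
    then show ?case by (simp add: nf_word_def one_eq_single tensor_ideal_zero)
  next
    case (Cons w ws)
    have "(single [w] 1 - nf_letter w) * single ws 1 + nf_letter w * (single ws 1 - nf_word ws) \<in> tensor_ideal scale"
      by (intro tensor_ideal_add tensor_ideal_left tensor_ideal_right letter_diff_mem Cons)
    then show ?case by (simp add: algebra_simps mult_single_word nf_word_def)
  qed
  from tensor_ideal_left[OF this, of "single [] c"]
  show ?case by (simp add: algebra_simps nf_single mult_single_word)
next
  case (add x y)
  from tensor_ideal_add[OF this] show ?case by (simp add: nf_add algebra_simps)
qed

text \<open>One inclusion holds since the kernel is an ideal containing the generators, the other since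
  \<open>z\<close> and \<open>nf z\<close> are congruent.\<close>

lemma tensor_ideal_eq: "tensor_ideal scale = {z. nf z = 0}"
proof
  have "nf_letter (x + y) = nf_letter x + nf_letter y" for x y
    by (simp add: nf_letter_def V.representation_add[OF V.independent_Basis] V.span_Basis single_add sum.distrib)
  moreover have "nf_letter (scale c x) = single [] c * nf_letter x" for c x
    by (simp add: nf_letter_def V.representation_scale[OF V.independent_Basis] V.span_Basis mult_single_word sum_distrib_left)
  ultimately have gen: "nf (single [x + y] 1 - single [x] 1 - single [y] 1) = 0"
     "nf (single [scale c x] 1 - single [x] c) = 0" for c x y
    by (simp_all add: nf_diff nf_single nf_word_def flip: one_eq_single)
  have "ideal {z. nf z = 0} (free_algebra :: ('v list \<Rightarrow>\<^sub>0 'k) ring)"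
  proof (rule idealI[OF ring_free_algebra])
    have inv: "\<ominus>\<^bsub>free_algebra\<^esub> z = - z" for z :: "'v list \<Rightarrow>\<^sub>0 'k"
      using type_ring_hom.uminus[OF type_ring_hom_id, of z] by simp
    show "subgroup {z. nf z = 0} (add_monoid (free_algebra :: ('v list \<Rightarrow>\<^sub>0 'k) ring))"
    proof (rule group.subgroupI[OF abelian_group.a_group[OF ring.is_abelian_group[OF ring_free_algebra]]])
      fix z :: "'v list \<Rightarrow>\<^sub>0 'k" assume "z \<in> {z. nf z = 0}"
      then show "inv\<^bsub>add_monoid free_algebra\<^esub> z \<in> {z. nf z = 0}"
        unfolding a_inv_def[symmetric] inv by (simp add: nf_uminus)
    qed (auto simp: free_algebra_def nf_add intro: exI[of _ 0])
  qed (auto simp: free_algebra_def nf_mult)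
  then show "tensor_ideal scale \<subseteq> {z. nf z = 0}"
    unfolding tensor_ideal_def by (rule ring.genideal_minimal[OF ring_free_algebra]) (auto simp: gen)
  show "{z. nf z = 0} \<subseteq> tensor_ideal scale"
  proof
    fix z assume "z \<in> {z. nf z = 0}"
    then show "z \<in> tensor_ideal scale" using nf_diff_mem[of z] by simp
  qed
qed

abbreviation "TA \<equiv> tensor_algebra scale"
abbreviation "tc \<equiv> tensor_class scale"
abbreviation "TP \<equiv> tensor_power scale"

end

sublocale based_space \<subseteq> T: type_ring_hom "tensor_algebra scale" "tensor_class scale"
  using type_ring_hom_quotient[OF type_ring_hom_id tensor_ideal_ideal]
  by (simp add: tensor_algebra_def tensor_class_def[abs_def])

context based_space
begin

lemma tc_eq_iff: "tc x = tc y \<longleftrightarrow> nf x = nf y"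
proof -
  interpret FA: ring "free_algebra :: ('v list \<Rightarrow>\<^sub>0 'k) ring" by (rule ring_free_algebra)
  have "tc x = tc y \<longleftrightarrow> x \<ominus>\<^bsub>free_algebra\<^esub> y \<in> tensor_ideal scale"
    unfolding tensor_class_def by (rule ideal.coset_eq_iff[OF tensor_ideal_ideal]) (simp_all add: free_algebra_def)
  also have "x \<ominus>\<^bsub>free_algebra\<^esub> y = x - y"
    using type_ring_hom.minus[OF type_ring_hom_id, of x y] by simp
  finally show ?thesis by (simp add: tensor_ideal_eq nf_diff)
qed

lemma tc_nf [simp]: "tc (nf z) = tc z"
  by (simp add: tc_eq_iff)

lemma carrier_TA: "carrier TA = range tc"
  by (auto simp: tensor_algebra_def tensor_class_def[abs_def] FactRing_def A_RCOSETS_def' free_algebra_def a_r_coset_def)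

lemma tensor_power_eq: "TP m = tc ` {z. homog m z}"
  by (simp add: tensor_power_def homog_def)

lemma tc_mem_power: "homog m z \<Longrightarrow> tc z \<in> TP m"
  by (auto simp: tensor_power_eq)

lemma tensor_powerE:
  assumes "t \<in> TP m"
  obtains z where "homog m z" "reduced z" "t = tc z"
  using assms by (auto simp: tensor_power_eq) (metis homog_nf reduced_nf tc_nf)

lemma tc_reduced_inj: "reduced x \<Longrightarrow> reduced y \<Longrightarrow> tc x = tc y \<Longrightarrow> x = y"
  by (simp add: tc_eq_iff nf_reduced)

lemma tensor_scale_tc: "tensor_scale scale c (tc z) = tc (single [] c * z)"
  by (simp add: tensor_scale_def tensor_scalar_def T.mult)

lemma pure_tensor_eq: "pure_tensor scale xs = tc (single xs 1)"
  by (simp add: pure_tensor_def)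

section \<open>The antisymmetrizer on tensors\<close>

text \<open>Existence is the compatibility of place permutations with \<open>nf\<close>, uniqueness the fact that pure
  tensors span.\<close>

lemma permute_tensor_tc:
  assumes s: "\<sigma> permutes {1..m}" and z: "homog m z"
  shows "permute_tensor scale m \<sigma> (tc z) = tc (permute_lin \<sigma> z)"
proof -
  let ?P = "\<lambda>h. h \<in> extensional (TP m) \<and>
     klinear_on TA (tensor_scale scale) (TP m) TA (tensor_scale scale) h \<and>
     (\<forall>xs. length xs = m \<longrightarrow> h (pure_tensor scale xs) = pure_tensor scale (permute_word \<sigma> xs))"
  have val: "h (tc z) = tc (permute_lin \<sigma> z)" if h: "?P h" "homog m z" for h z
    using h(2)
  proof (induction rule: homog_induct)
    case zero
    have "tensor_scale scale 0 (tc 0) = tc 0" by (simp add: tensor_scale_tc)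
    moreover have "tensor_scale scale 0 (h (tc 0)) = \<zero>\<^bsub>TA\<^esub>"
    proof -
      have "h (tc 0) \<in> carrier TA" using h(1) tc_mem_power[OF homog_zero] unfolding klinear_on_def by blast
      then show ?thesis by (auto simp: carrier_TA tensor_scale_tc T.zero)
    qed
    ultimately have "h (tc 0) = \<zero>\<^bsub>TA\<^esub>"
      using h(1) tc_mem_power[OF homog_zero] unfolding klinear_on_def by metis
    then show ?case by (simp add: T.zero permute_lin_def)
  next
    case (single ws c)
    have "h (tensor_scale scale c (tc (single ws 1))) = tensor_scale scale c (h (tc (single ws 1)))"
      using h(1) tc_mem_power[OF homog_single[OF single]] unfolding klinear_on_def by blast
    then show ?case using h(1) single
      by (simp add: tensor_scale_tc pure_tensor_eq mult_single_word permute_lin_def)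
  next
    case (add x y)
    then have "h (tc x \<oplus>\<^bsub>TA\<^esub> tc y) = h (tc x) \<oplus>\<^bsub>TA\<^esub> h (tc y)"
      using h(1) tc_mem_power homog_def unfolding klinear_on_def by blast
    then show ?case using add by (simp add: T.add[symmetric] permute_lin_def lin_add)
  qed
  have well: "tc (permute_lin \<sigma> z) = tc (permute_lin \<sigma> z')" if "z \<in> {z. homog m z}" "z' \<in> {z. homog m z}" "tc z = tc z'" for z z'
    using that nf_permute_lin[OF _ s] by (simp add: tc_eq_iff)
  obtain H where extension: "H \<in> extensional (TP m)" and H: "\<And>z. homog m z \<Longrightarrow> H (tc z) = tc (permute_lin \<sigma> z)"
    unfolding tensor_power_eq by (rule factor_through_image[of "{z. homog m z}" tc "\<lambda>z. tc (permute_lin \<sigma> z)", OF well]) simp_all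
  have "?P H"
  proof (intro conjI allI impI)
    show "H \<in> extensional (TP m)" by (rule extension)
    show "klinear_on TA (tensor_scale scale) (TP m) TA (tensor_scale scale) H"
      unfolding klinear_on_def
    proof (intro conjI ballI allI)
      show "H \<in> TP m \<rightarrow> carrier TA" by (auto simp: tensor_power_eq H)
      fix x y assume "x \<in> TP m" "y \<in> TP m"
      then show "H (x \<oplus>\<^bsub>TA\<^esub> y) = H x \<oplus>\<^bsub>TA\<^esub> H y"
        by (auto simp: tensor_power_eq H homog_add permute_lin_def lin_add simp flip: T.add)
    next
      fix c x assume "x \<in> TP m"
      then show "H (tensor_scale scale c x) = tensor_scale scale c (H x)"
        by (auto simp: tensor_power_eq H homog_scalar tensor_scale_tc permute_lin_def lin_scalar)
    qed
    fix xs :: "'v list" assume "length xs = m"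
    then show "H (pure_tensor scale xs) = pure_tensor scale (permute_word \<sigma> xs)"
      by (simp add: pure_tensor_eq H homog_single permute_lin_def flip: one_eq_single)
  qed
  moreover have "h = H" if "?P h" for h
  proof (rule extensionalityI[of _ "TP m"])
    fix t assume "t \<in> TP m"
    then show "h t = H t" using val[OF that] by (auto simp: tensor_power_eq H)
  qed (use that \<open>?P H\<close> in auto)
  ultimately have "permute_tensor scale m \<sigma> = H"
    unfolding permute_tensor_def by (intro the_equality) blast+
  then show ?thesis by (simp add: H z)
qed

lemma Ant_tc:
  assumes z: "homog m z"
  shows "Ant scale m (tc z) = tc (ant_lin z)"
proof -
  have "Ant scale m (tc z) = finsum TA (\<lambda>\<sigma>. tc (of_int (sign \<sigma>) * permute_lin \<sigma> z)) {\<sigma>. \<sigma> permutes {1..m}}"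
    unfolding Ant_def by (rule T.R.finsum_cong') (auto simp: permute_tensor_tc[OF _ z] T.of_int)
  then show ?thesis by (simp add: ant_lin_permute_lin[OF z] T.sum)
qed

end

section \<open>Exterior powers\<close>

context based_space
begin

definition ext_class :: "('v list \<Rightarrow>\<^sub>0 'k) \<Rightarrow> ('k, 'v) tensor set" where
  "ext_class z = exterior_proj scale (tc z)"

abbreviation "EA \<equiv> exterior_algebra scale"
abbreviation "EP \<equiv> exterior_power scale"

lemma exterior_ideal_ideal: "ideal (exterior_ideal scale) TA"
  unfolding exterior_ideal_def by (rule T.R.genideal_ideal) (auto simp: pure_tensor_eq)

end

sublocale based_space \<subseteq> E: type_ring_hom "exterior_algebra scale" ext_class
  using type_ring_hom_quotient[OF T.type_ring_hom_axioms exterior_ideal_ideal]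
  by (simp add: exterior_algebra_def ext_class_def[abs_def] exterior_proj_def)

context based_space
begin

lemma ext_class_nf: "ext_class (nf z) = ext_class z"
  by (simp add: ext_class_def)

lemma exterior_scale_ext_class: "exterior_scale scale c (ext_class z) = ext_class (single [] c * z)"
  by (simp add: exterior_scale_def E.mult) (simp add: ext_class_def tensor_scalar_def)

lemma wedge_eq: "wedge scale xs = ext_class (single xs 1)"
  by (simp add: wedge_def ext_class_def pure_tensor_eq)

lemma exterior_power_eq: "EP m = ext_class ` {z. homog m z}"
  by (auto simp: exterior_power_def tensor_power_eq ext_class_def)

lemma ext_class_mem_power: "homog m z \<Longrightarrow> ext_class z \<in> EP m"
  by (auto simp: exterior_power_eq)

lemma exterior_powerE:
  assumes "w \<in> EP m"
  obtains z where "homog m z" "reduced z" "w = ext_class z"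
  using assms by (auto simp: exterior_power_eq) (metis homog_nf reduced_nf ext_class_nf)

lemma ext_class_square: "ext_class (single [x, x] 1) = \<zero>\<^bsub>EA\<^esub>"
proof -
  have "tc (single [x, x] 1) \<in> exterior_ideal scale"
    unfolding exterior_ideal_def
    by (rule subsetD[OF T.R.genideal_self]) (auto simp: pure_tensor_eq)
  then have "tc (single [x, x] 1 - 0) \<in> exterior_ideal scale" by simp
  then have "ext_class (single [x, x] 1) = ext_class 0"
    unfolding ext_class_def exterior_proj_def
    by (subst ideal.coset_eq_iff[OF exterior_ideal_ideal]) (simp_all flip: T.minus)
  then show ?thesis by (simp add: E.zero)
qed

lemma ext_class_repeat: "ext_class (single (us @ x # x # vs) 1) = \<zero>\<^bsub>EA\<^esub>"
proof -
  have "single (us @ x # x # vs) 1 = single us 1 * single [x, x] 1 * single vs (1::'k)"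
    by (simp add: mult_single_word)
  then show ?thesis by (simp add: E.mult ext_class_square)
qed

text \<open>Polarization of \<open>x \<and> x = 0\<close>.\<close>

lemma ext_class_swap: "ext_class (single (us @ a # b # vs) 1) = ext_class (- single (us @ b # a # vs) 1)"
proof -
  let ?s = "\<lambda>x. single [x] (1::'k)"
  have sum: "tc (?s (a + b)) = tc (?s a + ?s b)"
    using tensor_ideal_generators(1)[of a b]
    by (simp add: tc_eq_iff tensor_ideal_eq nf_diff nf_add diff_eq_eq algebra_simps)
  have "ext_class (?s (a + b) * ?s (a + b)) = ext_class ((?s a + ?s b) * (?s a + ?s b))"
    unfolding E.mult by (simp only: ext_class_def sum)
  then have "ext_class (single [a, a] 1 + single [b, b] 1 + (single [a, b] 1 + single [b, a] 1)) = \<zero>\<^bsub>EA\<^esub>"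
    by (simp add: algebra_simps mult_single_word ext_class_square)
  then have "ext_class (single [a, b] 1 + single [b, a] 1) = \<zero>\<^bsub>EA\<^esub>"
    by (simp add: E.add ext_class_square)
  then have "ext_class (single us 1 * (single [a, b] 1 + single [b, a] 1) * single vs 1) = \<zero>\<^bsub>EA\<^esub>"
    by (simp add: E.mult)
  then have *: "ext_class (single (us @ a # b # vs) 1 + single (us @ b # a # vs) 1) = \<zero>\<^bsub>EA\<^esub>"
    by (simp add: algebra_simps mult_single_word)
  have "ext_class (single (us @ a # b # vs) 1) =
     ext_class (single (us @ a # b # vs) 1 + single (us @ b # a # vs) 1 + - single (us @ b # a # vs) 1)" by simp
  also have "\<dots> = ext_class (- single (us @ b # a # vs) 1)"
    by (subst E.add, subst *) simp
  finally show ?thesis .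
qed

text \<open>The antisymmetrizer is not multiplicative, so its kernel is not visibly an ideal. But the elements
  \<open>z\<close> all of whose multiples \<open>u z v\<close> are killed form an ideal for trivial reasons, and it contains
  the generators.\<close>

lemma ant_lin_exterior_ideal:
  assumes "tc z \<in> exterior_ideal scale"
  shows "nf (ant_lin z) = 0"
proof -
  let ?J = "{z :: 'v list \<Rightarrow>\<^sub>0 'k. \<forall>u v. ant_lin (u * z * v) = 0}"
  have J: "0 \<in> ?J" "\<And>x y. x \<in> ?J \<Longrightarrow> y \<in> ?J \<Longrightarrow> x + y \<in> ?J" "\<And>x. x \<in> ?J \<Longrightarrow> - x \<in> ?J"
     "\<And>x y. x \<in> ?J \<Longrightarrow> x * y \<in> ?J" "\<And>x y. x \<in> ?J \<Longrightarrow> y * x \<in> ?J"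
    by (auto simp: ant_lin_def lin_add lin_uminus algebra_simps) (metis mult.assoc)+
  have square: "single [x, x] 1 \<in> ?J" for x
  proof safe
    fix u v :: "'v list \<Rightarrow>\<^sub>0 'k"
    show "ant_lin (u * single [x, x] 1 * v) = 0"
    proof (induction u rule: poly_mapping_induct)
      case (single us a)
      show ?case
        by (induction v rule: poly_mapping_induct)
          (simp_all add: ant_lin_def mult_single_word ant_repeat distrib_left lin_add)
    qed (simp add: ant_lin_def distrib_right lin_add)
  qed
  have "ideal (tc ` ?J) TA"
  proof (rule idealI[OF T.R.ring_axioms])
    show "subgroup (tc ` ?J) (add_monoid TA)"
    proof (rule group.subgroupI[OF T.R.add.is_group])
      fix t assume "t \<in> tc ` ?J"
      then obtain z where z: "z \<in> ?J" "t = tc z" by blast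
      show "inv\<^bsub>add_monoid TA\<^esub> t \<in> tc ` ?J"
        unfolding a_inv_def[symmetric] z(2) T.uminus[symmetric] using J(3)[OF z(1)] by (rule imageI)
    next
      fix t t' assume "t \<in> tc ` ?J" "t' \<in> tc ` ?J"
      then obtain z z' where z: "z \<in> ?J" "t = tc z" "z' \<in> ?J" "t' = tc z'" by blast
      have "t \<oplus>\<^bsub>TA\<^esub> t' \<in> tc ` ?J"
        unfolding z(2,4) T.add[symmetric] using J(2)[OF z(1,3)] by (rule imageI)
      then show "t \<otimes>\<^bsub>add_monoid TA\<^esub> t' \<in> tc ` ?J" by simp
    next
      show "tc ` ?J \<noteq> {}" using J(1) by blast
    qed auto
  next
    fix a x assume "a \<in> tc ` ?J" "x \<in> carrier TA"
    then obtain z z' where z: "z \<in> ?J" "a = tc z" "x = tc z'" unfolding carrier_TA by blast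
    show "x \<otimes>\<^bsub>TA\<^esub> a \<in> tc ` ?J" unfolding z(2,3) T.mult[symmetric] using J(5)[OF z(1)] by (rule imageI)
    show "a \<otimes>\<^bsub>TA\<^esub> x \<in> tc ` ?J" unfolding z(2,3) T.mult[symmetric] using J(4)[OF z(1)] by (rule imageI)
  qed
  then have "exterior_ideal scale \<subseteq> tc ` ?J"
    unfolding exterior_ideal_def
    by (rule T.R.genideal_minimal) (use square in \<open>auto simp: pure_tensor_eq\<close>)
  then obtain z' where z': "z' \<in> ?J" "tc z = tc z'" using assms by blast
  have "ant_lin (1 * z' * 1) = 0" using z'(1) by blast
  then have "ant_lin (nf z') = 0" using nf_ant_lin[of z'] by simp
  then show ?thesis using z'(2) by (simp add: tc_eq_iff nf_ant_lin)
qed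

lemma ext_class_eq_imp:
  assumes "ext_class z = ext_class z'" shows "tc (ant_lin z) = tc (ant_lin z')"
proof -
  have "tc (z - z') \<in> exterior_ideal scale"
    using assms unfolding ext_class_def exterior_proj_def
    by (subst (asm) ideal.coset_eq_iff[OF exterior_ideal_ideal]) (simp_all add: T.minus)
  from ant_lin_exterior_ideal[OF this] show ?thesis
    by (simp add: tc_eq_iff ant_lin_def lin_diff nf_diff)
qed

text \<open>Bubble sort for words in the basis, compared by the indices of their letters.\<close>

lemma basis_word_induct [consumes 2, case_names increasing repeat swap]:
  assumes ws: "ws \<in> lists \<B>" "length ws = m"
    and incr: "\<And>js. sorted_wrt (<) js \<Longrightarrow> set js \<subseteq> {1..n} \<Longrightarrow> length js = m \<Longrightarrow> R (map e js)"
    and rep: "\<And>us a vs. length (us @ a # a # vs) = m \<Longrightarrow> R (us @ a # a # vs)"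
    and swap: "\<And>us a b vs. length (us @ a # b # vs) = m \<Longrightarrow> R (us @ b # a # vs) \<Longrightarrow> R (us @ a # b # vs)"
  shows "R ws"
proof -
  have "set js \<subseteq> {1..n} \<and> length js = m \<longrightarrow> R (map e js)" for js
    by (induction js rule: bubble_sort_induct) (use incr rep swap in auto)
  moreover obtain js where "ws = map e js" "js \<in> lists {1..n}"
    using ws(1) unfolding \<B>_def lists_image by blast
  ultimately show ?thesis using ws(2) by auto
qed

lemma reduced_homog_induct [consumes 2, case_names zero single add]:
  assumes "reduced z" "homog m z"
    and "R 0" "\<And>ws c. ws \<in> lists \<B> \<Longrightarrow> length ws = m \<Longrightarrow> R (single ws c)"
    and "\<And>x y. reduced x \<Longrightarrow> homog m x \<Longrightarrow> reduced y \<Longrightarrow> homog m y \<Longrightarrow> R x \<Longrightarrow> R y \<Longrightarrow> R (x + y)"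
  shows "R z"
  using keys_induct[of z "lists \<B> \<inter> {ws. length ws = m}" R] assms
  by (simp add: reduced_def homog_def)

text \<open>The antisymmetrizer factors through the exterior power and has the values prescribed for
  \<open>\<phi>\<^sub>m\<close>. A linear map with these values is unique because increasing wedge products span, by bubble
  sort.\<close>

lemma phi_ext_class:
  assumes z: "homog m z"
  shows "phi scale n e m (ext_class z) = tc (ant_lin z)"
proof -
  let ?P = "\<lambda>h. h \<in> extensional (EP m) \<and>
     klinear_on EA (exterior_scale scale) (EP m) TA (tensor_scale scale) h \<and>
     (\<forall>js. length js = m \<and> sorted_wrt (<) js \<and> set js \<subseteq> {1..n} \<longrightarrow>
        h (wedge scale (map e js)) = Ant scale m (pure_tensor scale (map e js)))"
  obtain H where extension: "H \<in> extensional (EP m)" and H: "\<And>z. homog m z \<Longrightarrow> H (ext_class z) = tc (ant_lin z)"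
    unfolding exterior_power_eq
    by (rule factor_through_image[of "{z. homog m z}" ext_class "\<lambda>z. tc (ant_lin z)", OF ext_class_eq_imp]) simp_all
  have "?P H"
  proof (intro conjI allI impI)
    show "klinear_on EA (exterior_scale scale) (EP m) TA (tensor_scale scale) H"
      unfolding klinear_on_def
    proof (intro conjI ballI allI)
      show "H \<in> EP m \<rightarrow> carrier TA" by (auto simp: exterior_power_eq H)
      fix x y assume "x \<in> EP m" "y \<in> EP m"
      then show "H (x \<oplus>\<^bsub>EA\<^esub> y) = H x \<oplus>\<^bsub>TA\<^esub> H y"
        by (auto simp: exterior_power_eq H homog_add ant_lin_def lin_add simp flip: T.add E.add)
    next
      fix c x assume "x \<in> EP m"
      then show "H (exterior_scale scale c x) = tensor_scale scale c (H x)"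
        by (auto simp: exterior_power_eq H homog_scalar exterior_scale_ext_class tensor_scale_tc ant_lin_def lin_scalar)
    qed
  qed (auto simp: extension wedge_eq H pure_tensor_eq Ant_tc homog_single)
  moreover have "h = H" if h: "?P h" for h
  proof -
    have add: "h (ext_class (x + y)) = h (ext_class x) \<oplus>\<^bsub>TA\<^esub> h (ext_class y)" if "homog m x" "homog m y" for x y
      using h that ext_class_mem_power unfolding klinear_on_def E.add by blast
    have scal: "h (ext_class (single [] c * x)) = tensor_scale scale c (h (ext_class x))" if "homog m x" for x c
      using h that ext_class_mem_power unfolding klinear_on_def exterior_scale_ext_class[symmetric] by blast
    have car: "h (ext_class x) \<in> range tc" if "homog m x" for x
      using h that ext_class_mem_power unfolding klinear_on_def carrier_TA by blast
    have zero: "h (ext_class 0) = tc 0"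
    proof -
      obtain y where "h (ext_class 0) = tc y" using car[OF homog_zero] by blast
      then show ?thesis using scal[OF homog_zero, of 0] by (simp add: tensor_scale_tc)
    qed
    have word: "h (ext_class (single ws 1)) = tc (ant_lin (single ws 1))" if "ws \<in> lists \<B>" "length ws = m" for ws
      using that
    proof (induction rule: basis_word_induct)
      case (increasing js)
      then show ?case using h by (simp add: wedge_eq pure_tensor_eq Ant_tc homog_single)
    next
      case (repeat us a vs)
      then show ?case using zero by (simp add: ext_class_repeat E.zero ant_lin_def ant_repeat)
    next
      case (swap us a b vs)
      have "h (ext_class (single [] (-1) * single (us @ b # a # vs) 1)) = tensor_scale scale (-1) (h (ext_class (single (us @ b # a # vs) 1)))"
        using swap by (intro scal homog_single) simp
      also have "single [] (-1) * single (us @ b # a # vs) 1 = - single (us @ b # a # vs) (1::'k)"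
        by (simp add: mult_single_word single_uminus)
      also have "tensor_scale scale (-1) (h (ext_class (single (us @ b # a # vs) 1))) = tc (ant_lin (single (us @ a # b # vs) 1))"
        unfolding swap(2) by (simp add: tensor_scale_tc ant_lin_def ant_swap[of us a] single_uminus flip: one_eq_single)
      finally show ?case by (simp only: ext_class_swap[of us a])
    qed
    have val: "h (ext_class x) = tc (ant_lin x)" if "reduced x" "homog m x" for x
      using that
    proof (induction rule: reduced_homog_induct)
      case (single ws c)
      then show ?case using scal[OF homog_single[of ws m 1], of c] word[of ws]
        by (simp add: mult_single_word tensor_scale_tc ant_lin_def flip: one_eq_single)
    qed (simp_all add: zero add ant_lin_def lin_add T.add)
    show ?thesis
    proof (rule extensionalityI[of _ "EP m"])
      fix w assume "w \<in> EP m"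
      then obtain x where "homog m x" "reduced x" "w = ext_class x" by (rule exterior_powerE)
      then show "h w = H w" by (simp add: val H)
    qed (use h extension in auto)
  qed
  ultimately have "phi scale n e m = H"
    unfolding phi_def by (intro the_equality) blast+
  then show ?thesis by (simp add: H z)
qed

end

section \<open>The Koszul spaces\<close>

lemma ant_Nil: "ant [] = 1"
proof -
  have "{\<sigma> :: nat \<Rightarrow> nat. \<sigma> permutes {1..0}} = {id}" by (auto simp: permutes_empty)
  then show ?thesis by (simp add: ant_def one_eq_single mult_single_word)
qed

definition alternating_at :: "nat \<Rightarrow> nat \<Rightarrow> ('a list \<Rightarrow>\<^sub>0 'k::field) \<Rightarrow> bool" where
  "alternating_at i m z \<longleftrightarrow> (\<forall>us a b vs. i \<le> length us \<longrightarrow> length us + 2 \<le> i + m \<longrightarrow>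
     coeff z (us @ a # b # vs) = - coeff z (us @ b # a # vs) \<and> coeff z (us @ a # a # vs) = 0)"

lemma alternating_at_add:
  assumes "alternating_at i m x" "alternating_at i m y"
  shows "alternating_at i m (x + y)"
  unfolding alternating_at_def
proof (intro allI impI)
  fix us :: "'a list" and a b vs
  assume "i \<le> length us" "length us + 2 \<le> i + m"
  then have "coeff z (us @ a # b # vs) = - coeff z (us @ b # a # vs)" "coeff z (us @ a # a # vs) = 0"
    if "alternating_at i m z" for z :: "'a list \<Rightarrow>\<^sub>0 'b"
    using that unfolding alternating_at_def by blast+
  from this[OF assms(1)] this[OF assms(2)]
  show "coeff (x + y) (us @ a # b # vs) = - coeff (x + y) (us @ b # a # vs) \<and> coeff (x + y) (us @ a # a # vs) = 0"
    by (simp only: lookup_add) simp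
qed

context based_space
begin

abbreviation "RN \<equiv> sym_relations scale"
abbreviation "KS \<equiv> koszul_space scale"

definition incr_lists :: "nat \<Rightarrow> nat list set" where
  "incr_lists m = {js. sorted_wrt (<) js \<and> set js \<subseteq> {1..n} \<and> length js = m}"

lemma finite_incr_lists: "finite (incr_lists m)"
  unfolding incr_lists_def by (rule finite_subset[OF _ finite_lists_length_eq[of "{1..n}" m]]) auto

lemma coeff_ant_incr_lists:
  assumes "js \<in> incr_lists m" "ks \<in> incr_lists m"
  shows "coeff (ant (map e js)) (map e ks) = (if js = ks then 1 else 0 :: 'k)"
proof -
  have "inj_on e (set js \<union> set ks)"
    using assms by (intro inj_on_subset[OF inj_e]) (auto simp: incr_lists_def)
  then show ?thesis using assms by (simp add: coeff_ant_map coeff_ant_increasing incr_lists_def)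
qed

lemma sym_relationsE:
  assumes "t \<in> RN N"
  obtains z where "reduced z" "homog N z" "t = tc (ant_lin z)"
  using assms unfolding sym_relations_def by (auto elim!: tensor_powerE simp: Ant_tc)

text \<open>The alternation of the middle factor in \<open>V\<^sup>\<otimes>\<^sup>i \<otimes> R \<otimes> V\<^sup>\<otimes>\<^sup>j\<close> survives multiplication by homogeneous
  factors on both sides, because these only see the other positions.\<close>

lemma koszul_factor_alternating:
  assumes "t \<in> ideal_prod TA (ideal_prod TA (TP i) (RN N)) (TP j)"
  shows "\<exists>z. reduced z \<and> homog (i + N + j) z \<and> t = tc z \<and> alternating_at i N z"
  using assms
proof induction
  case (prod s v)
  from prod(1) have "\<exists>z. reduced z \<and> homog (i + N) z \<and> s = tc z \<and> alternating_at i N z"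
  proof induction
    case (prod u r)
    from prod(1) obtain u' where u: "homog i u'" "reduced u'" "u = tc u'" by (rule tensor_powerE)
    from prod(2) obtain r' where r: "reduced r'" "homog N r'" "r = tc (ant_lin r')" by (rule sym_relationsE)
    have "alternating_at i N (u' * ant_lin r')"
      unfolding alternating_at_def
    proof (intro allI impI)
      fix us :: "'v list" and a b vs
      assume "i \<le> length us"
      then have split: "take i (us @ c # d # vs) = take i us" "drop i (us @ c # d # vs) = drop i us @ c # d # vs" for c d
        by simp_all
      show "coeff (u' * ant_lin r') (us @ a # b # vs) = - coeff (u' * ant_lin r') (us @ b # a # vs) \<and>
         coeff (u' * ant_lin r') (us @ a # a # vs) = 0"
        unfolding coeff_mult_homog[OF u(1)] split
        using coeff_ant_lin_swap[of r' "drop i us" a b vs] by (simp add: coeff_ant_lin_repeat)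
    qed
    then show ?case using u r
      by (intro exI[of _ "u' * ant_lin r'"])
        (simp add: reduced_mult reduced_ant_lin homog_mult homog_ant_lin T.mult)
  next
    case (sum s s')
    then show ?case by (metis T.add alternating_at_add homog_add reduced_add)
  qed
  then obtain x where x: "reduced x" "homog (i + N) x" "s = tc x" "alternating_at i N x" by blast
  from prod(2) obtain v' where v: "homog j v'" "reduced v'" "v = tc v'" by (rule tensor_powerE)
  have "alternating_at i N (x * v')"
    unfolding alternating_at_def
  proof (intro allI impI)
    fix us :: "'v list" and a b vs
    assume l: "i \<le> length us" "length us + 2 \<le> i + N"
    have split: "take (i + N) (us @ c # d # vs) = us @ c # d # take (i + N - length us - 2) vs"
      "drop (i + N) (us @ c # d # vs) = drop (i + N - length us - 2) vs" for c d
      using l by (simp_all add: take_Cons' drop_Cons' numeral_2_eq_2)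
    show "coeff (x * v') (us @ a # b # vs) = - coeff (x * v') (us @ b # a # vs) \<and>
       coeff (x * v') (us @ a # a # vs) = 0"
      unfolding coeff_mult_homog[OF x(2)] split
      using x(4)[unfolded alternating_at_def, rule_format, OF l, of a b "take (i + N - length us - 2) vs"]
      by simp
  qed
  then show ?case using x v
    by (intro exI[of _ "x * v'"]) (simp add: reduced_mult homog_mult T.mult)
next
  case (sum s s')
  then show ?case by (metis T.add alternating_at_add homog_add reduced_add)
qed

text \<open>An alternating family of coefficients is determined by its values on increasing words, so \<open>z\<close> is the
  antisymmetrization of its own increasing part. This holds in every characteristic, with no
  division by \<open>m!\<close>.\<close>

lemma alternating_imp_ant_lin:
  assumes z: "reduced z" "homog m z"
    and swap: "\<And>us a b vs. length (us @ a # b # vs) = m \<Longrightarrow> coeff z (us @ a # b # vs) = - coeff z (us @ b # a # vs)"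
    and rep: "\<And>us a vs. length (us @ a # a # vs) = m \<Longrightarrow> coeff z (us @ a # a # vs) = 0"
  shows "\<exists>y. reduced y \<and> homog m y \<and> z = ant_lin y"
proof -
  define y where "y = (\<Sum>js\<in>incr_lists m. single (map e js) (coeff z (map e js)))"
  have y: "reduced y" "homog m y"
    unfolding y_def by (auto intro!: reduced_sum reduced_single homog_sum homog_single imageI simp: incr_lists_def \<B>_def)
  have "z = ant_lin y"
  proof (rule poly_mapping_eqI)
    fix ws
    show "coeff z ws = coeff (ant_lin y) ws"
    proof (cases "ws \<in> lists \<B> \<and> length ws = m")
      case True
      then have "ws \<in> lists \<B>" "length ws = m" by auto
      then show ?thesis
      proof (induction rule: basis_word_induct)
        case (increasing ks)
        then have ks: "ks \<in> incr_lists m" by (simp add: incr_lists_def)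
        have "coeff (ant_lin y) (map e ks) = (\<Sum>js\<in>incr_lists m. coeff z (map e js) * coeff (ant (map e js)) (map e ks))"
          by (simp add: y_def ant_lin_def lin_sum lookup_sum coeff_scalar)
        also have "\<dots> = (\<Sum>js\<in>incr_lists m. if js = ks then coeff z (map e js) else 0)"
          by (intro sum.cong refl) (simp add: coeff_ant_incr_lists ks)
        finally show ?case using ks by (simp add: finite_incr_lists)
      next
        case (repeat us a vs)
        then show ?case by (simp add: rep coeff_ant_lin_repeat)
      next
        case (swap us a b vs)
        then show ?case using assms(3)[of us a b vs] coeff_ant_lin_swap[of y us a b vs] by simp
      qed
    next
      case False
      then have "ws \<notin> Poly_Mapping.keys z" "ws \<notin> Poly_Mapping.keys (ant_lin y)"
        using z reduced_ant_lin[OF y(1)] homog_ant_lin[OF y(2)] by (auto simp: reduced_def homog_def)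
      then show ?thesis by (simp add: in_keys_iff)
    qed
  qed
  then show ?thesis using y by blast
qed

text \<open>As \<open>N \<ge> 2\<close>, every pair of adjacent positions lies in a window of \<open>N\<close> consecutive positions, and
  such windows exist as soon as \<open>m \<ge> N\<close>. For \<open>m = 1\<close> there are no adjacent positions.\<close>

lemma koszul_spaceE:
  assumes t: "t \<in> KS N m" and "2 \<le> N" and m: "m = 1 \<or> N \<le> m"
  obtains z where "reduced z" "homog m z" "t = tc (ant_lin z)"
proof -
  have "t \<in> TP m" using t by (simp add: koszul_space_def)
  then obtain z where z: "homog m z" "reduced z" "t = tc z" by (rule tensor_powerE)
  have alt: "coeff z (us @ a # b # vs) = - coeff z (us @ b # a # vs) \<and> coeff z (us @ a # a # vs) = 0"
    if l: "length (us @ a # b # vs) = m" for us a b vs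
  proof -
    have "N \<le> m" using m l by auto
    define i where "i = min (length us) (m - N)"
    define j where "j = m - N - i"
    have ij: "i + N + j = m" "i \<le> length us" "length us + 2 \<le> i + N"
      using \<open>N \<le> m\<close> \<open>2 \<le> N\<close> l by (auto simp: i_def j_def min_def)
    then have "t \<in> ideal_prod TA (ideal_prod TA (TP i) (RN N)) (TP j)"
      using t by (simp add: koszul_space_def)
    from koszul_factor_alternating[OF this] obtain z' where z': "reduced z'" "t = tc z'" "alternating_at i N z'"
      by blast
    then have "z' = z" using z tc_reduced_inj by blast
    then show ?thesis using z'(3) ij unfolding alternating_at_def by blast
  qed
  have "\<exists>y. reduced y \<and> homog m y \<and> z = ant_lin y"
    using alternating_imp_ant_lin[OF z(2,1) conjunct1[OF alt] conjunct2[OF alt]] by simp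
  then show ?thesis using that z(3) by blast
qed

lemma ideal_prod_sum:
  assumes "tc 0 \<in> I" "tc 0 \<in> J" "\<And>i. i \<in> S \<Longrightarrow> tc (h i) \<in> ideal_prod TA I J"
  shows "tc (sum h S) \<in> ideal_prod TA I J"
  using assms(3)
proof (induction S rule: infinite_finite_induct)
  case (insert x F)
  then show ?case by (simp add: T.add ideal_prod.sum)
qed (use ideal_prod.prod[OF assms(1,2), of TA] in \<open>simp_all add: T.zero\<close>)

text \<open>The block decomposition with one block of length \<open>N\<close>; the second block is empty.\<close>

lemma tc_ant_koszul_space: "tc (ant xs) \<in> KS N (length xs)"
proof -
  have "tc (ant xs) \<in> ideal_prod TA (ideal_prod TA (TP i) (RN N)) (TP j)" if ij: "i + N + j = length xs" for i j
  proof -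
    obtain y where xs: "xs = word y 1 (length xs)" using word_of_list by metis
    have R: "tc (ant_lin z) \<in> RN N" if "homog N z" for z
      unfolding sym_relations_def using that tc_mem_power Ant_tc by force
    have zero: "tc 0 \<in> TP k" for k by (rule tc_mem_power) simp
    have zero': "tc 0 \<in> RN N" using R[OF homog_zero] by (simp add: ant_lin_def)
    have "tc 0 \<in> ideal_prod TA (TP i) (RN N)"
      using ideal_prod.prod[OF zero zero', of TA i] by (simp flip: T.mult)
    then show ?thesis
      apply (subst xs)
      apply (subst ant_blocks[of _ i N j 0 0])
      using ij apply simp
      apply (rule ideal_prod_sum[OF _ zero])
       apply assumption
    proof -
      fix \<tau> :: "nat \<Rightarrow> nat"
      let ?u = "single (word (y \<circ> \<tau>) 1 i) (of_int (sign \<tau>) :: 'k)" and ?r = "single (word (y \<circ> \<tau>) (Suc i) (i + N)) (1 :: 'k)"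
        and ?v = "single (word (y \<circ> \<tau>) (Suc (i + N)) (i + N + j)) (1 :: 'k)"
      have "tc ?u \<otimes>\<^bsub>TA\<^esub> tc (ant_lin ?r) \<otimes>\<^bsub>TA\<^esub> tc ?v \<in> ideal_prod TA (ideal_prod TA (TP i) (RN N)) (TP j)"
        by (intro ideal_prod.prod R tc_mem_power homog_single) simp_all
      then show "tc (single (word (y \<circ> \<tau>) 1 i) (of_int (sign \<tau>)) * ant (word (y \<circ> \<tau>) (Suc i) (i + N)) *
          single (word (y \<circ> \<tau>) (Suc (i + N)) (i + N + j)) 1 *
          ant (word (y \<circ> \<tau>) (Suc (i + N + j)) (i + N + j + 0)) *
          single (word (y \<circ> \<tau>) (Suc (i + N + j + 0)) (length xs)) 1)
         \<in> ideal_prod TA (ideal_prod TA (TP i) (RN N)) (TP j)"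
        using ij by (simp add: word_def ant_Nil ant_lin_def T.mult flip: one_eq_single)
    qed
  qed
  moreover have "tc (ant xs) \<in> TP (length xs)" by (rule tc_mem_power) simp
  ultimately show ?thesis by (simp add: koszul_space_def)
qed

end

section \<open>Koszul cochains\<close>

context bimodule
begin

lemma lact_zero: "a \<in> carrier A \<Longrightarrow> lact P a \<zero>\<^bsub>P\<^esub> = \<zero>\<^bsub>P\<^esub>"
  using lact_add[of a "\<zero>\<^bsub>P\<^esub>" "\<zero>\<^bsub>P\<^esub>"] lact_closed[of a "\<zero>\<^bsub>P\<^esub>"]
  by (metis P.add.l_cancel_one' P.l_zero P.zero_closed)

lemma zero_lact: "x \<in> carrier P \<Longrightarrow> lact P \<zero>\<^bsub>A\<^esub> x = \<zero>\<^bsub>P\<^esub>"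
  using add_lact[of "\<zero>\<^bsub>A\<^esub>" "\<zero>\<^bsub>A\<^esub>" x] lact_closed[of "\<zero>\<^bsub>A\<^esub>" x]
  by (metis A.l_zero A.zero_closed P.add.l_cancel_one')

lemma lact_finsum:
  assumes "a \<in> carrier A" "g \<in> I \<rightarrow> carrier P"
  shows "lact P a (finsum P g I) = finsum P (\<lambda>i. lact P a (g i)) I"
  using assms(2)
proof (induction I rule: infinite_finite_induct)
  case (insert i I)
  then have "g i \<in> carrier P" "g \<in> I \<rightarrow> carrier P" "(\<lambda>i. lact P a (g i)) \<in> I \<rightarrow> carrier P" "lact P a (g i) \<in> carrier P"
    using assms(1) by (auto intro: lact_closed)
  then show ?case using insert assms(1)
    by (simp add: lact_add)
qed (simp_all add: P.finsum_infinite lact_zero assms)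

end

locale sym_space = based_space scale e n
  for scale :: "'k::field \<Rightarrow> 'v::ab_group_add \<Rightarrow> 'v" and e :: "nat \<Rightarrow> 'v" and n :: nat +
  fixes N :: nat
begin

abbreviation "SA \<equiv> sym_algebra scale N"

definition sym_class :: "('v list \<Rightarrow>\<^sub>0 'k) \<Rightarrow> ('k, 'v) tensor set" where
  "sym_class z = sym_proj scale N (tc z)"

lemma sym_ideal_ideal: "ideal (sym_ideal scale N) TA"
  unfolding sym_ideal_def by (rule T.R.genideal_ideal) (auto elim!: sym_relationsE)

lemma sym_scalar_eq: "sym_scalar scale N c = sym_class (single [] c)"
  by (simp add: sym_scalar_def sym_class_def tensor_scalar_def)

end

sublocale sym_space \<subseteq> A: type_ring_hom "sym_algebra scale N" sym_class
  using type_ring_hom_quotient[OF T.type_ring_hom_axioms sym_ideal_ideal]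
  by (simp add: sym_algebra_def sym_class_def[abs_def] sym_proj_def)

locale sym_cochain = sym_space scale e n N + P: bimodule "sym_algebra scale N" "sym_scalar scale N" P
  for scale :: "'k::field \<Rightarrow> 'v::ab_group_add \<Rightarrow> 'v" and e :: "nat \<Rightarrow> 'v" and n N :: nat
    and P :: "(('k, 'v) tensor set, 'p) bimodule" +
  fixes m :: nat and f :: "('k, 'v) tensor set \<Rightarrow> 'p"
  assumes f_lin: "klinear_on EA (exterior_scale scale) (EP m) P (\<lambda>c. lact P (sym_scalar scale N c)) f"
begin

text \<open>The linear map on \<open>F\<close> that picks out the increasing words. It extends \<open>f \<circ> \<phi>\<^sub>m\<inverse>\<close> to tensors that are
  not antisymmetric.\<close>

definition extension :: "('v list \<Rightarrow>\<^sub>0 'k) \<Rightarrow> 'p" where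
  "extension z = (\<Oplus>\<^bsub>P\<^esub>js\<in>incr_lists m. lact P (sym_class (single [] (coeff z (map e js)))) (f (wedge scale (map e js))))"

lemma f_closed: "homog m z \<Longrightarrow> f (ext_class z) \<in> carrier P"
  using f_lin ext_class_mem_power unfolding klinear_on_def by blast

lemma f_add: "homog m x \<Longrightarrow> homog m y \<Longrightarrow> f (ext_class (x + y)) = f (ext_class x) \<oplus>\<^bsub>P\<^esub> f (ext_class y)"
  using f_lin ext_class_mem_power unfolding klinear_on_def E.add by blast

lemma f_scalar: "homog m x \<Longrightarrow> f (ext_class (single [] c * x)) = lact P (sym_class (single [] c)) (f (ext_class x))"
  using f_lin ext_class_mem_power unfolding klinear_on_def exterior_scale_ext_class[symmetric] sym_scalar_eq by blast

lemma f_zero: "f (ext_class 0) = \<zero>\<^bsub>P\<^esub>"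
  using f_scalar[OF homog_zero, of 0] f_closed[OF homog_zero] by (simp add: A.zero P.zero_lact)

lemma wedge_incr_lists_closed: "js \<in> incr_lists m \<Longrightarrow> f (wedge scale (map e js)) \<in> carrier P"
  unfolding wedge_eq by (rule f_closed) (simp add: incr_lists_def homog_single)

lemma extension_closed: "extension z \<in> carrier P"
  unfolding extension_def by (rule P.P.finsum_closed) (auto intro: P.lact_closed wedge_incr_lists_closed)

lemma extension_add: "extension (x + y) = extension x \<oplus>\<^bsub>P\<^esub> extension y"
proof -
  have "extension (x + y) = (\<Oplus>\<^bsub>P\<^esub>js\<in>incr_lists m. lact P (sym_class (single [] (coeff x (map e js)))) (f (wedge scale (map e js)))
       \<oplus>\<^bsub>P\<^esub> lact P (sym_class (single [] (coeff y (map e js)))) (f (wedge scale (map e js))))"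
    unfolding extension_def
    by (rule P.P.finsum_cong') (auto intro!: P.lact_closed wedge_incr_lists_closed simp: lookup_add single_add A.add P.add_lact[OF _ _ wedge_incr_lists_closed])
  also have "\<dots> = extension x \<oplus>\<^bsub>P\<^esub> extension y"
    unfolding extension_def by (rule P.P.finsum_addf) (auto intro!: P.lact_closed wedge_incr_lists_closed)
  finally show ?thesis .
qed

lemma extension_scalar: "extension (single [] c * z) = lact P (sym_class (single [] c)) (extension z)"
proof -
  have "extension (single [] c * z) = (\<Oplus>\<^bsub>P\<^esub>js\<in>incr_lists m. lact P (sym_class (single [] c)) (lact P (sym_class (single [] (coeff z (map e js)))) (f (wedge scale (map e js)))))"
    unfolding extension_def
  proof (rule P.P.finsum_cong')
    fix js assume "js \<in> incr_lists m"
    have "single [] (c * coeff z (map e js)) = single [] c * (single [] (coeff z (map e js)) :: 'v list \<Rightarrow>\<^sub>0 'k)"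
      by (simp add: mult_single_word)
    then show "lact P (sym_class (single [] (coeff (single [] c * z) (map e js)))) (f (wedge scale (map e js))) =
      lact P (sym_class (single [] c)) (lact P (sym_class (single [] (coeff z (map e js)))) (f (wedge scale (map e js))))"
      using wedge_incr_lists_closed[OF \<open>js \<in> incr_lists m\<close>] by (simp add: coeff_scalar A.mult P.mult_lact)
  qed (auto intro!: P.lact_closed wedge_incr_lists_closed)
  then show ?thesis unfolding extension_def
    by (subst P.lact_finsum) (auto intro!: P.lact_closed wedge_incr_lists_closed)
qed

lemma extension_zero: "extension 0 = \<zero>\<^bsub>P\<^esub>"
  using extension_scalar[of 0 0] extension_closed[of 0] by (simp add: A.zero P.zero_lact)

lemma extension_uminus: "extension (- z) = \<ominus>\<^bsub>P\<^esub> extension z"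
  using extension_add[of "- z" z] extension_closed by (simp add: extension_zero P.P.minus_equality)

lemma f_uminus: "homog m z \<Longrightarrow> f (ext_class (- z)) = \<ominus>\<^bsub>P\<^esub> f (ext_class z)"
proof -
  assume z: "homog m z"
  then have z': "homog m (- z)" by (simp add: homog_def)
  show ?thesis using f_add[OF z' z] f_closed[OF z] f_closed[OF z'] by (simp add: f_zero P.P.minus_equality)
qed

text \<open>Both sides are alternating in the letters, hence it suffices to compare them on increasing words,
  where \<open>coeff_ant_increasing\<close> leaves one term.\<close>

lemma extension_ant_lin:
  assumes "reduced z" "homog m z"
  shows "extension (ant_lin z) = f (ext_class z)"
proof -
  have word: "extension (ant_lin (single ws 1)) = f (ext_class (single ws 1))" if "ws \<in> lists \<B>" "length ws = m" for ws
    using that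
  proof (induction rule: basis_word_induct)
    case (increasing ks)
    then have ks: "ks \<in> incr_lists m" by (simp add: incr_lists_def)
    have "extension (ant_lin (single (map e ks) 1)) = (\<Oplus>\<^bsub>P\<^esub>js\<in>incr_lists m. if ks = js then f (wedge scale (map e js)) else \<zero>\<^bsub>P\<^esub>)"
      unfolding extension_def
    proof (rule P.P.finsum_cong')
      fix js assume js: "js \<in> incr_lists m"
      have "lact P \<one>\<^bsub>SA\<^esub> (f (wedge scale (map e js))) = f (wedge scale (map e js))"
        "lact P \<zero>\<^bsub>SA\<^esub> (f (wedge scale (map e js))) = \<zero>\<^bsub>P\<^esub>"
        using wedge_incr_lists_closed[OF js] by (simp_all add: P.one_lact P.zero_lact)
      then show "lact P (sym_class (single [] (coeff (ant_lin (single (map e ks) 1)) (map e js)))) (f (wedge scale (map e js)))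
          = (if ks = js then f (wedge scale (map e js)) else \<zero>\<^bsub>P\<^esub>)"
        by (simp add: ant_lin_def coeff_ant_incr_lists[OF ks js] A.one A.zero flip: one_eq_single)
    qed (auto intro: wedge_incr_lists_closed)
    also have "\<dots> = f (wedge scale (map e ks))"
      by (rule P.P.add.finprod_singleton[OF ks finite_incr_lists]) (auto intro: wedge_incr_lists_closed)
    finally show ?case by (simp add: wedge_eq)
  next
    case (repeat us a vs)
    then show ?case by (simp add: ant_lin_def ant_repeat extension_zero ext_class_repeat f_zero flip: E.zero)
  next
    case (swap us a b vs)
    have "extension (ant_lin (single (us @ a # b # vs) 1)) = \<ominus>\<^bsub>P\<^esub> extension (ant_lin (single (us @ b # a # vs) 1))"
      by (simp add: ant_lin_def ant_swap[of us a] extension_uminus)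
    also have "\<dots> = f (ext_class (single (us @ a # b # vs) 1))"
      using swap by (simp add: ext_class_swap[of us a] f_uminus homog_single)
    finally show ?case .
  qed
  show ?thesis using assms
  proof (induction rule: reduced_homog_induct)
    case (single ws c)
    then show ?case
      using word[of ws] f_scalar[OF homog_single[of ws m 1], of c] extension_scalar[of c "ant ws"]
      by (simp add: ant_lin_def mult_single_word flip: one_eq_single)
  qed (simp_all add: ant_lin_def lin_add extension_add f_add extension_zero f_zero)
qed

text \<open>The preimage under \<open>\<phi>\<^sub>m\<close> chosen in the cochain may be any one: by \<open>extension_ant_lin\<close>, the value of
  \<open>f\<close> at a preimage depends only on its image.\<close>

lemma koszul_cochain_ant_lin:
  assumes "reduced z" "homog m z"
  shows "koszul_cochain scale n e m f (tc (ant_lin z)) = extension (ant_lin z)"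
proof -
  have im: "tc (ant_lin z) \<in> phi scale n e m ` EP m"
    using phi_ext_class[OF assms(2)] ext_class_mem_power[OF assms(2)] by (metis image_eqI)
  let ?w = "inv_into (EP m) (phi scale n e m) (tc (ant_lin z))"
  have "?w \<in> EP m" "phi scale n e m ?w = tc (ant_lin z)"
    using im by (simp_all add: inv_into_into f_inv_into_f)
  then obtain z' where z': "homog m z'" "reduced z'" "?w = ext_class z'" by (meson exterior_powerE)
  then have "tc (ant_lin z') = tc (ant_lin z)"
    using phi_ext_class[OF z'(1)] \<open>phi scale n e m ?w = tc (ant_lin z)\<close> by simp
  then have "ant_lin z' = ant_lin z"
    using assms(1) z'(2) reduced_ant_lin tc_reduced_inj by blast
  then show ?thesis
    using extension_ant_lin[OF z'(2,1)] z'(3) by (simp add: koszul_cochain_def)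
qed

lemma wedge_eq_extension:
  assumes "length xs = m"
  shows "\<exists>y. f (wedge scale xs) = extension y"
  using extension_ant_lin[of "nf (single xs 1)"] assms
  by (metis ext_class_nf homog_nf homog_single reduced_nf wedge_eq)

lemma koszul_cochain_ant:
  assumes "length xs = m"
  shows "koszul_cochain scale n e m f (tc (ant xs)) = f (wedge scale xs)"
proof -
  let ?z = "nf (single xs 1)"
  have z: "reduced ?z" "homog m ?z" by (simp_all add: reduced_nf homog_nf homog_single assms)
  have "tc (ant_lin ?z) = tc (ant xs)"
    by (simp add: tc_eq_iff ant_lin_def flip: one_eq_single nf_ant_lin[unfolded ant_lin_def])
  then show ?thesis
    using koszul_cochain_ant_lin[OF z] extension_ant_lin[OF z] by (simp add: ext_class_nf wedge_eq)
qed

end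

section \<open>The tensor product of bimodules\<close>

locale bimodule_pair = P: bimodule A \<eta> P + Q: bimodule A \<eta> Q
  for A :: "('a, 'm) ring_scheme" and \<eta> :: "'k \<Rightarrow> 'a"
    and P :: "('a, 'p, 'n) bimodule_scheme" and Q :: "('a, 'q, 'o) bimodule_scheme"
begin

abbreviation "Fr \<equiv> free_Abelian_group (carrier P \<times> carrier Q)"
abbreviation "Bal \<equiv> balancing A P Q"
abbreviation "PQ \<equiv> bimod_tensor A P Q"
abbreviation "ten \<equiv> tens A P Q"

lemma keys_diff_frag: "Poly_Mapping.keys (frag_of a - frag_of b - frag_of c) \<subseteq> {a, b, c}"
  "Poly_Mapping.keys (frag_of a - frag_of b) \<subseteq> {a, b}"
  using keys_diff[of "frag_of a - frag_of b" "frag_of c"] keys_diff[of "frag_of a" "frag_of b"] by auto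

text \<open>The generators of the subgroup \<^const>\<open>balancing\<close>.\<close>

definition bal_rels :: "('p \<times> 'q \<Rightarrow>\<^sub>0 int) set" where
  "bal_rels = {frag_of (x \<oplus>\<^bsub>P\<^esub> x', y) - frag_of (x, y) - frag_of (x', y) | x x' y.
         x \<in> carrier P \<and> x' \<in> carrier P \<and> y \<in> carrier Q}
      \<union> {frag_of (x, y \<oplus>\<^bsub>Q\<^esub> y') - frag_of (x, y) - frag_of (x, y') | x y y'.
         x \<in> carrier P \<and> y \<in> carrier Q \<and> y' \<in> carrier Q}
      \<union> {frag_of (ract P x a, y) - frag_of (x, lact Q a y) | x a y.
         x \<in> carrier P \<and> a \<in> carrier A \<and> y \<in> carrier Q}"

lemma Bal_eq: "Bal = generate Fr bal_rels"
  by (simp add: balancing_def bal_rels_def)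

lemma bal_rels_carrier: "bal_rels \<subseteq> carrier Fr"
proof
  fix r assume "r \<in> bal_rels"
  then show "r \<in> carrier Fr"
    unfolding bal_rels_def
  proof (elim UnE CollectE exE conjE, goal_cases)
    case (1 x x' y)
    then show ?thesis using order_trans[OF keys_diff_frag(1), of "(x \<oplus>\<^bsub>P\<^esub> x', y)"] by simp
  next
    case (2 x y y')
    then show ?thesis using order_trans[OF keys_diff_frag(1), of "(x, y \<oplus>\<^bsub>Q\<^esub> y')"] by simp
  next
    case (3 x a y)
    then show ?thesis using order_trans[OF keys_diff_frag(2), of "(ract P x a, y)"]
      by (simp add: P.ract_closed Q.lact_closed)
  qed
qed

lemma subgroup_Bal: "subgroup Bal Fr"
  unfolding Bal_eq by (rule group.generate_is_subgroup[OF group_free_Abelian_group bal_rels_carrier])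

lemma normal_Bal: "Bal \<lhd> Fr"
  by (rule comm_group.normal_iff_subgroup[OF abelian_free_Abelian_group, THEN iffD2, OF subgroup_Bal])

lemma add_monoid_PQ: "add_monoid PQ = Fr Mod Bal"
  by (simp add: bimod_tensor_def Let_def FactGroup_def)

lemma abelian_group_PQ: "abelian_group PQ"
proof -
  have "comm_group (add_monoid PQ)"
    unfolding add_monoid_PQ by (rule comm_group.abelian_FactGroup[OF abelian_free_Abelian_group subgroup_Bal])
  then show ?thesis
    using comm_group.axioms(1) by (intro abelian_group.intro abelian_monoid.intro abelian_group_axioms.intro)
qed

sublocale PQ: abelian_group PQ
  by (rule abelian_group_PQ)

lemma tens_closed: "x \<in> carrier P \<Longrightarrow> y \<in> carrier Q \<Longrightarrow> ten x y \<in> carrier PQ"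
  by (auto simp: bimod_tensor_def Let_def carrier_FactGroup tens_def)

lemma coset_add:
  assumes "Poly_Mapping.keys a \<subseteq> carrier P \<times> carrier Q" "Poly_Mapping.keys b \<subseteq> carrier P \<times> carrier Q"
  shows "(Bal #>\<^bsub>Fr\<^esub> a) \<oplus>\<^bsub>PQ\<^esub> (Bal #>\<^bsub>Fr\<^esub> b) = Bal #>\<^bsub>Fr\<^esub> (a + b)"
  using normal.rcos_sum[OF normal_Bal, of a b] assms by (simp add: bimod_tensor_def Let_def)

lemma coset_eqI:
  assumes "Poly_Mapping.keys a \<subseteq> carrier P \<times> carrier Q" "Poly_Mapping.keys b \<subseteq> carrier P \<times> carrier Q" "a - b \<in> bal_rels"
  shows "Bal #>\<^bsub>Fr\<^esub> a = Bal #>\<^bsub>Fr\<^esub> b"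
proof (rule group.coset_mult_inv1[OF group_free_Abelian_group])
  have "a - b \<in> Bal" unfolding Bal_eq by (rule generate.incl[OF assms(3)])
  then have "Bal #>\<^bsub>Fr\<^esub> (a - b) = Bal"
    using bal_rels_carrier assms(3) by (intro group.coset_join2[OF group_free_Abelian_group _ subgroup_Bal]) blast+
  then show "Bal #>\<^bsub>Fr\<^esub> (a \<otimes>\<^bsub>Fr\<^esub> inv\<^bsub>Fr\<^esub> b) = Bal" using assms by simp
qed (use assms subgroup.subset[OF subgroup_Bal] in auto)

lemma tens_add_left:
  assumes "x \<in> carrier P" "x' \<in> carrier P" "y \<in> carrier Q"
  shows "ten (x \<oplus>\<^bsub>P\<^esub> x') y = ten x y \<oplus>\<^bsub>PQ\<^esub> ten x' y"
proof -
  have "frag_of (x \<oplus>\<^bsub>P\<^esub> x', y) - (frag_of (x, y) + frag_of (x', y)) \<in> bal_rels"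
    using assms unfolding bal_rels_def diff_diff_eq[symmetric] by blast
  moreover have "Poly_Mapping.keys (frag_of (x, y) + frag_of (x', y)) \<subseteq> carrier P \<times> carrier Q"
    using keys_add[of "frag_of (x, y)" "frag_of (x', y)"] assms by auto
  ultimately show ?thesis
    unfolding tens_def using assms by (subst coset_add) (simp_all add: coset_eqI)
qed

lemma tens_add_right:
  assumes "x \<in> carrier P" "y \<in> carrier Q" "y' \<in> carrier Q"
  shows "ten x (y \<oplus>\<^bsub>Q\<^esub> y') = ten x y \<oplus>\<^bsub>PQ\<^esub> ten x y'"
proof -
  have "frag_of (x, y \<oplus>\<^bsub>Q\<^esub> y') - (frag_of (x, y) + frag_of (x, y')) \<in> bal_rels"
    using assms unfolding bal_rels_def diff_diff_eq[symmetric] by blast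
  moreover have "Poly_Mapping.keys (frag_of (x, y) + frag_of (x, y')) \<subseteq> carrier P \<times> carrier Q"
    using keys_add[of "frag_of (x, y)" "frag_of (x, y')"] assms by auto
  ultimately show ?thesis
    unfolding tens_def using assms by (subst coset_add) (simp_all add: coset_eqI)
qed

lemma tens_balanced:
  assumes "x \<in> carrier P" "a \<in> carrier A" "y \<in> carrier Q"
  shows "ten (ract P x a) y = ten x (lact Q a y)"
  unfolding tens_def
proof (rule coset_eqI)
  show "frag_of (ract P x a, y) - frag_of (x, lact Q a y) \<in> bal_rels"
    using assms unfolding bal_rels_def by blast
qed (use assms in \<open>simp_all add: P.ract_closed Q.lact_closed\<close>)

end

section \<open>Cup products\<close>

text \<open>The degrees of the two cochains are \<open>a = \<nu>(p)\<close> and \<open>b = \<nu>(q)\<close>. The locale \<open>sym_space\<close> comes first so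
  that its constants, which both cochains share, are available without qualifier.\<close>

locale sym_cup = sym_space scale e n N + F: sym_cochain scale e n N P a f + G: sym_cochain scale e n N Q b g
  for scale :: "'k::field \<Rightarrow> 'v::ab_group_add \<Rightarrow> 'v" and e :: "nat \<Rightarrow> 'v" and n N :: nat
    and P :: "(('k, 'v) tensor set, 'p) bimodule" and a f
    and Q :: "(('k, 'v) tensor set, 'q) bimodule" and b g
begin

sublocale bimodule_pair "sym_algebra scale N" "sym_scalar scale N" P Q
  by unfold_locales

definition cup_term where
  "cup_term u w v w' t = ten (ract P (lact P (sym_class u) (F.extension w)) (sym_class v)) (ract Q (G.extension w') (sym_class t))"

lemma cup_term_left_closed: "ract P (lact P (sym_class u) (F.extension w)) (sym_class v) \<in> carrier P"
  by (simp add: F.P.ract_closed F.P.lact_closed F.extension_closed)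

lemma cup_term_right_closed: "ract Q (G.extension w') (sym_class t) \<in> carrier Q"
  by (simp add: G.P.ract_closed G.extension_closed)

lemma cup_term_closed: "cup_term u w v w' t \<in> carrier PQ"
  by (simp add: cup_term_def tens_closed cup_term_left_closed cup_term_right_closed)

lemma cup_term_add:
  "cup_term (u + u') w v w' t = cup_term u w v w' t \<oplus>\<^bsub>PQ\<^esub> cup_term u' w v w' t"
  "cup_term u (w + x) v w' t = cup_term u w v w' t \<oplus>\<^bsub>PQ\<^esub> cup_term u x v w' t"
  "cup_term u w (v + v') w' t = cup_term u w v w' t \<oplus>\<^bsub>PQ\<^esub> cup_term u w v' w' t"
  "cup_term u w v (w' + x') t = cup_term u w v w' t \<oplus>\<^bsub>PQ\<^esub> cup_term u w v x' t"
  "cup_term u w v w' (t + t') = cup_term u w v w' t \<oplus>\<^bsub>PQ\<^esub> cup_term u w v w' t'"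
  unfolding cup_term_def
  by (simp_all add: A.add F.extension_add G.extension_add F.extension_closed G.extension_closed
      F.P.lact_closed F.P.ract_closed G.P.lact_closed G.P.ract_closed
      F.P.lact_add F.P.ract_add F.P.add_lact F.P.add_ract G.P.ract_add G.P.add_ract
      tens_add_left tens_add_right)

lemma cup_term_uminus: "cup_term (- u) w v w' t = \<ominus>\<^bsub>PQ\<^esub> cup_term u w v w' t"
proof -
  have "cup_term 0 w v w' t = \<zero>\<^bsub>PQ\<^esub>"
    using cup_term_add(1)[of 0 0] cup_term_closed[of 0] by (metis PQ.add.l_cancel_one' add_0)
  then show ?thesis
    using cup_term_add(1)[of "- u" u w v w' t] cup_term_closed by (simp add: PQ.minus_equality)
qed

text \<open>Scalars act in the same way on both sides of a bimodule and can be moved through the tensor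
  product over \<open>A\<close>; so a scalar may be collected from any of the five factors.\<close>

lemma cup_term_scalar:
  shows "cup_term u (single [] c * w) v w' t = cup_term (single [] c * u) w v w' t"
    and "cup_term u w (single [] c * v) w' t = cup_term (single [] c * u) w v w' t"
    and "cup_term u w v (single [] c * w') t = cup_term (single [] c * u) w v w' t"
    and "cup_term u w v w' (single [] c * t) = cup_term (single [] c * u) w v w' t"
proof -
  let ?c = "sym_class (single [] c)"
  have P: "lact P ?c x = ract P x ?c" if "x \<in> carrier P" for x
    using F.P.scalar[OF that] by (simp add: sym_scalar_eq)
  have Q: "lact Q ?c x = ract Q x ?c" if "x \<in> carrier Q" for x
    using G.P.scalar[OF that] by (simp add: sym_scalar_eq)
  have u: "lact P (sym_class (single [] c * u)) x = lact P ?c (lact P (sym_class u) x)"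
     "lact P (sym_class u) (lact P ?c x) = lact P ?c (lact P (sym_class u) x)" if "x \<in> carrier P" for x
  proof -
    show "lact P (sym_class (single [] c * u)) x = lact P ?c (lact P (sym_class u) x)"
      using that by (simp add: A.mult F.P.mult_lact)
    have "lact P (sym_class u) (lact P ?c x) = lact P (sym_class (u * single [] c)) x"
      using that by (simp add: A.mult F.P.mult_lact)
    then show "lact P (sym_class u) (lact P ?c x) = lact P ?c (lact P (sym_class u) x)"
      using that by (simp add: scalar_central A.mult F.P.mult_lact)
  qed
  show "cup_term u (single [] c * w) v w' t = cup_term (single [] c * u) w v w' t"
    unfolding cup_term_def by (simp add: F.extension_scalar u F.extension_closed)
  have v: "ract P x (sym_class (single [] c * v)) = ract P (lact P ?c x) (sym_class v)" if "x \<in> carrier P" for x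
    using that by (simp add: P A.mult F.P.mult_ract)
  show "cup_term u w (single [] c * v) w' t = cup_term (single [] c * u) w v w' t"
    unfolding cup_term_def by (simp add: v u(1) F.extension_closed F.P.lact_closed)
  have bal: "ten x (lact Q ?c y) = ten (lact P ?c x) y" if "x \<in> carrier P" "y \<in> carrier Q" for x y
    using that by (simp add: P tens_balanced)
  have left: "lact P ?c (ract P (lact P (sym_class u) x) (sym_class v)) = ract P (lact P (sym_class (single [] c * u)) x) (sym_class v)"
    if "x \<in> carrier P" for x
    using that by (simp add: u(1) F.P.lact_ract F.P.lact_closed)
  show "cup_term u w v (single [] c * w') t = cup_term (single [] c * u) w v w' t"
    unfolding cup_term_def left[OF F.extension_closed, symmetric]
    by (simp add: G.extension_scalar G.P.lact_ract G.extension_closed bal cup_term_left_closed cup_term_right_closed)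
  have t: "ract Q y (sym_class (single [] c * t)) = lact Q ?c (ract Q y (sym_class t))" if "y \<in> carrier Q" for y
    using that by (simp add: A.mult G.P.mult_ract G.P.lact_ract flip: Q)
  show "cup_term u w v w' (single [] c * t) = cup_term (single [] c * u) w v w' t"
    unfolding cup_term_def left[OF F.extension_closed, symmetric]
    by (simp add: t G.extension_closed bal cup_term_left_closed cup_term_right_closed)
qed

end

context sym_cup
begin

lemma finite_words: "finite {ws. set ws \<subseteq> \<B> \<and> length ws = m}"
  by (rule finite_lists_length_eq[OF finite_\<B>])

text \<open>The additive map determined by the value \<open>u f(w) v \<otimes> g(w') t\<close> on a basis word \<open>u w v w' t\<close> cut at the
  prescribed positions, with the coefficient attached to \<open>u\<close>. It is given on \<open>F\<close>, where words are
  linearly independent and nothing needs to be well-defined.\<close>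

definition cup_lin :: "nat \<Rightarrow> nat \<Rightarrow> nat \<Rightarrow> ('v list \<Rightarrow>\<^sub>0 'k) \<Rightarrow> ('p \<times> 'q \<Rightarrow>\<^sub>0 int) set" where
  "cup_lin i l j z = (\<Oplus>\<^bsub>PQ\<^esub>ws\<in>{ws. set ws \<subseteq> \<B> \<and> length ws = i + a + l + b + j}.
     cup_term (single (take i ws) (coeff z ws)) (single (take a (drop i ws)) 1) (single (take l (drop (i + a) ws)) 1)
       (single (take b (drop (i + a + l) ws)) 1) (single (drop (i + a + l + b) ws) 1))"

lemma cup_lin_closed: "cup_lin i l j z \<in> carrier PQ"
  unfolding cup_lin_def by (rule PQ.finsum_closed) (simp add: cup_term_closed)

lemma cup_lin_add: "cup_lin i l j (x + y) = cup_lin i l j x \<oplus>\<^bsub>PQ\<^esub> cup_lin i l j y"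
  unfolding cup_lin_def lookup_add single_add cup_term_add(1)
  by (rule PQ.finsum_addf) (simp_all add: cup_term_closed)

lemma cup_term_zero: "cup_term 0 w v w' t = \<zero>\<^bsub>PQ\<^esub>"
  using cup_term_add(1)[of 0 0] cup_term_closed[of 0] by (metis PQ.add.l_cancel_one' add_0)

lemma cup_lin_zero: "cup_lin i l j 0 = \<zero>\<^bsub>PQ\<^esub>"
  using cup_lin_add[of i l j 0 0] cup_lin_closed[of i l j 0] by (metis PQ.add.l_cancel_one' add_0)

lemma cup_lin_sum: "cup_lin i l j (sum h I) = (\<Oplus>\<^bsub>PQ\<^esub>s\<in>I. cup_lin i l j (h s))"
  by (induction I rule: infinite_finite_induct)
    (simp_all add: cup_lin_zero cup_lin_add cup_lin_closed PQ.finsum_infinite)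

lemma cup_lin_single:
  assumes "set us \<subseteq> \<B>" "length us = i" "set ws \<subseteq> \<B>" "length ws = a" "set vs \<subseteq> \<B>" "length vs = l"
    "set ws' \<subseteq> \<B>" "length ws' = b" "set ts \<subseteq> \<B>" "length ts = j"
  shows "cup_lin i l j (single (us @ ws @ vs @ ws' @ ts) c) =
     cup_term (single us c) (single ws 1) (single vs 1) (single ws' 1) (single ts 1)"
proof -
  let ?x = "us @ ws @ vs @ ws' @ ts"
  have x: "?x \<in> {ws. set ws \<subseteq> \<B> \<and> length ws = i + a + l + b + j}" using assms by auto
  have "cup_lin i l j (single ?x c) = (\<Oplus>\<^bsub>PQ\<^esub>y\<in>{ws. set ws \<subseteq> \<B> \<and> length ws = i + a + l + b + j}.
     if ?x = y then cup_term (single (take i y) c) (single (take a (drop i y)) 1) (single (take l (drop (i + a) y)) 1)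
       (single (take b (drop (i + a + l) y)) 1) (single (drop (i + a + l + b) y) 1) else \<zero>\<^bsub>PQ\<^esub>)"
    unfolding cup_lin_def
    by (rule PQ.finsum_cong') (auto simp: lookup_single when_def cup_term_closed cup_term_zero)
  also have "\<dots> = cup_term (single (take i ?x) c) (single (take a (drop i ?x)) 1) (single (take l (drop (i + a) ?x)) 1)
       (single (take b (drop (i + a + l) ?x)) 1) (single (drop (i + a + l + b) ?x) 1)"
    by (rule PQ.add.finprod_singleton[OF x finite_words]) (simp add: cup_term_closed)
  finally show ?thesis using assms by simp
qed

text \<open>Both sides are additive in each factor. For basis words the claim is the definition, up to
  collecting the scalars.\<close>

lemma cup_lin_mult:
  assumes u: "reduced u" "homog i u" and w: "reduced w" "homog a w" and v: "reduced v" "homog l v"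
    and w': "reduced w'" "homog b w'" and t: "reduced t" "homog j t"
  shows "cup_lin i l j (u * w * v * w' * t) = cup_term u w v w' t"
proof -
  have psi0: "cup_term u 0 v w' t = \<zero>\<^bsub>PQ\<^esub>" "cup_term u w 0 w' t = \<zero>\<^bsub>PQ\<^esub>" "cup_term u w v 0 t = \<zero>\<^bsub>PQ\<^esub>" "cup_term u w v w' 0 = \<zero>\<^bsub>PQ\<^esub>" for u w v w' t
    using cup_term_scalar(1)[of u 0 0 v w' t] cup_term_scalar(2)[of u w 0 0 w' t] cup_term_scalar(3)[of u w v 0 0 t]
      cup_term_scalar(4)[of u w v w' 0 0]
    by (simp_all add: cup_term_zero)
  have 1: "cup_lin i l j (single us c1 * single ws c2 * single vs c3 * single ws' c4 * single ts c5)
      = cup_term (single us c1) (single ws c2) (single vs c3) (single ws' c4) (single ts c5)"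
    if "us \<in> lists \<B>" "length us = i" "ws \<in> lists \<B>" "length ws = a" "vs \<in> lists \<B>" "length vs = l"
      "ws' \<in> lists \<B>" "length ws' = b" "ts \<in> lists \<B>" "length ts = j"
    for us ws vs ws' ts c1 c2 c3 c4 c5
  proof -
    have "cup_lin i l j (single us c1 * single ws c2 * single vs c3 * single ws' c4 * single ts c5)
      = cup_term (single us (c1 * c2 * c3 * c4 * c5)) (single ws 1) (single vs 1) (single ws' 1) (single ts 1)"
      using that by (simp add: mult_single_word cup_lin_single in_lists_conv_set subset_iff)
    also have "\<dots> = cup_term (single us c1) (single [] c2 * single ws 1) (single [] c3 * single vs 1)
        (single [] c4 * single ws' 1) (single [] c5 * single ts 1)"
      unfolding cup_term_scalar by (simp add: mult_single_word mult_ac)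
    finally show ?thesis by (simp add: mult_single_word)
  qed
  have 2: "cup_lin i l j (u * single ws c2 * single vs c3 * single ws' c4 * single ts c5)
      = cup_term u (single ws c2) (single vs c3) (single ws' c4) (single ts c5)"
    if "ws \<in> lists \<B>" "length ws = a" "vs \<in> lists \<B>" "length vs = l"
      "ws' \<in> lists \<B>" "length ws' = b" "ts \<in> lists \<B>" "length ts = j"
    for ws vs ws' ts c2 c3 c4 c5
    using u
  proof (induction rule: reduced_homog_induct)
    case (single us c)
    then show ?case using 1[OF _ _ that] by simp
  qed (simp_all add: distrib_right cup_lin_add cup_term_add(1) cup_lin_zero cup_term_zero)
  have 3: "cup_lin i l j (u * w * single vs c3 * single ws' c4 * single ts c5)
      = cup_term u w (single vs c3) (single ws' c4) (single ts c5)"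
    if "vs \<in> lists \<B>" "length vs = l" "ws' \<in> lists \<B>" "length ws' = b" "ts \<in> lists \<B>" "length ts = j"
    for vs ws' ts c3 c4 c5
    using w
  proof (induction rule: reduced_homog_induct)
    case (single us c)
    then show ?case using 2[OF _ _ that] by simp
  qed (simp_all add: distrib_right distrib_left cup_lin_add cup_term_add(2) cup_lin_zero psi0)
  have 4: "cup_lin i l j (u * w * v * single ws' c4 * single ts c5) = cup_term u w v (single ws' c4) (single ts c5)"
    if "ws' \<in> lists \<B>" "length ws' = b" "ts \<in> lists \<B>" "length ts = j" for ws' ts c4 c5
    using v
  proof (induction rule: reduced_homog_induct)
    case (single us c)
    then show ?case using 3[OF _ _ that] by simp
  qed (simp_all add: distrib_right distrib_left cup_lin_add cup_term_add(3) cup_lin_zero psi0)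
  have 5: "cup_lin i l j (u * w * v * w' * single ts c5) = cup_term u w v w' (single ts c5)"
    if "ts \<in> lists \<B>" "length ts = j" for ts c5
    using w'
  proof (induction rule: reduced_homog_induct)
    case (single us c)
    then show ?case using 4[OF _ _ that] by simp
  qed (simp_all add: distrib_right distrib_left cup_lin_add cup_term_add(4) cup_lin_zero psi0)
  show ?thesis using t
  proof (induction rule: reduced_homog_induct)
    case (single us c)
    then show ?case using 5 by simp
  qed (simp_all add: distrib_left cup_lin_add cup_term_add(5) cup_lin_zero psi0)
qed

abbreviation "cf \<equiv> koszul_cochain scale n e a f"
abbreviation "cg \<equiv> koszul_cochain scale n e b g"

lemma factor_value:
  assumes N: "2 \<le> N" and a: "a = 1 \<or> N \<le> a" and b: "b = 1 \<or> N \<le> b"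
    and mem: "u \<in> TP i" "w \<in> KS N a" "v \<in> TP l" "w' \<in> KS N b" "t \<in> TP j"
  shows "\<exists>\<zeta>. reduced \<zeta> \<and> u \<otimes>\<^bsub>TA\<^esub> w \<otimes>\<^bsub>TA\<^esub> v \<otimes>\<^bsub>TA\<^esub> w' \<otimes>\<^bsub>TA\<^esub> t = tc \<zeta> \<and>
     cup_lin i l j \<zeta> = tens SA P Q (ract P (lact P (sym_proj scale N u) (cf w)) (sym_proj scale N v))
                          (ract Q (cg w') (sym_proj scale N t))"
proof -
  from mem obtain u' v' t' where uvt: "homog i u'" "reduced u'" "u = tc u'" "homog l v'" "reduced v'" "v = tc v'"
    "homog j t'" "reduced t'" "t = tc t'" by (auto elim!: tensor_powerE)
  obtain x where x: "reduced x" "homog a x" "w = tc (ant_lin x)" by (rule koszul_spaceE[OF mem(2) N a])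
  obtain x' where x': "reduced x'" "homog b x'" "w' = tc (ant_lin x')" by (rule koszul_spaceE[OF mem(4) N b])
  let ?z = "u' * ant_lin x * v' * ant_lin x' * t'"
  have "cup_lin i l j ?z = cup_term u' (ant_lin x) v' (ant_lin x') t'"
    using uvt x x' by (intro cup_lin_mult reduced_ant_lin homog_ant_lin) auto
  moreover have "reduced ?z"
    using uvt x x' by (simp add: reduced_mult reduced_ant_lin)
  moreover have "u \<otimes>\<^bsub>TA\<^esub> w \<otimes>\<^bsub>TA\<^esub> v \<otimes>\<^bsub>TA\<^esub> w' \<otimes>\<^bsub>TA\<^esub> t = tc ?z"
    by (simp add: uvt x x' T.mult)
  ultimately show ?thesis
    using F.koszul_cochain_ant_lin[OF x(1,2)] G.koszul_cochain_ant_lin[OF x'(1,2)]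
    by (intro exI[of _ ?z]) (simp add: cup_term_def uvt x(3) x'(3) sym_class_def)
qed

text \<open>Here independence of the decomposition is established: the right-hand side mentions only
  \<open>\<zeta>\<close>, the representative of \<open>z\<close>.\<close>

lemma decomposition_value:
  assumes N: "2 \<le> N" and a: "a = 1 \<or> N \<le> a" and b: "b = 1 \<or> N \<le> b"
    and mem: "\<And>s. s < r \<Longrightarrow> u s \<in> TP i \<and> w s \<in> KS N a \<and> v s \<in> TP l \<and> w' s \<in> KS N b \<and> t s \<in> TP j"
    and z: "z = (\<Oplus>\<^bsub>TA\<^esub>s\<in>{..<r}. u s \<otimes>\<^bsub>TA\<^esub> w s \<otimes>\<^bsub>TA\<^esub> v s \<otimes>\<^bsub>TA\<^esub> w' s \<otimes>\<^bsub>TA\<^esub> t s)"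
    and y: "y = (\<Oplus>\<^bsub>PQ\<^esub>s\<in>{..<r::nat}.
               tens SA P Q (ract P (lact P (sym_proj scale N (u s)) (cf (w s))) (sym_proj scale N (v s)))
                          (ract Q (cg (w' s)) (sym_proj scale N (t s))))"
    and \<zeta>: "reduced \<zeta>" "z = tc \<zeta>"
  shows "y = cup_lin i l j \<zeta>"
proof -
  have "\<forall>s. \<exists>\<xi>. s < r \<longrightarrow> reduced \<xi> \<and> u s \<otimes>\<^bsub>TA\<^esub> w s \<otimes>\<^bsub>TA\<^esub> v s \<otimes>\<^bsub>TA\<^esub> w' s \<otimes>\<^bsub>TA\<^esub> t s = tc \<xi> \<and>
     cup_lin i l j \<xi> = tens SA P Q (ract P (lact P (sym_proj scale N (u s)) (cf (w s))) (sym_proj scale N (v s)))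
                          (ract Q (cg (w' s)) (sym_proj scale N (t s)))"
    using factor_value[OF N a b] mem by blast
  then obtain \<xi> where \<xi>: "\<And>s. s < r \<Longrightarrow> reduced (\<xi> s) \<and> u s \<otimes>\<^bsub>TA\<^esub> w s \<otimes>\<^bsub>TA\<^esub> v s \<otimes>\<^bsub>TA\<^esub> w' s \<otimes>\<^bsub>TA\<^esub> t s = tc (\<xi> s) \<and>
     cup_lin i l j (\<xi> s) = tens SA P Q (ract P (lact P (sym_proj scale N (u s)) (cf (w s))) (sym_proj scale N (v s)))
                          (ract Q (cg (w' s)) (sym_proj scale N (t s)))"
    by metis
  have "z = (\<Oplus>\<^bsub>TA\<^esub>s\<in>{..<r}. tc (\<xi> s))"
    unfolding z by (rule T.R.finsum_cong') (use \<xi> in auto)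
  then have "tc \<zeta> = tc (\<Sum>s<r. \<xi> s)" by (simp add: \<zeta> T.sum)
  moreover have "reduced (\<Sum>s<r. \<xi> s)" by (rule reduced_sum) (use \<xi> in auto)
  ultimately have "\<zeta> = (\<Sum>s<r. \<xi> s)" using \<zeta>(1) tc_reduced_inj by blast
  then have "cup_lin i l j \<zeta> = (\<Oplus>\<^bsub>PQ\<^esub>s\<in>{..<r}. cup_lin i l j (\<xi> s))" by (simp add: cup_lin_sum)
  also have "\<dots> = y"
    unfolding y
  proof (rule PQ.finsum_cong')
    show "(\<lambda>s. tens SA P Q (ract P (lact P (sym_proj scale N (u s)) (cf (w s))) (sym_proj scale N (v s)))
                          (ract Q (cg (w' s)) (sym_proj scale N (t s)))) \<in> {..<r} \<rightarrow> carrier PQ"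
    proof
      fix s assume "s \<in> {..<r}"
      then show "tens SA P Q (ract P (lact P (sym_proj scale N (u s)) (cf (w s))) (sym_proj scale N (v s)))
                          (ract Q (cg (w' s)) (sym_proj scale N (t s))) \<in> carrier PQ"
        using \<xi>[of s] cup_lin_closed[of i l j "\<xi> s"] by simp
    qed
  qed (use \<xi> in simp_all)
  finally show ?thesis by simp
qed

lemma apply_factors_eq:
  assumes N: "2 \<le> N" and a: "a = 1 \<or> N \<le> a" and b: "b = 1 \<or> N \<le> b"
    and mem: "\<And>s. s < r \<Longrightarrow> u s \<in> TP i \<and> w s \<in> KS N a \<and> v s \<in> TP l \<and> w' s \<in> KS N b \<and> t s \<in> TP j"
    and z: "z = (\<Oplus>\<^bsub>TA\<^esub>s\<in>{..<r}. u s \<otimes>\<^bsub>TA\<^esub> w s \<otimes>\<^bsub>TA\<^esub> v s \<otimes>\<^bsub>TA\<^esub> w' s \<otimes>\<^bsub>TA\<^esub> t s)"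
    and y: "y = (\<Oplus>\<^bsub>PQ\<^esub>s\<in>{..<r::nat}.
               tens SA P Q (ract P (lact P (sym_proj scale N (u s)) (cf (w s))) (sym_proj scale N (v s)))
                          (ract Q (cg (w' s)) (sym_proj scale N (t s))))"
  shows "apply_factors scale N P Q i a l b j cf cg z = y"
proof -
  have "z \<in> carrier TA"
    unfolding z
  proof (rule T.R.finsum_closed, rule funcsetI)
    fix s assume "s \<in> {..<r}"
    then show "u s \<otimes>\<^bsub>TA\<^esub> w s \<otimes>\<^bsub>TA\<^esub> v s \<otimes>\<^bsub>TA\<^esub> w' s \<otimes>\<^bsub>TA\<^esub> t s \<in> carrier TA"
      using factor_value[OF N a b, of "u s" i "w s" "v s" l "w' s" "t s" j] mem[of s] by auto
  qed
  then obtain z' where "z = tc z'" unfolding carrier_TA by blast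
  then have \<zeta>: "reduced (nf z')" "z = tc (nf z')" by (simp_all add: reduced_nf)
  show ?thesis
    unfolding apply_factors_def Let_def
  proof (rule the_equality)
    show "\<exists>(r::nat) u w v w' t.
        (\<forall>s<r. u s \<in> TP i \<and> w s \<in> KS N a \<and> v s \<in> TP l \<and> w' s \<in> KS N b \<and> t s \<in> TP j) \<and>
        z = (\<Oplus>\<^bsub>TA\<^esub>s\<in>{..<r}. u s \<otimes>\<^bsub>TA\<^esub> w s \<otimes>\<^bsub>TA\<^esub> v s \<otimes>\<^bsub>TA\<^esub> w' s \<otimes>\<^bsub>TA\<^esub> t s) \<and>
        y = (\<Oplus>\<^bsub>PQ\<^esub>s\<in>{..<r}.
               tens SA P Q (ract P (lact P (sym_proj scale N (u s)) (cf (w s))) (sym_proj scale N (v s)))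
                          (ract Q (cg (w' s)) (sym_proj scale N (t s))))"
      by (intro exI[of _ r] exI[of _ u] exI[of _ w] exI[of _ v] exI[of _ w'] exI[of _ t] conjI z y) (simp add: mem)
  next
    fix y' assume "\<exists>(r::nat) u w v w' t.
        (\<forall>s<r. u s \<in> TP i \<and> w s \<in> KS N a \<and> v s \<in> TP l \<and> w' s \<in> KS N b \<and> t s \<in> TP j) \<and>
        z = (\<Oplus>\<^bsub>TA\<^esub>s\<in>{..<r}. u s \<otimes>\<^bsub>TA\<^esub> w s \<otimes>\<^bsub>TA\<^esub> v s \<otimes>\<^bsub>TA\<^esub> w' s \<otimes>\<^bsub>TA\<^esub> t s) \<and>
        y' = (\<Oplus>\<^bsub>PQ\<^esub>s\<in>{..<r}.
               tens SA P Q (ract P (lact P (sym_proj scale N (u s)) (cf (w s))) (sym_proj scale N (v s)))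
                          (ract Q (cg (w' s)) (sym_proj scale N (t s))))"
    then show "y' = y"
    proof (elim exE conjE)
      fix r' :: nat and u2 w2 v2 w2' t2
      assume mem': "\<forall>s<r'. u2 s \<in> TP i \<and> w2 s \<in> KS N a \<and> v2 s \<in> TP l \<and> w2' s \<in> KS N b \<and> t2 s \<in> TP j"
        and z': "z = (\<Oplus>\<^bsub>TA\<^esub>s\<in>{..<r'}. u2 s \<otimes>\<^bsub>TA\<^esub> w2 s \<otimes>\<^bsub>TA\<^esub> v2 s \<otimes>\<^bsub>TA\<^esub> w2' s \<otimes>\<^bsub>TA\<^esub> t2 s)"
        and y': "y' = (\<Oplus>\<^bsub>PQ\<^esub>s\<in>{..<r'}.
               tens SA P Q (ract P (lact P (sym_proj scale N (u2 s)) (cf (w2 s))) (sym_proj scale N (v2 s)))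
                          (ract Q (cg (w2' s)) (sym_proj scale N (t2 s))))"
      have "y' = cup_lin i l j (nf z')"
        by (rule decomposition_value[OF N a b mem'[rule_format] z' y' \<zeta>])
      also have "\<dots> = y"
        by (rule decomposition_value[OF N a b mem z y \<zeta>, symmetric])
      finally show "y' = y" .
    qed
  qed
qed

lemma cup_term_sign:
  "cup_term (single us (of_int (sign \<tau>))) w v w' t = add_pow PQ (sign \<tau>) (cup_term (single us 1) w v w' t)"
proof (cases \<tau> rule: sign_cases)
  case even
  then show ?thesis using PQ.add.int_pow_1[OF cup_term_closed] by simp
next
  case odd
  have "add_pow PQ (- 1 :: int) (cup_term (single us 1) w v w' t) = \<ominus>\<^bsub>PQ\<^esub> cup_term (single us 1) w v w' t"
    by (simp add: add_pow_int_lt cup_term_closed)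
  then show ?thesis using odd by (simp add: single_uminus cup_term_uminus)
qed

text \<open>The shuffle decomposition is one admissible way of writing the antisymmetrized word, so it
  computes the value.\<close>

lemma apply_factors_ant:
  assumes N: "2 \<le> N" and a: "a = 1 \<or> N \<le> a" and b: "b = 1 \<or> N \<le> b"
    and m: "m = i + a + l + b + j"
  shows "apply_factors scale N P Q i a l b j cf cg (tc (ant (word x 1 m))) =
    (\<Oplus>\<^bsub>PQ\<^esub>\<tau>\<in>{\<tau>. \<tau> permutes {1..m} \<and> strict_mono_on {Suc i..i + a} \<tau> \<and>
           strict_mono_on {Suc (i + a + l)..i + a + l + b} \<tau>}.
      add_pow PQ (sign \<tau>) (tens SA P Q
        (ract P (lact P (sym_class (single (word (x \<circ> \<tau>) 1 i) 1)) (f (wedge scale (word (x \<circ> \<tau>) (Suc i) (i + a)))))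
                (sym_class (single (word (x \<circ> \<tau>) (Suc (i + a)) (i + a + l)) 1)))
        (ract Q (g (wedge scale (word (x \<circ> \<tau>) (Suc (i + a + l)) (i + a + l + b))))
                (sym_class (single (word (x \<circ> \<tau>) (Suc (i + a + l + b)) m) 1)))))"
  (is "?L = (\<Oplus>\<^bsub>PQ\<^esub>\<tau>\<in>?Sh. ?term \<tau>)")
    and "apply_factors scale N P Q i a l b j cf cg (tc (ant (word x 1 m))) \<in> carrier PQ"
proof -
  let ?u = "\<lambda>\<tau>. single (word (x \<circ> \<tau>) 1 i) (of_int (sign \<tau>) :: 'k)"
  let ?w = "\<lambda>\<tau>. word (x \<circ> \<tau>) (Suc i) (i + a)"
  let ?v = "\<lambda>\<tau>. single (word (x \<circ> \<tau>) (Suc (i + a)) (i + a + l)) (1 :: 'k)"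
  let ?w' = "\<lambda>\<tau>. word (x \<circ> \<tau>) (Suc (i + a + l)) (i + a + l + b)"
  let ?t = "\<lambda>\<tau>. single (word (x \<circ> \<tau>) (Suc (i + a + l + b)) m) (1 :: 'k)"
  let ?val = "\<lambda>\<tau>. tens SA P Q
      (ract P (lact P (sym_proj scale N (tc (?u \<tau>))) (cf (tc (ant (?w \<tau>))))) (sym_proj scale N (tc (?v \<tau>))))
      (ract Q (cg (tc (ant (?w' \<tau>)))) (sym_proj scale N (tc (?t \<tau>))))"
  have "finite ?Sh" by (rule finite_subset[OF _ finite_permutations[of "{1..m}"]]) auto
  then obtain h where h: "bij_betw h {..<card ?Sh} ?Sh"
    using ex_bij_betw_nat_finite[of ?Sh] by (auto simp: atLeast0LessThan)
  have val: "?val \<tau> = ?term \<tau> \<and> ?val \<tau> \<in> carrier PQ" for \<tau>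
  proof -
    have kc: "cf (tc (ant (?w \<tau>))) = f (wedge scale (?w \<tau>))" "cg (tc (ant (?w' \<tau>))) = g (wedge scale (?w' \<tau>))"
      by (simp_all add: F.koszul_cochain_ant G.koszul_cochain_ant)
    obtain y y' where y: "f (wedge scale (?w \<tau>)) = F.extension y" "g (wedge scale (?w' \<tau>)) = G.extension y'"
      using F.wedge_eq_extension[of "?w \<tau>"] G.wedge_eq_extension[of "?w' \<tau>"] by auto
    have "cup_term (?u \<tau>) y (?v \<tau>) y' (?t \<tau>) = add_pow PQ (sign \<tau>) (cup_term (single (word (x \<circ> \<tau>) 1 i) 1) y (?v \<tau>) y' (?t \<tau>))"
      by (rule cup_term_sign)
    then show ?thesis
      using cup_term_closed[of "?u \<tau>" y "?v \<tau>" y' "?t \<tau>"] by (simp add: kc y cup_term_def sym_class_def)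
  qed
  have sum: "(\<Oplus>\<^bsub>PQ\<^esub>\<tau>\<in>?Sh. ?term \<tau>) = (\<Oplus>\<^bsub>PQ\<^esub>s\<in>{..<card ?Sh}. ?val (h s))"
  proof -
    have "(\<Oplus>\<^bsub>PQ\<^esub>\<tau>\<in>?Sh. ?term \<tau>) = (\<Oplus>\<^bsub>PQ\<^esub>\<tau>\<in>h ` {..<card ?Sh}. ?val \<tau>)"
    proof (rule PQ.finsum_cong')
      show "?Sh = h ` {..<card ?Sh}" using h by (simp add: bij_betw_def)
      show "?val \<in> h ` {..<card ?Sh} \<rightarrow> carrier PQ" using val by blast
      show "?term \<tau> = ?val \<tau>" for \<tau> using val[of \<tau>] by simp
    qed
    also have "\<dots> = (\<Oplus>\<^bsub>PQ\<^esub>s\<in>{..<card ?Sh}. ?val (h s))"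
    proof (rule PQ.add.finprod_reindex)
      show "?val \<in> h ` {..<card ?Sh} \<rightarrow> carrier PQ" using val by blast
      show "inj_on h {..<card ?Sh}" using h by (simp only: bij_betw_def)
    qed
    finally show ?thesis .
  qed
  have dec: "tc (ant (word x 1 m)) = (\<Oplus>\<^bsub>TA\<^esub>s\<in>{..<card ?Sh}. tc (?u (h s)) \<otimes>\<^bsub>TA\<^esub> tc (ant (?w (h s))) \<otimes>\<^bsub>TA\<^esub> tc (?v (h s))
       \<otimes>\<^bsub>TA\<^esub> tc (ant (?w' (h s))) \<otimes>\<^bsub>TA\<^esub> tc (?t (h s)))"
    unfolding ant_blocks[OF m] T.sum[symmetric] T.mult[symmetric]
    by (subst sum.reindex_bij_betw[OF h, symmetric]) (rule refl)
  have mem: "tc (?u \<tau>) \<in> TP i \<and> tc (ant (?w \<tau>)) \<in> KS N a \<and> tc (?v \<tau>) \<in> TP l \<and>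
      tc (ant (?w' \<tau>)) \<in> KS N b \<and> tc (?t \<tau>) \<in> TP j" for \<tau>
    using m tc_ant_koszul_space[of "?w \<tau>"] tc_ant_koszul_space[of "?w' \<tau>"]
    by (auto intro!: tc_mem_power homog_single)
  show "?L = (\<Oplus>\<^bsub>PQ\<^esub>\<tau>\<in>?Sh. ?term \<tau>)" by (rule apply_factors_eq[OF N a b mem dec sum])
  moreover have "(\<Oplus>\<^bsub>PQ\<^esub>\<tau>\<in>?Sh. ?term \<tau>) \<in> carrier PQ"
    unfolding sum using val by (intro PQ.finsum_closed) blast
  ultimately show "?L \<in> carrier PQ" by simp
qed

end

section \<open>The shuffle formula\<close>

text \<open>For odd \<open>p\<close> and \<open>q\<close>, the term \<open>N - 2\<close> is the number of letters left over for the three outer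
  factors.\<close>

lemma nu_odd:
  assumes "2 \<le> N" "odd p" "odd q"
  shows "nu N (p + q) = nu N p + nu N q + N - 2"
proof -
  have "(p + q) div 2 = Suc (p div 2 + q div 2)" "(p + q) mod 2 = 0" "p mod 2 = 1" "q mod 2 = 1"
    using assms by presburger+
  then show ?thesis using assms(1) by (simp add: nu_def algebra_simps)
qed

lemma nu_add_imp_odd:
  assumes "nu N (p + q) \<noteq> nu N p + nu N q"
  shows "odd p \<and> odd q"
proof (rule ccontr)
  assume "\<not> (odd p \<and> odd q)"
  then have "(p + q) div 2 = p div 2 + q div 2" "(p + q) mod 2 = p mod 2 + q mod 2" by presburger+
  then show False using assms by (simp add: nu_def algebra_simps)
qed

lemma nu_odd_cases: "odd p \<Longrightarrow> nu N p = 1 \<or> N \<le> nu N p"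
  by (cases "p div 2") (auto simp: nu_def odd_iff_mod_2_eq_one)

theorem mainTheorem2:
  fixes scale :: "'k::field \<Rightarrow> 'v::ab_group_add \<Rightarrow> 'v"
    and e :: "nat \<Rightarrow> 'v"
    and n N p q :: nat
    and P :: "(('k, 'v) tensor set, 'p) bimodule"
    and Q :: "(('k, 'v) tensor set, 'q) bimodule"
    and f :: "('k, 'v) tensor set \<Rightarrow> 'p"
    and g :: "('k, 'v) tensor set \<Rightarrow> 'q"
    and x :: "nat \<Rightarrow> 'v"
    and s :: "nat \<Rightarrow> nat"
  defines "A \<equiv> sym_algebra scale N"
    and "\<eta> \<equiv> sym_scalar scale N"
    and "\<pi> \<equiv> (\<lambda>xs. sym_proj scale N (pure_tensor scale xs))"
    and "\<nu> \<equiv> nu N"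
  assumes "finite_dimensional_vector_space scale (e ` {1..n})"
    and "inj_on e {1..n}"
    and "2 \<le> n" and "2 \<le> N" and "N \<le> n"
    and "bimodule A \<eta> P" and "bimodule A \<eta> Q"
    and "\<nu> (p + q) \<noteq> \<nu> p + \<nu> q"
    and "klinear_on (exterior_algebra scale) (exterior_scale scale) (exterior_power scale (\<nu> p))
           P (\<lambda>c. lact P (\<eta> c)) f"
    and "klinear_on (exterior_algebra scale) (exterior_scale scale) (exterior_power scale (\<nu> q))
           Q (\<lambda>c. lact Q (\<eta> c)) g"
    and "strict_mono_on {1..\<nu> (p + q)} s" and "s ` {1..\<nu> (p + q)} \<subseteq> {1..n}"
    and "\<And>k. k \<in> {1..\<nu> (p + q)} \<Longrightarrow> x k = e (s k)"
  shows "koszul_cup scale N P Q p q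
           (koszul_cochain scale n e (\<nu> p) f) (koszul_cochain scale n e (\<nu> q) g)
           (phi scale n e (\<nu> (p + q)) (wedge scale (word x 1 (\<nu> (p + q))))) =
         \<ominus>\<^bsub>bimod_tensor A P Q\<^esub> finsum (bimod_tensor A P Q) (\<lambda>(i, j).
           \<Oplus>\<^bsub>bimod_tensor A P Q\<^esub>\<sigma>\<in>koszul_shuffles N p q i j.
             [sign \<sigma>] \<cdot>\<^bsub>bimod_tensor A P Q\<^esub>
               tens A P Q
                 (ract P
                   (lact P (\<pi> (word (\<lambda>k. x (\<sigma> k)) 1 i))
                     (f (wedge scale (word (\<lambda>k. x (\<sigma> k)) (i + 1) (i + \<nu> p)))))
                   (\<pi> (word (\<lambda>k. x (\<sigma> k)) (i + \<nu> p + 1) (\<nu> p + N - j - 2))))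
                 (ract Q
                   (g (wedge scale (word (\<lambda>k. x (\<sigma> k)) (\<nu> p + N - j - 1) (\<nu> p + \<nu> q + N - j - 2))))
                   (\<pi> (word (\<lambda>k. x (\<sigma> k)) (\<nu> p + \<nu> q + N - j - 1) (\<nu> (p + q))))))
           {(i, j). i + j \<le> N - 2}"
proof -
  have opq: "odd p" "odd q" using nu_add_imp_odd assms(12) unfolding \<nu>_def by blast+
  interpret S: sym_space scale e n N
    using assms(5,6) by (intro sym_space.intro based_space.intro)
  interpret C: sym_cup scale e n N P "\<nu> p" f Q "\<nu> q" g
    using assms(10,11,13,14) unfolding A_def \<eta>_def
    by (intro sym_cup.intro sym_cochain.intro sym_cochain_axioms.intro S.sym_space_axioms)
  have nu: "\<nu> (p + q) = \<nu> p + \<nu> q + N - 2"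
    unfolding \<nu>_def by (rule nu_odd[OF assms(8) opq])
  let ?m = "\<nu> (p + q)"
  have phi: "phi scale n e ?m (wedge scale (word x 1 ?m)) = S.tc (ant (word x 1 ?m))"
    unfolding S.wedge_eq by (subst S.phi_ext_class) (simp_all add: homog_single ant_lin_def flip: one_eq_single)
  have key: "apply_factors scale N P Q i (\<nu> p) (N - 2 - i - j) (\<nu> q) j C.cf C.cg (S.tc (ant (word x 1 ?m))) =
       (\<Oplus>\<^bsub>bimod_tensor A P Q\<^esub>\<sigma>\<in>koszul_shuffles N p q i j.
             add_pow (bimod_tensor A P Q) (sign \<sigma>) (
               tens A P Q
                 (ract P
                   (lact P (\<pi> (word (\<lambda>k. x (\<sigma> k)) 1 i))
                     (f (wedge scale (word (\<lambda>k. x (\<sigma> k)) (i + 1) (i + \<nu> p)))))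
                   (\<pi> (word (\<lambda>k. x (\<sigma> k)) (i + \<nu> p + 1) (\<nu> p + N - j - 2))))
                 (ract Q
                   (g (wedge scale (word (\<lambda>k. x (\<sigma> k)) (\<nu> p + N - j - 1) (\<nu> p + \<nu> q + N - j - 2))))
                   (\<pi> (word (\<lambda>k. x (\<sigma> k)) (\<nu> p + \<nu> q + N - j - 1) (\<nu> (p + q)))))))"
      "apply_factors scale N P Q i (\<nu> p) (N - 2 - i - j) (\<nu> q) j C.cf C.cg (S.tc (ant (word x 1 ?m)))
         \<in> carrier (bimod_tensor A P Q)"
    if ij: "i + j \<le> N - 2" for i j
  proof -
    let ?l = "N - 2 - i - j"
    have idx: "?m = i + \<nu> p + ?l + \<nu> q + j" "\<nu> p + N - j - 2 = i + \<nu> p + ?l"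
      "\<nu> p + N - j - 1 = Suc (i + \<nu> p + ?l)" "\<nu> p + \<nu> q + N - j - 2 = i + \<nu> p + ?l + \<nu> q"
      "\<nu> p + \<nu> q + N - j - 1 = Suc (i + \<nu> p + ?l + \<nu> q)"
      using ij assms(8) nu by auto
    have idx': "i + 1 = Suc i" "i + \<nu> p + 1 = Suc (i + \<nu> p)" by simp_all
    have sh: "koszul_shuffles N p q i j = {\<tau>. \<tau> permutes {1..?m} \<and> strict_mono_on {Suc i..i + \<nu> p} \<tau> \<and>
           strict_mono_on {Suc (i + \<nu> p + ?l)..i + \<nu> p + ?l + \<nu> q} \<tau>}"
      unfolding koszul_shuffles_def \<nu>_def[symmetric] idx(3,4) idx' ..
    have cases: "\<nu> p = 1 \<or> N \<le> \<nu> p" "\<nu> q = 1 \<or> N \<le> \<nu> q"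
      unfolding \<nu>_def using nu_odd_cases opq by blast+
    note main = C.apply_factors_ant[OF assms(8) cases idx(1), of x]
    have pi: "\<pi> = (\<lambda>xs. S.sym_class (single xs 1))"
      by (simp add: \<pi>_def S.sym_class_def S.pure_tensor_eq)
    show "apply_factors scale N P Q i (\<nu> p) ?l (\<nu> q) j C.cf C.cg (S.tc (ant (word x 1 ?m))) =
       (\<Oplus>\<^bsub>bimod_tensor A P Q\<^esub>\<sigma>\<in>koszul_shuffles N p q i j.
             add_pow (bimod_tensor A P Q) (sign \<sigma>) (
               tens A P Q
                 (ract P
                   (lact P (\<pi> (word (\<lambda>k. x (\<sigma> k)) 1 i))
                     (f (wedge scale (word (\<lambda>k. x (\<sigma> k)) (i + 1) (i + \<nu> p)))))
                   (\<pi> (word (\<lambda>k. x (\<sigma> k)) (i + \<nu> p + 1) (\<nu> p + N - j - 2))))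
                 (ract Q
                   (g (wedge scale (word (\<lambda>k. x (\<sigma> k)) (\<nu> p + N - j - 1) (\<nu> p + \<nu> q + N - j - 2))))
                   (\<pi> (word (\<lambda>k. x (\<sigma> k)) (\<nu> p + \<nu> q + N - j - 1) (\<nu> (p + q)))))))"
      unfolding sh idx(2-5) idx' pi A_def using main(1) unfolding comp_def .
    show "apply_factors scale N P Q i (\<nu> p) ?l (\<nu> q) j C.cf C.cg (S.tc (ant (word x 1 ?m)))
         \<in> carrier (bimod_tensor A P Q)"
      unfolding A_def by (rule main(2))
  qed
  show ?thesis
    unfolding koszul_cup_def Let_def phi A_def[symmetric] \<nu>_def[symmetric]
    apply (simp only: opq simp_thms if_True)
    apply (rule arg_cong[where f = "a_inv (bimod_tensor A P Q)"])
    apply (rule abelian_monoid.finsum_cong'[OF abelian_group.axioms(1)])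
    subgoal using C.abelian_group_PQ unfolding A_def .
    subgoal ..
    subgoal using key by auto
    subgoal using key by auto
    done
qed

end
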